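(* Let $\mathbb{F}$ be a field with $|\mathbb{F}|>2$, let $n\ge 3$, and let $V$ be an $n$-dimensional $\mathbb{F}$-vector space, $G=GL(V)$. (1) If $\operatorname{char}\mathbb{F}\ne 2$ and $\operatorname{char}\mathbb{F}\nmid n+1$, then $\boldsymbol{\Lambda}=\mathcal{N}\oplus\mathcal{M}^{\ast\ast}$, $\boldsymbol{\Lambda}/\mathcal{M}^{\ast\ast}$ is $G$-isomorphic to $\mathcal{N}$, and $\mathcal{N}$ is irreducible. (2) If $\operatorname{char}\mathbb{F}\ne 2$ and $\operatorname{char}\mathbb{F}\mid n+1$, then $\mathcal{N}\cap\mathcal{M}^{\ast\ast}=\mathcal{M}^{\ast}_{(1,1)}$, $(\mathcal{N}+\mathcal{M}^{\ast\ast})/\mathcal{M}^{\ast\ast}$ is irreducible and $G$-isomorphic to $\mathcal{N}/\mathcal{M}^{\ast}_{(1,1)}$, $\boldsymbol{\Lambda}/(\mathcal{N}+\mathcal{M}^{\ast\ast})$ is $G$-isomorphic to $\widehat V$, and $\boldsymbol{\Lambda}/\mathcal{M}^{\ast\ast}$ is not $G$-isomorphic to $\mathcal{N}$. (3) If $\operatorname{char}\mathbb{F}=2$, then $\mathcal{N}\cap\mathcal{M}^{\ast\ast}=\mathcal{U}$, $(\mathcal{N}+\mathcal{M}^{\ast\ast})/\mathcal{M}^{\ast\ast}\simeq\mathcal{N}/\mathcal{U}$ is irreducible, and $(\mathcal{N}+\mathcal{M}^{\ast\ast})/\mathcal{N}\simeq\mathcal{M}^{\ast\ast}/\mathcal{U}$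 has precisely two composition factors, both $G$-isomorphic to $\widehat V$. If moreover $n$ is even, then $\boldsymbol{\Lambda}/(\mathcal{N}+\mathcal{M}^{\ast\ast})$ is irreducible and $G$-isomorphic to $\mathcal{U}$. If instead $n$ is odd, then $\boldsymbol{\Lambda}/(\mathcal{N}+\mathcal{M}^{\ast\ast})$ has precisely two composition factors, which are (up to $G$-isomorphism) exactly the two composition factors of $\mathcal{U}$; and $\mathcal{N}+\mathcal{M}^{\ast\ast}\subset(\mathcal{T}\cap\widetilde{\mathcal{T}})+\mathcal{M}^{\ast\ast}\subset\boldsymbol{\Lambda}$ are proper inclusions with both successive quotients irreducible $G$-modules. In all cases, $\boldsymbol{\Lambda}/\mathcal{M}^{\ast\ast}$ and $\mathcal{N}$ have the same composition factors (up to $G$-isomorphism, with multiplicity).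
   Context: $V$ is an $n$-dimensional vector space over $\mathbb{F}$ with a fixed basis $v_1,\dots,v_n$; $G=GL(V)$ acts on $V$ on the left. The dual space $\widehat V$ is a right $G$-module via $(\varphi g)(v)=\varphi(gv)$. $\boldsymbol{\Lambda}=\mathbb{F}^{n^3}$ is the space of structure vectors $\boldsymbol{\lambda}=(\lambda_{ijk})_{1\le i,j,k\le n}$; such a vector corresponds to the (not necessarily associative) algebra on $V$ whose bilinear product is $[v_i,v_j]=\sum_k\lambda_{ijk}v_k$. $G$ acts linearly on $\boldsymbol{\Lambda}$ on the right: $\boldsymbol{\lambda}g$ is the structure vector of the product $[u,v]'=g^{-1}[gu,gv]$. $G$-submodules of $\boldsymbol{\Lambda}$ are with respect to this action. Define the following $G$-submodules of $\boldsymbol{\Lambda}$ (where $[\,,\,]$ is the product with structure vector $\boldsymbol{\lambda}$): $\mathcal{C}$ = all $\boldsymbol{\lambda}$ with $[u,v]=[v,u]$ for all $u,v\in V$; $\mathcal{K}$ = all $\boldsymbol{\lambda}$ with $[v,v]=0$ for all $v\in V$; $\mathcal{T}$ = all $\boldsymbol{\lambda}$ such that for every $u\in V$ the linear map $v\mapsto[u,v]$ has trace $0$; $\widetilde{\mathcal{T}}$ = all $\boldsymbol{\lambda}$ such that for every $u\in V$ the linear map $v\mapsto[v,u]$ has trace $0$; $\mathcal{U}=\mathcal{K}\cap\mathcal{T}$ and $\mathcal{N}=\mathcal{C}\cap\mathcal{T}$; $\mathcal{M}^{\ast\ast}$ = all $\boldsymbol{\lambda}$ with $[v,v]\in\mathbb{F}v$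 for all $v\in V$; $\mathcal{M}^{\ast}_{(1,1)}$ = all structure vectors of products of the form $[u,v]=\theta(v)u+\theta(u)v$ with $\theta\in\widehat V$. Characteristic $0$ is regarded as not dividing any nonzero integer. *)

theory Defs
  imports "HOL-Analysis.Analysis"
begin

text \<open>The scalars are the whole type \<^typ>\<open>'f\<close>; the acting group is a set
  of elements of \<^typ>\<open>'g\<close> and is passed separately, as the first argument \<open>G\<close> below.\<close>

record ('f, 'g, 'm) gmod =
  gcarrier :: "'m set"
  gzero :: 'm
  gadd :: "'m \<Rightarrow> 'm \<Rightarrow> 'm"
  gsmult :: "'f \<Rightarrow> 'm \<Rightarrow> 'm"
  gact :: "'m \<Rightarrow> 'g \<Rightarrow> 'm"

definition gsubmodule :: "'g set \<Rightarrow> ('f, 'g, 'm) gmod \<Rightarrow> 'm set \<Rightarrow> bool" where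
  "gsubmodule G M S \<longleftrightarrow>
     S \<subseteq> gcarrier M \<and> gzero M \<in> S \<and>
     (\<forall>x\<in>S. \<forall>y\<in>S. gadd M x y \<in> S) \<and>
     (\<forall>c. \<forall>x\<in>S. gsmult M c x \<in> S) \<and>
     (\<forall>g\<in>G. \<forall>x\<in>S. gact M x g \<in> S)"

definition grestrict :: "('f, 'g, 'm) gmod \<Rightarrow> 'm set \<Rightarrow> ('f, 'g, 'm) gmod" where
  "grestrict M S = M\<lparr>gcarrier := S\<rparr>"

definition gcoset :: "('f, 'g, 'm) gmod \<Rightarrow> 'm set \<Rightarrow> 'm \<Rightarrow> 'm set" where
  "gcoset M S x = (\<lambda>s. gadd M x s) ` S"

text \<open>In the quotient, scalar multiplication adds \<open>S\<close> again because multiplying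
  a coset elementwise by the scalar 0 would not give a full coset.\<close>

definition gquot :: "('f, 'g, 'm) gmod \<Rightarrow> 'm set \<Rightarrow> ('f, 'g, 'm set) gmod" where
  "gquot M S =
     \<lparr>gcarrier = gcoset M S ` gcarrier M,
      gzero = S,
      gadd = (\<lambda>X Y. {gadd M x y | x y. x \<in> X \<and> y \<in> Y}),
      gsmult = (\<lambda>c X. {gadd M (gsmult M c x) s | x s. x \<in> X \<and> s \<in> S}),
      gact = (\<lambda>X g. (\<lambda>x. gact M x g) ` X)\<rparr>"

definition giso :: "'g set \<Rightarrow> ('f, 'g, 'm) gmod \<Rightarrow> ('f, 'g, 'k) gmod \<Rightarrow> bool" where
  "giso G M N \<longleftrightarrow>
     (\<exists>f. bij_betw f (gcarrier M) (gcarrier N) \<and>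
        (\<forall>x\<in>gcarrier M. \<forall>y\<in>gcarrier M. f (gadd M x y) = gadd N (f x) (f y)) \<and>
        (\<forall>c. \<forall>x\<in>gcarrier M. f (gsmult M c x) = gsmult N c (f x)) \<and>
        (\<forall>g\<in>G. \<forall>x\<in>gcarrier M. f (gact M x g) = gact N (f x) g))"

definition girreducible :: "'g set \<Rightarrow> ('f, 'g, 'm) gmod \<Rightarrow> bool" where
  "girreducible G M \<longleftrightarrow>
     gcarrier M \<noteq> {gzero M} \<and>
     (\<forall>S. gsubmodule G M S \<longrightarrow> S = {gzero M} \<or> S = gcarrier M)"

definition comp_factor :: "('f, 'g, 'm) gmod \<Rightarrow> (nat \<Rightarrow> 'm set) \<Rightarrow> nat \<Rightarrow> ('f, 'g, 'm set) gmod" where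
  "comp_factor M S i = gquot (grestrict M (S (Suc i))) (S i)"

definition comp_series :: "'g set \<Rightarrow> ('f, 'g, 'm) gmod \<Rightarrow> nat \<Rightarrow> (nat \<Rightarrow> 'm set) \<Rightarrow> bool" where
  "comp_series G M k S \<longleftrightarrow>
     S 0 = {gzero M} \<and> S k = gcarrier M \<and>
     (\<forall>i\<le>k. gsubmodule G M (S i)) \<and>
     (\<forall>i<k. S i \<subset> S (Suc i) \<and> girreducible G (comp_factor M S i))"

text \<open>By the Jordan-Hoelder theorem the following two notions do not depend
  on the composition series chosen.\<close>

definition has_comp_length :: "'g set \<Rightarrow> ('f, 'g, 'm) gmod \<Rightarrow> nat \<Rightarrow> bool" where
  "has_comp_length G M k \<longleftrightarrow> (\<exists>S. comp_series G M k S)"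

definition same_comp_factors :: "'g set \<Rightarrow> ('f, 'g, 'm) gmod \<Rightarrow> ('f, 'g, 'k) gmod \<Rightarrow> bool" where
  "same_comp_factors G M N \<longleftrightarrow>
     (\<exists>k S T \<pi>. comp_series G M k S \<and> comp_series G N k T \<and>
        bij_betw \<pi> {..<k} {..<k} \<and>
        (\<forall>i<k. giso G (comp_factor M S i) (comp_factor N T (\<pi> i))))"

text \<open>Throughout, \<open>sc\<close> is the scalar multiplication of the vector space \<open>V\<close>, which is all
  of \<^typ>\<open>'v\<close>, and \<open>v\<close> is its basis, indexed by the finite type \<^typ>\<open>'n\<close>.
  The space of structure vectors is \<^typ>\<open>'a ^ ('n \<times> 'n \<times> 'n)\<close>.\<close>

type_synonym ('a, 'n) svec = "'a ^ ('n \<times> 'n \<times> 'n)"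

definition coord :: "('a::field \<Rightarrow> 'v::ab_group_add \<Rightarrow> 'v) \<Rightarrow> ('n::finite \<Rightarrow> 'v) \<Rightarrow> 'v \<Rightarrow> 'n \<Rightarrow> 'a" where
  "coord sc v u i = module.representation sc (range v) u (v i)"

definition alg_prod ::
  "('a::field \<Rightarrow> 'v::ab_group_add \<Rightarrow> 'v) \<Rightarrow> ('n::finite \<Rightarrow> 'v) \<Rightarrow> ('a, 'n) svec \<Rightarrow> 'v \<Rightarrow> 'v \<Rightarrow> 'v" where
  "alg_prod sc v x u w =
     (\<Sum>i\<in>UNIV. \<Sum>j\<in>UNIV. \<Sum>k\<in>UNIV. sc (coord sc v u i * coord sc v w j * x $ (i, j, k)) (v k))"

definition struct_vec ::
  "('a::field \<Rightarrow> 'v::ab_group_add \<Rightarrow> 'v) \<Rightarrow> ('n::finite \<Rightarrow> 'v) \<Rightarrow> ('v \<Rightarrow> 'v \<Rightarrow> 'v) \<Rightarrow> ('a, 'n) svec" where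
  "struct_vec sc v p = vec_lambda (\<lambda>(i, j, k). coord sc v (p (v i) (v j)) k)"

definition GL :: "('a::field \<Rightarrow> 'v::ab_group_add \<Rightarrow> 'v) \<Rightarrow> ('v \<Rightarrow> 'v) set" where
  "GL sc = {g. Vector_Spaces.linear sc sc g \<and> bij g}"

definition svec_act ::
  "('a::field \<Rightarrow> 'v::ab_group_add \<Rightarrow> 'v) \<Rightarrow> ('n::finite \<Rightarrow> 'v) \<Rightarrow> ('a, 'n) svec \<Rightarrow> ('v \<Rightarrow> 'v) \<Rightarrow> ('a, 'n) svec" where
  "svec_act sc v x g = struct_vec sc v (\<lambda>u w. inv g (alg_prod sc v x (g u) (g w)))"

definition svec_module ::
  "('a::field \<Rightarrow> 'v::ab_group_add \<Rightarrow> 'v) \<Rightarrow> ('n::finite \<Rightarrow> 'v) \<Rightarrow> ('a, 'v \<Rightarrow> 'v, ('a, 'n) svec) gmod" where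
  "svec_module sc v =
     \<lparr>gcarrier = UNIV, gzero = 0, gadd = (+), gsmult = (*s), gact = svec_act sc v\<rparr>"

definition dual_module ::
  "('a::field \<Rightarrow> 'v::ab_group_add \<Rightarrow> 'v) \<Rightarrow> ('a, 'v \<Rightarrow> 'v, 'v \<Rightarrow> 'a) gmod" where
  "dual_module sc =
     \<lparr>gcarrier = {\<phi>. Vector_Spaces.linear sc (*) \<phi>},
      gzero = (\<lambda>u. 0),
      gadd = (\<lambda>\<phi> \<psi> u. \<phi> u + \<psi> u),
      gsmult = (\<lambda>c \<phi> u. c * \<phi> u),
      gact = (\<lambda>\<phi> g u. \<phi> (g u))\<rparr>"

definition lin_trace ::
  "('a::field \<Rightarrow> 'v::ab_group_add \<Rightarrow> 'v) \<Rightarrow> ('n::finite \<Rightarrow> 'v) \<Rightarrow> ('v \<Rightarrow> 'v) \<Rightarrow> 'a" where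
  "lin_trace sc v f = trace (\<chi> i j. coord sc v (f (v j)) i)"

definition mod_C ::
  "('a::field \<Rightarrow> 'v::ab_group_add \<Rightarrow> 'v) \<Rightarrow> ('n::finite \<Rightarrow> 'v) \<Rightarrow> ('a, 'n) svec set" where
  "mod_C sc v = {x. \<forall>u w. alg_prod sc v x u w = alg_prod sc v x w u}"

definition mod_K ::
  "('a::field \<Rightarrow> 'v::ab_group_add \<Rightarrow> 'v) \<Rightarrow> ('n::finite \<Rightarrow> 'v) \<Rightarrow> ('a, 'n) svec set" where
  "mod_K sc v = {x. \<forall>u. alg_prod sc v x u u = 0}"

definition mod_T ::
  "('a::field \<Rightarrow> 'v::ab_group_add \<Rightarrow> 'v) \<Rightarrow> ('n::finite \<Rightarrow> 'v) \<Rightarrow> ('a, 'n) svec set" where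
  "mod_T sc v = {x. \<forall>u. lin_trace sc v (\<lambda>w. alg_prod sc v x u w) = 0}"

definition mod_T_tilde ::
  "('a::field \<Rightarrow> 'v::ab_group_add \<Rightarrow> 'v) \<Rightarrow> ('n::finite \<Rightarrow> 'v) \<Rightarrow> ('a, 'n) svec set" where
  "mod_T_tilde sc v = {x. \<forall>u. lin_trace sc v (\<lambda>w. alg_prod sc v x w u) = 0}"

definition mod_U ::
  "('a::field \<Rightarrow> 'v::ab_group_add \<Rightarrow> 'v) \<Rightarrow> ('n::finite \<Rightarrow> 'v) \<Rightarrow> ('a, 'n) svec set" where
  "mod_U sc v = mod_K sc v \<inter> mod_T sc v"

definition mod_N ::
  "('a::field \<Rightarrow> 'v::ab_group_add \<Rightarrow> 'v) \<Rightarrow> ('n::finite \<Rightarrow> 'v) \<Rightarrow> ('a, 'n) svec set" where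
  "mod_N sc v = mod_C sc v \<inter> mod_T sc v"

definition mod_Mss ::
  "('a::field \<Rightarrow> 'v::ab_group_add \<Rightarrow> 'v) \<Rightarrow> ('n::finite \<Rightarrow> 'v) \<Rightarrow> ('a, 'n) svec set" where
  "mod_Mss sc v = {x. \<forall>u. \<exists>c. alg_prod sc v x u u = sc c u}"

definition mod_Ms11 ::
  "('a::field \<Rightarrow> 'v::ab_group_add \<Rightarrow> 'v) \<Rightarrow> ('n::finite \<Rightarrow> 'v) \<Rightarrow> ('a, 'n) svec set" where
  "mod_Ms11 sc v =
     {struct_vec sc v (\<lambda>u w. sc (\<theta> w) u + sc (\<theta> u) w) | \<theta>. Vector_Spaces.linear sc (*) \<theta>}"

end

(* The lattice of submodules is controlled by transvections. Expanding x.tv(t phi, a) - x in powers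
   of t and using a scalar t distinct from 0 and 1, one extracts the quadratic part, and from it
   shows that any submodule not contained in Mss contains N, whatever the characteristic. Hence
   N/(N meet Mss) = (N + Mss)/Mss is always irreducible. In characteristic 2 the same extraction
   inside K shows that a submodule of K not contained in W = Ms11 contains U. The other factors
   are copies of V_hat, obtained from traces or from [v,v] = theta(v) v; in characteristic 2 the map
   x |-> [u,w] + [w,u] carries Lambda onto K with kernel C and transports the chain W, U, K to
   N + Mss, (T meet T_tilde) + Mss, Lambda. *)

theory Submission
  imports Defs
begin

text \<open>The quadratic part is the right target because \<open>x.g - x\<close> for
  \<open>g = tv (s \<phi>) a\<close> is a cubic polynomial s L + s^2 Q + s^3 R without constant
  term. When R vanishes or already lies in the submodule, subtracting t times the value at 1 from
  the value at t leaves (t^2 - t) Q. One scalar outside {0, 1} thus replaces any division by 2, so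
  that one argument serves all characteristics. The integer n + 1 enters through a single
  computation: for the products in \<open>W\<close>, the map [u, .] = \<theta>(.) u + \<theta>(u) id
  has trace (n + 1) \<theta>(u). So \<open>W\<close> lies in \<open>T\<close> when n + 1 = 0 in the
  field and meets \<open>T\<close> only in 0 otherwise; this separates the cases, including the
  parity of n in characteristic 2. Quotients are handled through epimorphisms with a named kernel:
  two of them with the same source and kernel have isomorphic targets, and irreducibility of B/A
  becomes the absence of submodules strictly between A and B. All chains then live inside \<Lambda>,
  and the set-theoretic form of cosets matters in one lemma only.\<close>

section \<open>Group modules given by records\<close>

text \<open>The record has no negation, so inverses are expressed with the scalar -1.
  \<open>act_inverse\<close> asks only that each action map be undone by another one; this gives
  surjectivity of the action on submodules.\<close>

locale gmodule =
  fixes G :: "'g set" and M :: "('f::field, 'g, 'm) gmod"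
  assumes zero_closed: "gzero M \<in> gcarrier M"
    and add_closed: "\<lbrakk>x \<in> gcarrier M; y \<in> gcarrier M\<rbrakk> \<Longrightarrow> gadd M x y \<in> gcarrier M"
    and smult_closed: "x \<in> gcarrier M \<Longrightarrow> gsmult M c x \<in> gcarrier M"
    and act_closed: "\<lbrakk>g \<in> G; x \<in> gcarrier M\<rbrakk> \<Longrightarrow> gact M x g \<in> gcarrier M"
    and add_comm: "\<lbrakk>x \<in> gcarrier M; y \<in> gcarrier M\<rbrakk> \<Longrightarrow> gadd M x y = gadd M y x"
    and add_assoc: "\<lbrakk>x \<in> gcarrier M; y \<in> gcarrier M; z \<in> gcarrier M\<rbrakk>
      \<Longrightarrow> gadd M (gadd M x y) z = gadd M x (gadd M y z)"
    and add_zero: "x \<in> gcarrier M \<Longrightarrow> gadd M x (gzero M) = x"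
    and add_neg: "x \<in> gcarrier M \<Longrightarrow> gadd M x (gsmult M (- 1) x) = gzero M"
    and smult_add: "\<lbrakk>x \<in> gcarrier M; y \<in> gcarrier M\<rbrakk>
      \<Longrightarrow> gsmult M c (gadd M x y) = gadd M (gsmult M c x) (gsmult M c y)"
    and act_add: "\<lbrakk>g \<in> G; x \<in> gcarrier M; y \<in> gcarrier M\<rbrakk>
      \<Longrightarrow> gact M (gadd M x y) g = gadd M (gact M x g) (gact M y g)"
    and act_smult: "\<lbrakk>g \<in> G; x \<in> gcarrier M\<rbrakk> \<Longrightarrow> gact M (gsmult M c x) g = gsmult M c (gact M x g)"
    and act_inverse: "g \<in> G \<Longrightarrow> \<exists>h\<in>G. \<forall>x\<in>gcarrier M. gact M (gact M x h) g = x"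
begin

lemma cancel:
  assumes "x \<in> gcarrier M" "y \<in> gcarrier M" "z \<in> gcarrier M" "gadd M x y = gadd M x z"
  shows "y = z"
proof -
  have "w = gadd M (gsmult M (- 1) x) (gadd M x w)" if "w \<in> gcarrier M" for w
  proof -
    have "gadd M (gsmult M (- 1) x) (gadd M x w) = gadd M (gadd M (gsmult M (- 1) x) x) w"
      using assms(1) that by (simp add: add_assoc smult_closed)
    also have "\<dots> = w"
      using assms(1) that by (metis add_comm add_neg add_zero smult_closed zero_closed)
    finally show ?thesis ..
  qed
  then show ?thesis using assms by metis
qed

lemma add_diff:
  assumes "x \<in> gcarrier M" "y \<in> gcarrier M"
  shows "gadd M y (gadd M x (gsmult M (- 1) y)) = x"
  using assms by (metis add_assoc add_comm add_neg add_zero smult_closed)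

lemma smult_zero: "gsmult M c (gzero M) = gzero M"
  by (metis cancel add_zero smult_add smult_closed zero_closed)

lemma act_zero: "g \<in> G \<Longrightarrow> gact M (gzero M) g = gzero M"
  by (metis cancel add_zero act_add act_closed zero_closed)

lemma subset_carrier: "gsubmodule G M S \<Longrightarrow> x \<in> S \<Longrightarrow> x \<in> gcarrier M"
  unfolding gsubmodule_def by blast

lemma gmodule_grestrict:
  assumes "gsubmodule G M S"
  shows "gmodule G (grestrict M S)"
proof
  fix g assume g: "g \<in> G"
  show "\<exists>h\<in>G. \<forall>x\<in>gcarrier (grestrict M S). gact (grestrict M S) (gact (grestrict M S) x h) g = x"
    using act_inverse[OF g] subset_carrier[OF assms] by (auto simp: grestrict_def)
qed (use assms subset_carrier[OF assms] in \<open>auto simp: grestrict_def gsubmodule_def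
    intro: add_comm add_assoc add_zero add_neg smult_add act_add act_smult\<close>)

lemma gsubmodule_grestrict_iff:
  assumes "gsubmodule G M B"
  shows "gsubmodule G (grestrict M B) S \<longleftrightarrow> gsubmodule G M S \<and> S \<subseteq> B"
  using assms by (auto simp: gsubmodule_def grestrict_def)

lemma gsubmodule_carrier: "gsubmodule G M (gcarrier M)"
  by (auto simp: gsubmodule_def zero_closed add_closed smult_closed act_closed)

lemma gsubmodule_zero: "gsubmodule G M {gzero M}"
  by (auto simp: gsubmodule_def zero_closed add_zero smult_zero act_zero)

end

section \<open>Epimorphisms with a named kernel, isomorphism theorems\<close>

definition gepi :: "'g set \<Rightarrow> ('f, 'g, 'm) gmod \<Rightarrow> ('f, 'g, 'k) gmod \<Rightarrow> ('m \<Rightarrow> 'k) \<Rightarrow> 'm set \<Rightarrow> bool" where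
  "gepi G M N f K \<longleftrightarrow> f ` gcarrier M = gcarrier N \<and> f (gzero M) = gzero N \<and>
     (\<forall>x\<in>gcarrier M. \<forall>y\<in>gcarrier M. f (gadd M x y) = gadd N (f x) (f y)) \<and>
     (\<forall>c. \<forall>x\<in>gcarrier M. f (gsmult M c x) = gsmult N c (f x)) \<and>
     (\<forall>g\<in>G. \<forall>x\<in>gcarrier M. f (gact M x g) = gact N (f x) g) \<and>
     K = {x \<in> gcarrier M. f x = gzero N}"

lemma gepiD:
  assumes "gepi G M N f K"
  shows "f ` gcarrier M = gcarrier N" "f (gzero M) = gzero N"
    "\<And>x y. \<lbrakk>x \<in> gcarrier M; y \<in> gcarrier M\<rbrakk> \<Longrightarrow> f (gadd M x y) = gadd N (f x) (f y)"
    "\<And>c x. x \<in> gcarrier M \<Longrightarrow> f (gsmult M c x) = gsmult N c (f x)"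
    "\<And>g x. \<lbrakk>g \<in> G; x \<in> gcarrier M\<rbrakk> \<Longrightarrow> f (gact M x g) = gact N (f x) g"
    "K = {x \<in> gcarrier M. f x = gzero N}"
  using assms unfolding gepi_def by blast+

lemma gepi_closed: "gepi G M N f K \<Longrightarrow> x \<in> gcarrier M \<Longrightarrow> f x \<in> gcarrier N"
  unfolding gepi_def by blast

context gmodule begin

text \<open>The target is a bare record, so its laws have to be transported along the surjection;
  the fact \<open>*\<close> turns each quantifier over the target into one over the source.\<close>

lemma gmodule_gepi:
  assumes "gepi G M N f K"
  shows "gmodule G N"
proof -
  note e = gepiD[OF assms]
  have *: "(\<forall>y\<in>gcarrier N. P y) \<longleftrightarrow> (\<forall>x\<in>gcarrier M. P (f x))" for P
    unfolding e(1)[symmetric] by blast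
  have c: "f x \<in> gcarrier N" if "x \<in> gcarrier M" for x using e(1) that by blast
  note r = e(3-5)[symmetric]
  show ?thesis
  proof
    show "gzero N \<in> gcarrier N" using c zero_closed e(2) by metis
    have "\<forall>x\<in>gcarrier N. \<forall>y\<in>gcarrier N. gadd N x y \<in> gcarrier N"
      unfolding * by (simp add: r add_closed c)
    then show "gadd N x y \<in> gcarrier N" if "x \<in> gcarrier N" "y \<in> gcarrier N" for x y using that by blast
    have "\<forall>x\<in>gcarrier N. gsmult N k x \<in> gcarrier N" for k
      unfolding * by (simp add: r smult_closed c)
    then show "gsmult N k x \<in> gcarrier N" if "x \<in> gcarrier N" for k x using that by blast
    have "\<forall>x\<in>gcarrier N. gact N x g \<in> gcarrier N" if "g \<in> G" for g
      unfolding * by (simp add: that r act_closed c)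
    then show "gact N x g \<in> gcarrier N" if "g \<in> G" "x \<in> gcarrier N" for g x using that by blast
    have "\<forall>x\<in>gcarrier N. \<forall>y\<in>gcarrier N. gadd N x y = gadd N y x"
      unfolding * by (auto simp: r intro: arg_cong[where f = f] add_comm)
    then show "gadd N x y = gadd N y x" if "x \<in> gcarrier N" "y \<in> gcarrier N" for x y using that by blast
    have "\<forall>x\<in>gcarrier N. \<forall>y\<in>gcarrier N. \<forall>z\<in>gcarrier N.
        gadd N (gadd N x y) z = gadd N x (gadd N y z)"
      unfolding * by (simp add: r add_closed add_assoc)
    then show "gadd N (gadd N x y) z = gadd N x (gadd N y z)"
      if "x \<in> gcarrier N" "y \<in> gcarrier N" "z \<in> gcarrier N" for x y z using that by blast
    have "\<forall>x\<in>gcarrier N. gadd N x (gzero N) = x"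
      unfolding * by (simp add: e(2)[symmetric] r zero_closed add_zero)
    then show "gadd N x (gzero N) = x" if "x \<in> gcarrier N" for x using that by blast
    have "\<forall>x\<in>gcarrier N. gadd N x (gsmult N (- 1) x) = gzero N"
      unfolding * by (simp add: e(2)[symmetric] r smult_closed add_neg)
    then show "gadd N x (gsmult N (- 1) x) = gzero N" if "x \<in> gcarrier N" for x using that by blast
    have "\<forall>x\<in>gcarrier N. \<forall>y\<in>gcarrier N.
        gsmult N k (gadd N x y) = gadd N (gsmult N k x) (gsmult N k y)" for k
      unfolding * by (simp add: r smult_closed add_closed smult_add)
    then show "gsmult N k (gadd N x y) = gadd N (gsmult N k x) (gsmult N k y)"
      if "x \<in> gcarrier N" "y \<in> gcarrier N" for k x y using that by blast
    have "\<forall>x\<in>gcarrier N. \<forall>y\<in>gcarrier N.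
        gact N (gadd N x y) g = gadd N (gact N x g) (gact N y g)" if "g \<in> G" for g
      unfolding * by (simp add: that r act_closed add_closed act_add)
    then show "gact N (gadd N x y) g = gadd N (gact N x g) (gact N y g)"
      if "g \<in> G" "x \<in> gcarrier N" "y \<in> gcarrier N" for g x y using that by blast
    have "\<forall>x\<in>gcarrier N. gact N (gsmult N k x) g = gsmult N k (gact N x g)" if "g \<in> G" for g k
      unfolding * by (simp add: that r act_closed smult_closed act_smult)
    then show "gact N (gsmult N k x) g = gsmult N k (gact N x g)"
      if "g \<in> G" "x \<in> gcarrier N" for g k x using that by blast
    show "\<exists>h\<in>G. \<forall>x\<in>gcarrier N. gact N (gact N x h) g = x" if g: "g \<in> G" for g
    proof -
      obtain h where h: "h \<in> G" "\<forall>x\<in>gcarrier M. gact M (gact M x h) g = x"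
        using act_inverse[OF g] by blast
      have "\<forall>x\<in>gcarrier N. gact N (gact N x h) g = x"
        unfolding * using h by (simp add: g r act_closed)
      then show ?thesis using h(1) by blast
    qed
  qed
qed

lemma gepi_id: "gepi G M M id {gzero M}"
  unfolding gepi_def using zero_closed by auto

lemma gepi_eq_iff:
  assumes e: "gepi G M N f K" and "x \<in> gcarrier M" "y \<in> gcarrier M"
  shows "f x = f y \<longleftrightarrow> gadd M x (gsmult M (- 1) y) \<in> K"
proof -
  interpret N: gmodule G N by (rule gmodule_gepi[OF e])
  note c = gepi_closed[OF e]
  have "gadd M x (gsmult M (- 1) y) \<in> K \<longleftrightarrow> gadd N (f x) (gsmult N (- 1) (f y)) = gzero N"
    using gepiD[OF e] assms(2,3) by (simp add: add_closed smult_closed)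
  also have "\<dots> \<longleftrightarrow> f x = f y"
    using c assms(2,3) by (metis N.add_diff N.add_neg N.add_zero)
  finally show ?thesis by simp
qed

lemma gsubmodule_preimage:
  assumes e: "gepi G M N f K" and S: "gsubmodule G N S"
  shows "gsubmodule G M {x \<in> gcarrier M. f x \<in> S}"
  using S unfolding gsubmodule_def
  by (auto simp: gepiD(2-5)[OF e] zero_closed add_closed smult_closed act_closed)

lemma gsubmodule_kernel:
  assumes e: "gepi G M N f K"
  shows "gsubmodule G M K"
  using gsubmodule_preimage[OF e gmodule.gsubmodule_zero[OF gmodule_gepi[OF e]]] gepiD(6)[OF e] by simp

lemma gsubmodule_image:
  assumes e: "gepi G M N f K" and S: "gsubmodule G M S"
  shows "gsubmodule G N (f ` S)"
proof -
  have S': "S \<subseteq> gcarrier M" "gzero M \<in> S" "\<And>x y. x \<in> S \<Longrightarrow> y \<in> S \<Longrightarrow> gadd M x y \<in> S"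
    "\<And>c x. x \<in> S \<Longrightarrow> gsmult M c x \<in> S" "\<And>g x. g \<in> G \<Longrightarrow> x \<in> S \<Longrightarrow> gact M x g \<in> S"
    using S unfolding gsubmodule_def by auto
  have "f ` S \<subseteq> gcarrier N" by (auto intro: gepi_closed[OF e] subset_carrier[OF S])
  moreover have "gzero N \<in> f ` S" using S'(2) gepiD(2)[OF e] by (metis image_eqI)
  moreover have "gadd N (f x) (f y) \<in> f ` S" if "x \<in> S" "y \<in> S" for x y
    using gepiD(3)[OF e, of x y] S' that by (metis image_eqI subsetD)
  moreover have "gsmult N c (f x) \<in> f ` S" if "x \<in> S" for c x
    using gepiD(4)[OF e, of x c] S' that by (metis image_eqI subsetD)
  moreover have "gact N (f x) g \<in> f ` S" if "x \<in> S" "g \<in> G" for g x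
    using gepiD(5)[OF e, of g x] S' that by (metis image_eqI subsetD)
  ultimately show ?thesis unfolding gsubmodule_def by blast
qed

text \<open>If f x = f y with y in S, then x - y lies in the kernel, hence in S. This is the half of
  the correspondence theorem that needs the kernel inside S.\<close>

lemma preimage_image:
  assumes e: "gepi G M N f K" and S: "gsubmodule G M S" and "K \<subseteq> S"
  shows "{x \<in> gcarrier M. f x \<in> f ` S} = S"
proof
  show "S \<subseteq> {x \<in> gcarrier M. f x \<in> f ` S}" using subset_carrier[OF S] by blast
  show "{x \<in> gcarrier M. f x \<in> f ` S} \<subseteq> S"
  proof clarify
    fix x y assume x: "x \<in> gcarrier M" and y: "y \<in> S" and eq: "f x = f y"
    have yc: "y \<in> gcarrier M" using subset_carrier[OF S y] .
    have "gadd M x (gsmult M (- 1) y) \<in> S"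
      using gepi_eq_iff[OF e x yc] eq assms(3) by blast
    then have "gadd M y (gadd M x (gsmult M (- 1) y)) \<in> S"
      using S y unfolding gsubmodule_def by blast
    then show "x \<in> S" by (simp add: add_diff x yc)
  qed
qed

lemma gepi_compose:
  assumes e: "gepi G M N f K" and e': "gepi G N P h L"
  shows "gepi G M P (h \<circ> f) {x \<in> gcarrier M. f x \<in> L}"
proof -
  have c: "f x \<in> gcarrier N" if "x \<in> gcarrier M" for x using e that by (rule gepi_closed)
  have "(h \<circ> f) ` gcarrier M = gcarrier P"
    using gepiD(1)[OF e] gepiD(1)[OF e'] by (metis image_comp)
  then show ?thesis using c unfolding gepi_def
    by (auto simp: gepiD(2-6)[OF e] gepiD(2-5)[OF e'] gepiD(6)[OF e'])
qed

lemma gepi_grestrict: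
  assumes e: "gepi G M N f K" and S: "gsubmodule G M S"
  shows "gepi G (grestrict M S) (grestrict N (f ` S)) f (S \<inter> K)"
  using gepiD[OF e] subset_carrier[OF S]
  unfolding gepi_def grestrict_def by auto

text \<open>The only place where the set-theoretic operations of \<open>gquot\<close> are unfolded;
  later arguments see a quotient merely as the target of an epimorphism with kernel S.\<close>

lemma gepi_gcoset:
  assumes S: "gsubmodule G M S"
  shows "gepi G M (gquot M S) (gcoset M S) S"
proof -
  have S': "gzero M \<in> S" "\<And>x y. x \<in> S \<Longrightarrow> y \<in> S \<Longrightarrow> gadd M x y \<in> S"
    "\<And>c x. x \<in> S \<Longrightarrow> gsmult M c x \<in> S" "\<And>g x. g \<in> G \<Longrightarrow> x \<in> S \<Longrightarrow> gact M x g \<in> S"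
    using S unfolding gsubmodule_def by auto
  note Sc = subset_carrier[OF S]
  have mem: "z \<in> gcoset M S x \<longleftrightarrow> z \<in> gcarrier M \<and> gadd M z (gsmult M (- 1) x) \<in> S"
    if x: "x \<in> gcarrier M" for x z
  proof
    assume "z \<in> gcoset M S x"
    then obtain s where s: "s \<in> S" "z = gadd M x s" unfolding gcoset_def by blast
    have "gadd M z (gsmult M (- 1) x) = s"
      using s(2) x Sc[OF s(1)] by (metis add_assoc add_comm add_neg add_zero smult_closed)
    then show "z \<in> gcarrier M \<and> gadd M z (gsmult M (- 1) x) \<in> S"
      using s x Sc[OF s(1)] add_closed by simp
  next
    assume "z \<in> gcarrier M \<and> gadd M z (gsmult M (- 1) x) \<in> S"
    then show "z \<in> gcoset M S x" unfolding gcoset_def using x add_diff by (metis image_eqI)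
  qed
  have self: "x \<in> gcoset M S x" if "x \<in> gcarrier M" for x
    unfolding gcoset_def using S'(1) add_zero[OF that] by (metis image_eqI)
  have z: "gcoset M S (gzero M) = S"
    unfolding gcoset_def using Sc by (force simp: image_iff add_comm[OF zero_closed] add_zero)
  have zero_iff: "gcoset M S x = S \<longleftrightarrow> x \<in> S" if x: "x \<in> gcarrier M" for x
  proof
    assume "gcoset M S x = S" then show "x \<in> S" using self[OF x] by simp
  next
    assume xS: "x \<in> S"
    show "gcoset M S x = S"
    proof
      show "gcoset M S x \<subseteq> S" using xS S'(2) unfolding gcoset_def by blast
      show "S \<subseteq> gcoset M S x"
        using xS mem[OF x] S'(2,3) Sc by blast
    qed
  qed
  have add: "gcoset M S (gadd M x y) = {gadd M a b | a b. a \<in> gcoset M S x \<and> b \<in> gcoset M S y}"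
    if x: "x \<in> gcarrier M" and y: "y \<in> gcarrier M" for x y
  proof -
    have 1: "gadd M (gadd M x s) (gadd M y t) = gadd M (gadd M x y) (gadd M s t)"
      if "s \<in> S" "t \<in> S" for s t
      using x y Sc[OF that(1)] Sc[OF that(2)] by (metis add_assoc add_closed add_comm)
    have 2: "gadd M (gadd M x y) s = gadd M (gadd M x s) (gadd M y (gzero M))" if "s \<in> S" for s
      using 1[OF that S'(1)] Sc[OF that] by (simp add: add_zero)
    show ?thesis unfolding gcoset_def image_def
      using 1 2 S'(1,2) by blast
  qed
  have smult: "gcoset M S (gsmult M c x) = {gadd M (gsmult M c a) s | a s. a \<in> gcoset M S x \<and> s \<in> S}"
    if x: "x \<in> gcarrier M" for c x
  proof -
    have 1: "gadd M (gsmult M c (gadd M x s)) t = gadd M (gsmult M c x) (gadd M (gsmult M c s) t)"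
      if "s \<in> S" "t \<in> S" for s t
      using x Sc[OF that(1)] Sc[OF that(2)] by (simp add: smult_add add_assoc smult_closed)
    have 2: "gadd M (gsmult M c x) s = gadd M (gsmult M c (gadd M x (gzero M))) s" for s
      using x by (simp add: add_zero)
    show ?thesis unfolding gcoset_def image_def
      using 1 2 S'(1,2,3) by blast
  qed
  have act: "gcoset M S (gact M x g) = (\<lambda>x. gact M x g) ` gcoset M S x"
    if x: "x \<in> gcarrier M" and g: "g \<in> G" for x g
  proof -
    \<comment> \<open>The action on cosets is elementwise, so a coset is sent to a full coset only
      if g maps S onto S, not just into it.\<close>
    have img: "(\<lambda>x. gact M x g) ` S = S"
    proof
      show "(\<lambda>x. gact M x g) ` S \<subseteq> S" using S'(4)[OF g] by blast
      obtain h where h: "h \<in> G" "\<forall>x\<in>gcarrier M. gact M (gact M x h) g = x"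
        using act_inverse[OF g] by blast
      show "S \<subseteq> (\<lambda>x. gact M x g) ` S"
        using h(2) S'(4)[OF h(1)] Sc by (metis image_eqI subsetI)
    qed
    have "(\<lambda>x. gact M x g) ` gcoset M S x = (\<lambda>s. gadd M (gact M x g) (gact M s g)) ` S"
      unfolding gcoset_def image_image by (rule image_cong) (simp_all add: act_add[OF g x] Sc)
    also have "\<dots> = gadd M (gact M x g) ` (\<lambda>x. gact M x g) ` S" by (simp add: image_image)
    finally show ?thesis unfolding img gcoset_def by simp
  qed
  show ?thesis unfolding gepi_def
  proof (intro conjI ballI allI)
    show "S = {x \<in> gcarrier M. gcoset M S x = gzero (gquot M S)}"
      proof -
      have "S = {x \<in> gcarrier M. x \<in> S}" using Sc by blast
      also have "\<dots> = {x \<in> gcarrier M. gcoset M S x = S}" using zero_iff by blast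
      finally show ?thesis by (simp add: gquot_def)
    qed
  qed (simp_all add: gquot_def z add smult act)
qed

text \<open>First isomorphism theorem in symmetric form: with equal kernels the two maps have the
  same fibres, so f' composed with any choice of preimages under f is well defined and
  bijective.\<close>

lemma giso_of_gepi:
  assumes e: "gepi G M N f K" and e': "gepi G M N' f' K"
  shows "giso G N N'"
proof -
  define s where "s n = (SOME x. x \<in> gcarrier M \<and> f x = n)" for n
  have s: "s n \<in> gcarrier M \<and> f (s n) = n" if "n \<in> gcarrier N" for n
  proof -
    have "\<exists>x. x \<in> gcarrier M \<and> f x = n" using that unfolding gepiD(1)[OF e, symmetric] by blast
    then show ?thesis unfolding s_def by (rule someI_ex)
  qed
  define h where "h n = f' (s n)" for n
  have eq: "f x = f y \<longleftrightarrow> f' x = f' y" if "x \<in> gcarrier M" "y \<in> gcarrier M" for x y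
    using gepi_eq_iff[OF e that] gepi_eq_iff[OF e' that] by simp
  have hf: "h (f x) = f' x" if "x \<in> gcarrier M" for x
    unfolding h_def using s[OF gepi_closed[OF e that]] eq[of "s (f x)" x] that by simp
  have *: "(\<forall>y\<in>gcarrier N. P y) \<longleftrightarrow> (\<forall>x\<in>gcarrier M. P (f x))" for P
    unfolding gepiD(1)[OF e, symmetric] by blast
  note r = gepiD(3-5)[OF e, symmetric] gepiD(3-5)[OF e', symmetric]
  have "inj_on h (gcarrier N)"
    unfolding inj_on_def * by (simp add: hf eq)
  moreover have "h ` gcarrier N = gcarrier N'"
    using hf gepiD(1)[OF e] gepiD(1)[OF e'] by (metis (no_types, lifting) image_cong image_image)
  moreover have "\<forall>x\<in>gcarrier N. \<forall>y\<in>gcarrier N. h (gadd N x y) = gadd N' (h x) (h y)"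
    unfolding * by (simp add: hf r add_closed)
  moreover have "\<forall>x\<in>gcarrier N. h (gsmult N c x) = gsmult N' c (h x)" for c
    unfolding * by (simp add: hf r smult_closed)
  moreover have "\<forall>x\<in>gcarrier N. h (gact N x g) = gact N' (h x) g" if "g \<in> G" for g
    unfolding * by (simp add: that hf r act_closed)
  ultimately show ?thesis unfolding giso_def bij_betw_def by (intro exI[of _ h] conjI) simp_all
qed

lemma giso_sym:
  assumes "giso G M N"
  shows "giso G N M"
proof -
  obtain f where f: "bij_betw f (gcarrier M) (gcarrier N)"
      "\<forall>x\<in>gcarrier M. \<forall>y\<in>gcarrier M. f (gadd M x y) = gadd N (f x) (f y)"
      "\<forall>c. \<forall>x\<in>gcarrier M. f (gsmult M c x) = gsmult N c (f x)"
      "\<forall>g\<in>G. \<forall>x\<in>gcarrier M. f (gact M x g) = gact N (f x) g"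
    using assms unfolding giso_def by (elim exE conjE)
  define h where "h = inv_into (gcarrier M) f"
  have h: "bij_betw h (gcarrier N) (gcarrier M)" and hf: "\<And>x. x \<in> gcarrier M \<Longrightarrow> h (f x) = x"
    using f(1) bij_betw_inv_into[OF f(1)] by (simp_all add: h_def bij_betw_def)
  have N: "gcarrier N = f ` gcarrier M" using f(1) by (simp add: bij_betw_def)
  have "\<forall>x\<in>gcarrier N. \<forall>y\<in>gcarrier N. h (gadd N x y) = gadd M (h x) (h y)"
    unfolding N by (simp add: hf f(2)[rule_format, symmetric] add_closed)
  moreover have "\<forall>c. \<forall>x\<in>gcarrier N. h (gsmult N c x) = gsmult M c (h x)"
    unfolding N by (simp add: hf f(3)[rule_format, symmetric] smult_closed)
  moreover have "\<forall>g\<in>G. \<forall>x\<in>gcarrier N. h (gact N x g) = gact M (h x) g"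
    unfolding N by (simp add: hf f(4)[rule_format, symmetric] act_closed)
  ultimately show ?thesis unfolding giso_def using h by (intro exI[of _ h] conjI) simp_all
qed

text \<open>Turns an assumed isomorphism from a quotient of M into a map defined on M itself, which
  is convenient when the isomorphism is to be refuted.\<close>

lemma gepi_giso:
  assumes e: "gepi G M N f K" and i: "giso G N P" and P: "gmodule G P"
  obtains f' where "gepi G M P f' K"
proof -
  interpret N: gmodule G N by (rule gmodule_gepi[OF e])
  interpret P: gmodule G P by (rule P)
  obtain h where h: "bij_betw h (gcarrier N) (gcarrier P)"
      "\<forall>x\<in>gcarrier N. \<forall>y\<in>gcarrier N. h (gadd N x y) = gadd P (h x) (h y)"
      "\<forall>c. \<forall>x\<in>gcarrier N. h (gsmult N c x) = gsmult P c (h x)"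
      "\<forall>g\<in>G. \<forall>x\<in>gcarrier N. h (gact N x g) = gact P (h x) g"
    using i unfolding giso_def by (elim exE conjE)
  have hc: "h x \<in> gcarrier P" if "x \<in> gcarrier N" for x using h(1) that by (auto simp: bij_betw_def)
  \<comment> \<open>\<open>giso\<close> does not mention zero; its preservation follows from
    additivity by cancellation.\<close>
  have "gadd P (h (gzero N)) (h (gzero N)) = h (gadd N (gzero N) (gzero N))"
    using h(2) N.zero_closed by simp
  also have "\<dots> = gadd P (h (gzero N)) (gzero P)"
    using hc[OF N.zero_closed] N.add_zero[OF N.zero_closed] P.add_zero by simp
  finally have h0: "h (gzero N) = gzero P"
    using P.cancel hc[OF N.zero_closed] P.zero_closed by blast
  have "{x \<in> gcarrier N. h x = gzero P} = {gzero N}"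
  proof -
    have "x = gzero N" if "x \<in> gcarrier N" "h x = gzero P" for x
      using h(1) h0 that N.zero_closed by (metis bij_betw_imp_inj_on inj_onD)
    then show ?thesis using h0 N.zero_closed by blast
  qed
  then have "gepi G N P h {gzero N}"
    using h h0 unfolding gepi_def by (simp add: bij_betw_def)
  from gepi_compose[OF e this] gepiD(6)[OF e] show thesis using that by simp
qed

end

lemma giso_trans:
  assumes "giso G M N" "giso G N P"
  shows "giso G M P"
proof -
  obtain f where f: "bij_betw f (gcarrier M) (gcarrier N)"
      "\<forall>x\<in>gcarrier M. \<forall>y\<in>gcarrier M. f (gadd M x y) = gadd N (f x) (f y)"
      "\<forall>c. \<forall>x\<in>gcarrier M. f (gsmult M c x) = gsmult N c (f x)"
      "\<forall>g\<in>G. \<forall>x\<in>gcarrier M. f (gact M x g) = gact N (f x) g"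
    using assms(1) unfolding giso_def by (elim exE conjE)
  obtain h where h: "bij_betw h (gcarrier N) (gcarrier P)"
      "\<forall>x\<in>gcarrier N. \<forall>y\<in>gcarrier N. h (gadd N x y) = gadd P (h x) (h y)"
      "\<forall>c. \<forall>x\<in>gcarrier N. h (gsmult N c x) = gsmult P c (h x)"
      "\<forall>g\<in>G. \<forall>x\<in>gcarrier N. h (gact N x g) = gact P (h x) g"
    using assms(2) unfolding giso_def by (elim exE conjE)
  have c: "f x \<in> gcarrier N" if "x \<in> gcarrier M" for x using f(1) that by (auto simp: bij_betw_def)
  show ?thesis unfolding giso_def
    using bij_betw_trans[OF f(1) h(1)] f(2-4) h(2-4) c by (intro exI[of _ "h \<circ> f"] conjI) simp_all
qed

section \<open>Covers, sections and composition series\<close>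

definition gcover :: "'g set \<Rightarrow> ('f, 'g, 'm) gmod \<Rightarrow> 'm set \<Rightarrow> 'm set \<Rightarrow> bool" where
  "gcover G M A B \<longleftrightarrow> gsubmodule G M A \<and> gsubmodule G M B \<and> A \<subset> B \<and>
     (\<forall>S. gsubmodule G M S \<and> A \<subseteq> S \<and> S \<subseteq> B \<longrightarrow> S = A \<or> S = B)"

text \<open>The lower submodule comes first. The right-hand side has the shape of
  \<open>comp_factor\<close>, so sections and composition factors match literally.\<close>

abbreviation gsection :: "('f, 'g, 'm) gmod \<Rightarrow> 'm set \<Rightarrow> 'm set \<Rightarrow> ('f, 'g, 'm set) gmod" where
  "gsection M A B \<equiv> gquot (grestrict M B) A"

context gmodule begin

text \<open>Correspondence theorem: images and preimages match the submodules of the target with the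
  submodules of M above K.\<close>

lemma girreducible_gepi_iff:
  assumes e: "gepi G M N f K"
  shows "girreducible G N \<longleftrightarrow> gcover G M K (gcarrier M)"
proof -
  interpret N: gmodule G N by (rule gmodule_gepi[OF e])
  have K: "gsubmodule G M K" by (rule gsubmodule_kernel[OF e])
  have fK: "f ` K = {gzero N}"
    using gepiD(2,6)[OF e] zero_closed by auto
  show ?thesis
  proof
    assume irr: "girreducible G N"
    have "K \<noteq> gcarrier M" using irr fK gepiD(1)[OF e] unfolding girreducible_def by metis
    then have "K \<subset> gcarrier M" using subset_carrier[OF K] by blast
    moreover have "S = K \<or> S = gcarrier M" if S: "gsubmodule G M S" "K \<subseteq> S" for S
    proof -
      have "f ` S = f ` K \<or> f ` S = f ` gcarrier M"
        using irr gsubmodule_image[OF e S(1)] fK gepiD(1)[OF e] unfolding girreducible_def by metis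
      then show ?thesis
        using preimage_image[OF e S] preimage_image[OF e K] preimage_image[OF e gsubmodule_carrier]
          subset_carrier[OF K] by (metis subsetI order_refl)
    qed
    ultimately show "gcover G M K (gcarrier M)"
      unfolding gcover_def using K gsubmodule_carrier by blast
  next
    assume c: "gcover G M K (gcarrier M)"
    have "gcarrier N \<noteq> {gzero N}"
      using c gepiD(6)[OF e] gepi_closed[OF e] unfolding gcover_def by blast
    moreover have "S = {gzero N} \<or> S = gcarrier N" if S: "gsubmodule G N S" for S
    proof -
      let ?T = "{x \<in> gcarrier M. f x \<in> S}"
      have "gsubmodule G M ?T" by (rule gsubmodule_preimage[OF e S])
      moreover have "K \<subseteq> ?T" using gepiD(6)[OF e] S unfolding gsubmodule_def by auto
      ultimately have "?T = K \<or> ?T = gcarrier M"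
        using c unfolding gcover_def by (metis (no_types, lifting) mem_Collect_eq subsetI)
      moreover have "f ` ?T = S"
        using S gepiD(1)[OF e] unfolding gsubmodule_def by auto
      ultimately show ?thesis using fK gepiD(1)[OF e] by metis
    qed
    ultimately show "girreducible G N" unfolding girreducible_def by blast
  qed
qed

lemma gcover_grestrict_iff:
  assumes "gsubmodule G M B"
  shows "gcover G (grestrict M B) A B \<longleftrightarrow> gcover G M A B"
  unfolding gcover_def gsubmodule_grestrict_iff[OF assms] using assms by blast

lemma girreducible_grestrict_gepi_iff:
  assumes B: "gsubmodule G M B" and e: "gepi G (grestrict M B) N f A"
  shows "girreducible G N \<longleftrightarrow> gcover G M A B"
  using gmodule.girreducible_gepi_iff[OF gmodule_grestrict[OF B] e] gcover_grestrict_iff[OF B]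
  by (simp add: grestrict_def)

lemma gepi_gsection:
  assumes "gsubmodule G M A" "gsubmodule G M B" "A \<subseteq> B"
  shows "gepi G (grestrict M B) (gsection M A B) (gcoset (grestrict M B) A) A"
  using gmodule.gepi_gcoset[OF gmodule_grestrict[OF assms(2)]] gsubmodule_grestrict_iff[OF assms(2)] assms
  by blast

lemma girreducible_gsection_iff:
  assumes "gsubmodule G M A" "gsubmodule G M B" "A \<subseteq> B"
  shows "girreducible G (gsection M A B) \<longleftrightarrow> gcover G M A B"
  by (rule girreducible_grestrict_gepi_iff[OF assms(2) gepi_gsection[OF assms]])

lemma giso_gsection:
  assumes "gsubmodule G M B" and "gepi G (grestrict M B) N f A"
  shows "giso G (gsection M A B) N"
proof -
  interpret B: gmodule G "grestrict M B" by (rule gmodule_grestrict[OF assms(1)])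
  show ?thesis
    using B.giso_of_gepi[OF B.gepi_gcoset[OF B.gsubmodule_kernel[OF assms(2)]] assms(2)] .
qed

text \<open>Second isomorphism theorem: the coset map of S/B stays onto when restricted to A,
  because the B-summand of an element of S dies in the quotient.\<close>

lemma gepi_gsection_sum:
  assumes A: "gsubmodule G M A" and B: "gsubmodule G M B" and S: "gsubmodule G M S"
    and AS: "A \<subseteq> S" and BS: "B \<subseteq> S" and sum: "\<And>x. x \<in> S \<Longrightarrow> \<exists>a\<in>A. \<exists>b\<in>B. x = gadd M a b"
  shows "gepi G (grestrict M A) (gsection M B S) (gcoset (grestrict M S) B) (A \<inter> B)"
proof -
  interpret S: gmodule G "grestrict M S" by (rule gmodule_grestrict[OF S])
  have e: "gepi G (grestrict M S) (gsection M B S) (gcoset (grestrict M S) B) B"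
    by (rule gepi_gsection[OF B S BS])
  let ?f = "gcoset (grestrict M S) B"
  interpret Q: gmodule G "gsection M B S" by (rule S.gmodule_gepi[OF e])
  have "gsubmodule G (grestrict M S) A" using A AS gsubmodule_grestrict_iff[OF S] by blast
  from S.gepi_grestrict[OF e this]
  have 1: "gepi G (grestrict M A) (grestrict (gsection M B S) (?f ` A)) ?f (A \<inter> B)"
    by (simp add: grestrict_def)
  have "?f ` A = gcarrier (gsection M B S)"
  proof
    show "?f ` A \<subseteq> gcarrier (gsection M B S)"
      using AS gepi_closed[OF e] by (auto simp: grestrict_def)
    have "?f x \<in> ?f ` A" if x: "x \<in> S" for x
    proof -
      obtain a b where ab: "a \<in> A" "b \<in> B" "x = gadd M a b" using sum[OF x] by blast
      have "?f x = gadd (gsection M B S) (?f a) (?f b)"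
        using gepiD(3)[OF e, of a b] ab AS BS by (simp add: grestrict_def subset_iff)
      also have "?f b = gzero (gsection M B S)" using gepiD(6)[OF e] ab(2) by blast
      also have "gadd (gsection M B S) (?f a) \<dots> = ?f a"
        by (rule Q.add_zero, rule gepi_closed[OF e]) (use AS ab(1) in \<open>auto simp: grestrict_def\<close>)
      finally show ?thesis using ab(1) by blast
    qed
    moreover have "gcarrier (gsection M B S) = ?f ` S"
      using gepiD(1)[OF e] by (simp add: grestrict_def)
    ultimately show "gcarrier (gsection M B S) \<subseteq> ?f ` A" by auto
  qed
  then show ?thesis using 1 by (simp add: grestrict_def)
qed

text \<open>Reads a chain of covers in M as a composition series of N, which is \<open>B k\<close>
  modulo \<open>B 0\<close>. The factors are unchanged by the third isomorphism theorem: the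
  composite map from \<open>B (Suc i)\<close> to the i-th factor has kernel
  \<open>B i\<close>.\<close>

lemma comp_series_gepi:
  assumes e: "gepi G (grestrict M (B k)) N f (B 0)" and B0: "gsubmodule G M (B 0)"
    and cov: "\<And>i. i < k \<Longrightarrow> gcover G M (B i) (B (Suc i))"
  shows "comp_series G N k (\<lambda>i. f ` B i)"
    and "i < k \<Longrightarrow> giso G (comp_factor N (\<lambda>i. f ` B i) i) (gsection M (B i) (B (Suc i)))"
proof -
  have sub: "gsubmodule G M (B i)" if "i \<le> k" for i
    using B0 cov that unfolding gcover_def by (cases i) (simp_all add: less_eq_Suc_le)
  have less: "B i \<subset> B (Suc i)" if "i < k" for i
    using cov[OF that] unfolding gcover_def by (elim conjE)
  have mono: "B i \<subseteq> B j" if "i \<le> j" "j \<le> k" for i j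
    using that
  proof (induction j rule: dec_induct)
    case (step n)
    then show ?case using less[of n] by auto
  qed simp
  interpret B: gmodule G "grestrict M (B k)" by (rule gmodule_grestrict[OF sub]) simp
  interpret N: gmodule G N by (rule B.gmodule_gepi[OF e])
  have subk: "gsubmodule G (grestrict M (B k)) (B i)" if "i \<le> k" for i
    using gsubmodule_grestrict_iff[OF sub] sub[OF that] mono[OF that] by simp
  have img: "gsubmodule G N (f ` B i)" if "i \<le> k" for i by (rule B.gsubmodule_image[OF e subk[OF that]])
  have pre: "{x \<in> B k. f x \<in> f ` B i} = B i" if "i \<le> k" for i
    using B.preimage_image[OF e subk[OF that] mono] that by (simp add: grestrict_def)
  have main: "gepi G (grestrict M (B (Suc i))) (comp_factor N (\<lambda>i. f ` B i) i)
      (gcoset (grestrict N (f ` B (Suc i))) (f ` B i) \<circ> f) (B i)" if i: "i < k" for i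
  proof -
    interpret Bi: gmodule G "grestrict M (B (Suc i))" by (rule gmodule_grestrict[OF sub]) (use i in simp)
    have "gepi G (grestrict M (B (Suc i))) (grestrict N (f ` B (Suc i))) f (B (Suc i) \<inter> B 0)"
      using B.gepi_grestrict[OF e subk[of "Suc i"]] i by (simp add: grestrict_def)
    from Bi.gepi_compose[OF this N.gepi_gsection[OF img img]]
    have "gepi G (grestrict M (B (Suc i))) (comp_factor N (\<lambda>i. f ` B i) i)
      (gcoset (grestrict N (f ` B (Suc i))) (f ` B i) \<circ> f) {x \<in> B (Suc i). f x \<in> f ` B i}"
      using i mono[of i "Suc i"] by (simp add: comp_factor_def grestrict_def image_mono)
    moreover have "{x \<in> B (Suc i). f x \<in> f ` B i} = B i"
      using pre[of i] mono[of "Suc i" k] mono[of i "Suc i"] i by auto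
    ultimately show ?thesis by simp
  qed
  show "i < k \<Longrightarrow> giso G (comp_factor N (\<lambda>i. f ` B i) i) (gsection M (B i) (B (Suc i)))"
  proof -
    assume i: "i < k"
    interpret Bi: gmodule G "grestrict M (B (Suc i))" by (rule gmodule_grestrict[OF sub]) (use i in simp)
    have "gepi G (grestrict M (B (Suc i))) (gsection M (B i) (B (Suc i))) (gcoset (grestrict M (B (Suc i))) (B i)) (B i)"
      by (rule gepi_gsection) (use i sub mono in auto)
    then show ?thesis by (rule Bi.giso_of_gepi[OF main[OF i]])
  qed
  have "f ` B 0 = {gzero N}"
    using gepiD(2,6)[OF e] B.zero_closed by auto
  moreover have "f ` B k = gcarrier N" using gepiD(1)[OF e] by (simp add: grestrict_def)
  moreover have "f ` B i \<subset> f ` B (Suc i)" if "i < k" for i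
  proof -
    have "f ` B i \<noteq> f ` B (Suc i)"
    proof
      assume eq: "f ` B i = f ` B (Suc i)"
      have "B i = B (Suc i)"
        using pre[of i] pre[of "Suc i"] that unfolding eq by (metis Suc_leI less_imp_le)
      then show False using less[OF that] by blast
    qed
    then show ?thesis using mono[of i "Suc i"] that by (simp add: psubset_eq image_mono)
  qed
  moreover have "girreducible G (comp_factor N (\<lambda>i. f ` B i) i)" if "i < k" for i
    using girreducible_grestrict_gepi_iff[OF sub main[OF that]] cov[OF that] that by simp
  ultimately show "comp_series G N k (\<lambda>i. f ` B i)"
    unfolding comp_series_def using img by simp
qed

text \<open>The matching permutation is fixed as the reversal, since in every application below the
  factors of \<Lambda>/\<open>Mss\<close> and of \<open>N\<close>, or of \<Lambda>/(\<open>N\<close>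
  + \<open>Mss\<close>) and of \<open>U\<close>, occur in opposite order.\<close>

lemma same_comp_factors_gepi:
  assumes e: "gepi G (grestrict M (B k)) N f (B 0)" and B0: "gsubmodule G M (B 0)"
    and cov: "\<And>i. i < k \<Longrightarrow> gcover G M (B i) (B (Suc i))"
    and e': "gepi G (grestrict M (B' k)) N' f' (B' 0)" and B0': "gsubmodule G M (B' 0)"
    and cov': "\<And>i. i < k \<Longrightarrow> gcover G M (B' i) (B' (Suc i))"
    and iso: "\<And>i. i < k \<Longrightarrow>
      giso G (gsection M (B i) (B (Suc i))) (gsection M (B' (k - Suc i)) (B' (Suc (k - Suc i))))"
  shows "same_comp_factors G N N'"
proof -
  let ?\<pi> = "\<lambda>i. k - Suc i"
  have "bij_betw ?\<pi> {..<k} {..<k}"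
    by (rule bij_betw_byWitness[where f' = ?\<pi>]) auto
  moreover have "giso G (comp_factor N (\<lambda>i. f ` B i) i) (comp_factor N' (\<lambda>i. f' ` B' i) (?\<pi> i))"
    if i: "i < k" for i
  proof -
    have j: "?\<pi> i < k" using i by simp
    have 1: "giso G (comp_factor N' (\<lambda>i. f' ` B' i) (?\<pi> i)) (gsection M (B' (?\<pi> i)) (B' (Suc (?\<pi> i))))"
      using comp_series_gepi(2)[OF e' B0' cov' j] .
    have cs: "\<forall>j\<le>k. gsubmodule G N' (f' ` B' j)" "\<forall>j<k. f' ` B' j \<subset> f' ` B' (Suc j)"
      using comp_series_gepi(1)[OF e' B0' cov'] unfolding comp_series_def by simp_all
    have s: "gsubmodule G N' (f' ` B' (?\<pi> i))" "gsubmodule G N' (f' ` B' (Suc (?\<pi> i)))"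
      "f' ` B' (?\<pi> i) \<subseteq> f' ` B' (Suc (?\<pi> i))"
      using cs(1)[rule_format, of "?\<pi> i"] cs(1)[rule_format, of "Suc (?\<pi> i)"]
        cs(2)[rule_format, OF j] j by (auto simp only: psubset_eq Suc_leI less_imp_le)
    have "gsubmodule G M (B' k)"
      using B0' cov'[of "k - 1"] by (cases k) (auto simp: gcover_def)
    then interpret N': gmodule G N' using gmodule.gmodule_gepi[OF gmodule_grestrict e'] by blast
    interpret R: gmodule G "grestrict N' (f' ` B' (Suc (?\<pi> i)))" by (rule N'.gmodule_grestrict[OF s(2)])
    interpret Q: gmodule G "comp_factor N' (\<lambda>i. f' ` B' i) (?\<pi> i)"
      unfolding comp_factor_def by (rule R.gmodule_gepi[OF N'.gepi_gsection[OF s]])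
    show ?thesis
      using giso_trans[OF giso_trans[OF comp_series_gepi(2)[OF e B0 cov i] iso[OF i]] Q.giso_sym[OF 1]] .
  qed
  ultimately show ?thesis unfolding same_comp_factors_def
    using comp_series_gepi(1)[OF e B0 cov] comp_series_gepi(1)[OF e' B0' cov'] by blast
qed

end

section \<open>Structure vectors and bilinear products in coordinates\<close>

text \<open>Moves guards that do not depend on the summation index outwards, so that nested sums
  over Kronecker deltas collapse one index at a time.\<close>

lemma sum_if_outer: "(\<Sum>x\<in>A. if P then f x else 0) = (if P then sum f A else 0)"
  by simp

text \<open>\<open>field_large\<close> is the usable form of |F| > 2: a scalar t for which t^2 - t
  is invertible.\<close>

locale algebra_space = finite_dimensional_vector_space sc "range v"
  for sc :: "'a::field \<Rightarrow> 'v::ab_group_add \<Rightarrow> 'v" and v :: "'n::finite \<Rightarrow> 'v" +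
  assumes inj_v: "inj v"
    and field_large: "\<exists>t::'a. t \<noteq> 0 \<and> t \<noteq> 1"
    and card_n: "CARD('n) \<ge> 3"
begin

abbreviation c :: "'v \<Rightarrow> 'n \<Rightarrow> 'a" where "c \<equiv> coord sc v"
abbreviation br :: "('a, 'n) svec \<Rightarrow> 'v \<Rightarrow> 'v \<Rightarrow> 'v" where "br \<equiv> alg_prod sc v"
abbreviation sv :: "('v \<Rightarrow> 'v \<Rightarrow> 'v) \<Rightarrow> ('a, 'n) svec" where "sv \<equiv> struct_vec sc v"
abbreviation act :: "('a, 'n) svec \<Rightarrow> ('v \<Rightarrow> 'v) \<Rightarrow> ('a, 'n) svec" where "act \<equiv> svec_act sc v"
abbreviation \<Lambda> :: "('a, 'v \<Rightarrow> 'v, ('a, 'n) svec) gmod" where "\<Lambda> \<equiv> svec_module sc v"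
abbreviation lin :: "('v \<Rightarrow> 'v) \<Rightarrow> bool" where "lin \<equiv> Vector_Spaces.linear sc sc"
abbreviation dual :: "('v \<Rightarrow> 'a) \<Rightarrow> bool" where "dual \<equiv> Vector_Spaces.linear sc (*)"
abbreviation G :: "('v \<Rightarrow> 'v) set" where "G \<equiv> GL sc"

lemma coord_add: "c (u + w) i = c u i + c w i"
  unfolding coord_def by (subst representation_add) (simp_all add: independent_Basis span_Basis)

lemma coord_scale: "c (sc t u) i = t * c u i"
  unfolding coord_def by (subst representation_scale) (simp_all add: independent_Basis span_Basis)

lemma coord_zero: "c 0 i = 0"
  unfolding coord_def by (simp add: representation_zero)

lemma coord_neg: "c (- u) i = - c u i"
  unfolding coord_def by (subst representation_neg) (simp_all add: independent_Basis span_Basis)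

lemma coord_diff: "c (u - w) i = c u i - c w i"
  unfolding coord_def by (subst representation_diff) (simp_all add: independent_Basis span_Basis)

lemma coord_sum: "c (sum f A) i = (\<Sum>x\<in>A. c (f x) i)"
  by (induction A rule: infinite_finite_induct) (simp_all add: coord_zero coord_add)

lemma coord_basis: "c (v i) j = (if i = j then 1 else 0)"
  unfolding coord_def
  by (subst representation_basis) (auto simp: independent_Basis inj_eq[OF inj_v])

lemmas coord_simps = coord_add coord_scale coord_zero coord_neg coord_diff coord_sum coord_basis

lemma basis_expansion: "(\<Sum>i\<in>UNIV. sc (c u i) (v i)) = u"
proof -
  have "(\<Sum>b\<in>range v. sc (representation (range v) u b) b) = u"
    by (rule sum_representation_eq) (simp_all add: independent_Basis span_Basis)
  then show ?thesis by (simp add: sum.reindex[OF inj_v] coord_def)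
qed

lemma coord_eqI:
  assumes "\<And>i. c u i = c w i"
  shows "u = w"
proof -
  have "(\<Sum>i\<in>UNIV. sc (c u i) (v i)) = (\<Sum>i\<in>UNIV. sc (c w i) (v i))" by (simp only: assms)
  then show ?thesis by (simp only: basis_expansion)
qed

lemma linear_iff_sc: "lin f \<longleftrightarrow> (\<forall>u w. f (u + w) = f u + f w) \<and> (\<forall>t u. f (sc t u) = sc t (f u))"
  unfolding Vector_Spaces.linear_iff using vector_space_axioms by simp

lemma vector_space_field: "vector_space ((*) :: 'a \<Rightarrow> 'a \<Rightarrow> 'a)"
  by unfold_locales (simp_all add: algebra_simps)

lemma dual_iff: "dual f \<longleftrightarrow> (\<forall>u w. f (u + w) = f u + f w) \<and> (\<forall>t u. f (sc t u) = t * f u)"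
  unfolding Vector_Spaces.linear_iff using vector_space_axioms vector_space_field by simp

lemma dual_add: "dual f \<Longrightarrow> f (u + w) = f u + f w"
  and dual_scale: "dual f \<Longrightarrow> f (sc t u) = t * f u"
  by (simp_all add: dual_iff)

lemma dual_0: "dual f \<Longrightarrow> f 0 = 0"
  using dual_scale[of f 0 0] by simp

lemma dual_neg: "dual f \<Longrightarrow> f (- u) = - f u"
  using dual_scale[of f "-1" u] by simp

lemma dual_diff: "dual f \<Longrightarrow> f (u - w) = f u - f w"
  using dual_add[of f u "- w"] dual_neg by simp

lemma dual_sum: "dual f \<Longrightarrow> f (sum h A) = (\<Sum>x\<in>A. f (h x))"
  by (induction A rule: infinite_finite_induct) (simp_all add: dual_0 dual_add)

lemmas dual_simps = dual_add dual_scale dual_0 dual_neg dual_diff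

lemma dual_expansion:
  assumes "dual f"
  shows "f u = (\<Sum>i\<in>UNIV. c u i * f (v i))"
proof -
  have "f u = f (\<Sum>i\<in>UNIV. sc (c u i) (v i))" by (simp only: basis_expansion)
  then show ?thesis by (simp only: dual_sum[OF assms] dual_scale[OF assms])
qed

lemma dual_coord: "dual (\<lambda>u. c u i)"
  by (simp add: dual_iff coord_simps)

lemma dual_combination: "dual (\<lambda>u. \<Sum>i\<in>UNIV. c u i * b i)"
  by (simp add: dual_iff coord_simps algebra_simps sum.distrib sum_distrib_left)

lemma lin_add: "lin f \<Longrightarrow> f (u + w) = f u + f w"
  and lin_scale: "lin f \<Longrightarrow> f (sc t u) = sc t (f u)"
  by (simp_all add: linear_iff_sc)

lemma lin_0: "lin f \<Longrightarrow> f 0 = 0"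
  using lin_scale[of f 0 0] by simp

lemma lin_neg: "lin f \<Longrightarrow> f (- u) = - f u"
  using lin_scale[of f "-1" u] by simp

lemma lin_diff: "lin f \<Longrightarrow> f (u - w) = f u - f w"
  using lin_add[of f u "- w"] lin_neg by simp

lemma lin_sum: "lin f \<Longrightarrow> f (sum h A) = (\<Sum>x\<in>A. f (h x))"
  by (induction A rule: infinite_finite_induct) (simp_all add: lin_0 lin_add)

lemma coord_lin_expansion:
  assumes "lin f"
  shows "c (f u) j = (\<Sum>i\<in>UNIV. c u i * c (f (v i)) j)"
proof -
  have "f u = f (\<Sum>i\<in>UNIV. sc (c u i) (v i))" by (simp only: basis_expansion)
  then show ?thesis by (simp only: lin_sum[OF assms] lin_scale[OF assms] coord_simps)
qed

lemma coord_br: "c (br x u w) k = (\<Sum>i\<in>UNIV. \<Sum>j\<in>UNIV. c u i * c w j * x $ (i, j, k))"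
  unfolding alg_prod_def by (simp add: coord_simps if_distrib[of "\<lambda>t. _ * t"] cong: if_cong)

lemma coord_br_basis: "c (br x (v i) (v j)) k = x $ (i, j, k)"
  by (simp add: coord_br coord_basis if_distrib[of "\<lambda>t. t * _"] sum_if_outer cong: if_cong)

lemma br_add_left: "br x (u + u') w = br x u w + br x u' w"
  by (rule coord_eqI) (simp add: coord_br coord_add algebra_simps sum.distrib)

lemma br_add_right: "br x u (w + w') = br x u w + br x u w'"
  by (rule coord_eqI) (simp add: coord_br coord_add algebra_simps sum.distrib)

lemma br_scale_left: "br x (sc t u) w = sc t (br x u w)"
  by (rule coord_eqI) (simp add: coord_br coord_scale algebra_simps sum_distrib_left)

lemma br_scale_right: "br x u (sc t w) = sc t (br x u w)"
  by (rule coord_eqI) (simp add: coord_br coord_scale algebra_simps sum_distrib_left)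

lemma lin_br_left: "lin (\<lambda>u. br x u w)" and lin_br_right: "lin (br x u)"
  by (simp_all add: linear_iff_sc br_add_left br_add_right br_scale_left br_scale_right)

lemmas br_zero_left = lin_0[OF lin_br_left] and br_zero_right = lin_0[OF lin_br_right]
  and br_neg_left = lin_neg[OF lin_br_left] and br_neg_right = lin_neg[OF lin_br_right]
  and br_diff_left = lin_diff[OF lin_br_left] and br_diff_right = lin_diff[OF lin_br_right]

lemmas br_bilinear = br_add_left br_add_right br_scale_left br_scale_right br_zero_left br_zero_right
  br_neg_left br_neg_right br_diff_left br_diff_right

lemma br_plus: "br (x + y) u w = br x u w + br y u w"
  by (rule coord_eqI) (simp add: coord_br coord_add algebra_simps sum.distrib)

lemma br_smult: "br (t *s x) u w = sc t (br x u w)"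
  by (rule coord_eqI) (simp add: coord_br coord_scale algebra_simps sum_distrib_left)

lemma br_zero: "br 0 u w = 0"
  by (rule coord_eqI) (simp add: coord_br coord_zero)

lemma br_minus: "br (x - y) u w = br x u w - br y u w"
  by (rule coord_eqI) (simp add: coord_br coord_diff algebra_simps sum_subtractf)

lemma br_uminus: "br (- x) u w = - br x u w"
  using br_minus[of 0 x u w] by (simp add: br_zero)

lemmas br_svec = br_plus br_smult br_zero br_minus br_uminus

lemma svec_eqI:
  assumes "\<And>u w. br x u w = br y u w"
  shows "x = y"
  unfolding vec_eq_iff using assms coord_br_basis by (metis prod_cases3)

definition bilin :: "('v \<Rightarrow> 'v \<Rightarrow> 'v) \<Rightarrow> bool" where
  "bilin p \<longleftrightarrow> (\<forall>w. lin (\<lambda>u. p u w)) \<and> (\<forall>u. lin (p u))"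

text \<open>\<open>sv\<close> records only the values of p on pairs of basis vectors; bilinearity is
  what lets these determine p.\<close>

lemma br_sv:
  assumes "bilin p"
  shows "br (sv p) u w = p u w"
proof (rule coord_eqI)
  fix k
  have l: "lin (\<lambda>u. p u w)" "\<And>u. lin (p u)" for w using assms unfolding bilin_def by blast+
  have "c (p u w) k = (\<Sum>i\<in>UNIV. c u i * (\<Sum>j\<in>UNIV. c w j * c (p (v i) (v j)) k))"
    by (subst coord_lin_expansion[OF l(1)], subst coord_lin_expansion[OF l(2)]) simp
  then show "c (br (sv p) u w) k = c (p u w) k"
    by (simp add: coord_br struct_vec_def sum_distrib_left mult.assoc)
qed

lemma GL_D: "g \<in> G \<Longrightarrow> lin g" "g \<in> G \<Longrightarrow> bij g"
  unfolding GL_def by blast+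

lemma GL_add: "g \<in> G \<Longrightarrow> g (u + w) = g u + g w" and GL_scale: "g \<in> G \<Longrightarrow> g (sc t u) = sc t (g u)"
  by (simp_all add: GL_D lin_add lin_scale)

lemma GL_inv [simp]: "g \<in> G \<Longrightarrow> inv g (g u) = u" "g \<in> G \<Longrightarrow> g (inv g u) = u"
  using GL_D(2) by (simp_all add: bij_is_inj bij_is_surj surj_f_inv_f)

lemma inv_GL: "g \<in> G \<Longrightarrow> inv g \<in> G"
proof -
  assume g: "g \<in> G"
  have "inv g (u + w) = inv g u + inv g w" for u w
    using GL_inv[OF g] lin_add[OF GL_D(1)[OF g]] by metis
  moreover have "inv g (sc t u) = sc t (inv g u)" for t u
    using GL_inv[OF g] lin_scale[OF GL_D(1)[OF g]] by metis
  ultimately show ?thesis using bij_imp_bij_inv[OF GL_D(2)[OF g]] by (simp add: GL_def linear_iff_sc)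
qed

lemma br_act:
  assumes g: "g \<in> G"
  shows "br (act x g) u w = inv g (br x (g u) (g w))"
  unfolding svec_act_def
  by (rule br_sv) (simp add: bilin_def linear_iff_sc br_bilinear
      GL_add[OF g] GL_scale[OF g] GL_add[OF inv_GL[OF g]] GL_scale[OF inv_GL[OF g]])

lemma gmodule_\<Lambda>: "gmodule G \<Lambda>"
proof
  fix g assume g: "g \<in> G"
  note l = GL_add[OF inv_GL[OF g]] GL_scale[OF inv_GL[OF g]]
  show "gact \<Lambda> (gadd \<Lambda> x y) g = gadd \<Lambda> (gact \<Lambda> x g) (gact \<Lambda> y g)" for x y
    by (simp add: svec_module_def, rule svec_eqI) (simp add: br_act g br_plus l)
  show "gact \<Lambda> (gsmult \<Lambda> t x) g = gsmult \<Lambda> t (gact \<Lambda> x g)" for t x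
    by (simp add: svec_module_def, rule svec_eqI) (simp add: br_act g br_smult l)
  have "act (act x (inv g)) g = x" for x
    by (rule svec_eqI) (simp add: br_act g inv_GL[OF g] inv_inv_eq[OF GL_D(2)[OF g]])
  then show "\<exists>h\<in>G. \<forall>x\<in>gcarrier \<Lambda>. gact \<Lambda> (gact \<Lambda> x h) g = x"
    using inv_GL[OF g] by (auto simp: svec_module_def)
qed (simp_all add: svec_module_def vec_eq_iff algebra_simps)

sublocale \<Lambda>: gmodule G \<Lambda> by (rule gmodule_\<Lambda>)

lemma gsubmodule_iff:
  "gsubmodule G \<Lambda> S \<longleftrightarrow> 0 \<in> S \<and> (\<forall>x\<in>S. \<forall>y\<in>S. x + y \<in> S) \<and> (\<forall>t. \<forall>x\<in>S. t *s x \<in> S) \<and>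
     (\<forall>g\<in>G. \<forall>x\<in>S. act x g \<in> S)"
  by (simp add: gsubmodule_def svec_module_def)

lemma gsubmodule_diff: "gsubmodule G \<Lambda> S \<Longrightarrow> x \<in> S \<Longrightarrow> y \<in> S \<Longrightarrow> x - y \<in> S"
proof -
  assume "gsubmodule G \<Lambda> S" "x \<in> S" "y \<in> S"
  then have "x + (-1) *s y \<in> S" unfolding gsubmodule_iff by blast
  also have "x + (-1) *s y = x - y" by (simp add: vec_eq_iff)
  finally show ?thesis .
qed

lemma gsubmodule_sum: "gsubmodule G \<Lambda> S \<Longrightarrow> (\<And>i. i \<in> A \<Longrightarrow> f i \<in> S) \<Longrightarrow> sum f A \<in> S"
  by (induction A rule: infinite_finite_induct) (auto simp: gsubmodule_iff)

lemma gsubmodule_Int: "gsubmodule G \<Lambda> S \<Longrightarrow> gsubmodule G \<Lambda> T \<Longrightarrow> gsubmodule G \<Lambda> (S \<inter> T)"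
  unfolding gsubmodule_iff by blast

lemma act_add: "g \<in> G \<Longrightarrow> act (x + y) g = act x g + act y g"
  using \<Lambda>.act_add[of g x y] by (simp add: svec_module_def)

lemma act_smult: "g \<in> G \<Longrightarrow> act (t *s x) g = t *s act x g"
  using \<Lambda>.act_smult[of g x t] by (simp add: svec_module_def)

lemma gsubmodule_plus:
  assumes S: "gsubmodule G \<Lambda> S" and T: "gsubmodule G \<Lambda> T"
  shows "gsubmodule G \<Lambda> (S + T)"
  unfolding gsubmodule_iff
proof (intro conjI ballI allI)
  show "0 \<in> S + T" using S T unfolding gsubmodule_iff by (metis add_0 set_plus_intro)
next
  fix x y assume "x \<in> S + T" "y \<in> S + T"
  then obtain a b a' b' where *: "a \<in> S" "b \<in> T" "a' \<in> S" "b' \<in> T" "x = a + b" "y = a' + b'"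
    by (elim set_plus_elim) blast
  have "x + y = (a + a') + (b + b')" using * by simp
  moreover have "a + a' \<in> S" "b + b' \<in> T" using * S T unfolding gsubmodule_iff by blast+
  ultimately show "x + y \<in> S + T" by (metis set_plus_intro)
next
  fix t x assume "x \<in> S + T"
  then obtain a b where *: "a \<in> S" "b \<in> T" "x = a + b" by (elim set_plus_elim) blast
  have "t *s x = t *s a + t *s b" using * by (simp add: vec_eq_iff algebra_simps)
  moreover have "t *s a \<in> S" "t *s b \<in> T" using * S T unfolding gsubmodule_iff by blast+
  ultimately show "t *s x \<in> S + T" by (metis set_plus_intro)
next
  fix g x assume g: "g \<in> G" and "x \<in> S + T"
  then obtain a b where *: "a \<in> S" "b \<in> T" "x = a + b" by (elim set_plus_elim) blast
  have "act x g = act a g + act b g" using * by (simp add: act_add g)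
  moreover have "act a g \<in> S" "act b g \<in> T" using * S T g unfolding gsubmodule_iff by blast+
  ultimately show "act x g \<in> S + T" by (metis set_plus_intro)
qed

section \<open>Traces of left and right multiplications, first submodules\<close>

abbreviation tr :: "('v \<Rightarrow> 'v) \<Rightarrow> 'a" where "tr \<equiv> lin_trace sc v"

lemma tr_eq: "tr f = (\<Sum>j\<in>UNIV. c (f (v j)) j)"
  by (simp add: lin_trace_def trace_def)

lemma tr_compose:
  assumes "lin f" "lin g"
  shows "tr (\<lambda>u. f (g u)) = tr (\<lambda>u. g (f u))"
proof -
  have "tr (\<lambda>u. f (g u)) = (\<Sum>j\<in>UNIV. \<Sum>k\<in>UNIV. c (g (v j)) k * c (f (v k)) j)"
    unfolding tr_eq by (rule sum.cong[OF refl]) (rule coord_lin_expansion[OF assms(1)])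
  also have "\<dots> = (\<Sum>k\<in>UNIV. \<Sum>j\<in>UNIV. c (f (v k)) j * c (g (v j)) k)"
    by (subst sum.swap) (simp add: mult.commute)
  also have "\<dots> = tr (\<lambda>u. g (f u))"
    unfolding tr_eq by (rule sum.cong[OF refl]) (rule coord_lin_expansion[OF assms(2), symmetric])
  finally show ?thesis .
qed

text \<open>The trace is defined in the fixed basis, so its invariance under conjugation has to come
  from tr(fg) = tr(gf). It makes \<open>trL\<close> and \<open>trR\<close> equivariant.\<close>

lemma tr_conj:
  assumes g: "g \<in> G" and f: "lin f"
  shows "tr (\<lambda>u. inv g (f (g u))) = tr f"
proof -
  have "lin (\<lambda>u. f (g u))" using f GL_D(1)[OF g] by (simp add: linear_iff_sc)
  from tr_compose[OF GL_D(1)[OF inv_GL[OF g]] this] show ?thesis by (simp add: g)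
qed

definition trL :: "('a, 'n) svec \<Rightarrow> 'v \<Rightarrow> 'a" where "trL x u = tr (br x u)"
definition trR :: "('a, 'n) svec \<Rightarrow> 'v \<Rightarrow> 'a" where "trR x u = tr (\<lambda>w. br x w u)"

lemma trL_eq: "trL x u = (\<Sum>j\<in>UNIV. c (br x u (v j)) j)"
  and trR_eq: "trR x u = (\<Sum>j\<in>UNIV. c (br x (v j) u) j)"
  by (simp_all add: trL_def trR_def tr_eq)

lemma trL_basis: "trL x (v i) = (\<Sum>j\<in>UNIV. x $ (i, j, j))"
  and trR_basis: "trR x (v i) = (\<Sum>j\<in>UNIV. x $ (j, i, j))"
  by (simp_all add: trL_eq trR_eq coord_br_basis)

lemma trL_svec: "trL (x + y) u = trL x u + trL y u" "trL (t *s x) u = t * trL x u"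
    "trL 0 u = 0" "trL (x - y) u = trL x u - trL y u"
  and trR_svec: "trR (x + y) u = trR x u + trR y u" "trR (t *s x) u = t * trR x u"
    "trR 0 u = 0" "trR (x - y) u = trR x u - trR y u"
  by (simp_all add: trL_eq trR_eq br_svec coord_simps sum.distrib sum_distrib_left sum_subtractf)

lemma dual_trL: "dual (trL x)" and dual_trR: "dual (trR x)"
  by (simp_all add: dual_iff trL_eq trR_eq br_bilinear coord_simps sum.distrib sum_distrib_left)

lemma trL_act: "g \<in> G \<Longrightarrow> trL (act x g) u = trL x (g u)"
  and trR_act: "g \<in> G \<Longrightarrow> trR (act x g) u = trR x (g u)"
  unfolding trL_def trR_def
  using tr_conj[OF _ lin_br_right, of g x "g u"] tr_conj[OF _ lin_br_left, of g x "g u"]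
  by (simp_all add: br_act tr_eq)

abbreviation V_hat :: "('a, 'v \<Rightarrow> 'v, 'v \<Rightarrow> 'a) gmod" where "V_hat \<equiv> dual_module sc"
abbreviation "C \<equiv> mod_C sc v"
abbreviation "K \<equiv> mod_K sc v"
abbreviation "T \<equiv> mod_T sc v"
abbreviation "T' \<equiv> mod_T_tilde sc v"
abbreviation "U \<equiv> mod_U sc v"
abbreviation "N \<equiv> mod_N sc v"
abbreviation "Mss \<equiv> mod_Mss sc v"
abbreviation "W \<equiv> mod_Ms11 sc v"

lemma T_iff: "x \<in> T \<longleftrightarrow> (\<forall>u. trL x u = 0)" and T'_iff: "x \<in> T' \<longleftrightarrow> (\<forall>u. trR x u = 0)"
  by (simp_all add: mod_T_def mod_T_tilde_def trL_def trR_def)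

lemma gsubmodule_C: "gsubmodule G \<Lambda> C"
  unfolding gsubmodule_iff mod_C_def by (simp add: br_svec br_act)

lemma gsubmodule_K: "gsubmodule G \<Lambda> K"
  unfolding gsubmodule_iff mod_K_def
  by (simp add: br_svec br_act lin_0[OF GL_D(1)[OF inv_GL]])

lemma gsubmodule_T: "gsubmodule G \<Lambda> T" and gsubmodule_T': "gsubmodule G \<Lambda> T'"
  unfolding gsubmodule_iff Ball_def T_iff T'_iff by (simp_all add: trL_svec trR_svec trL_act trR_act)

lemma gsubmodule_U: "gsubmodule G \<Lambda> U" and gsubmodule_N: "gsubmodule G \<Lambda> N"
  unfolding mod_U_def mod_N_def
  by (simp_all add: gsubmodule_Int gsubmodule_C gsubmodule_K gsubmodule_T)

lemma dual_eqI:
  assumes "dual f" "dual h" "\<And>i. f (v i) = h (v i)"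
  shows "f = h"
proof
  show "f u = h u" for u
    unfolding dual_expansion[OF assms(1), of u] dual_expansion[OF assms(2), of u] by (simp only: assms(3))
qed

lemma sc_eq_iff: "sc s u = sc t u \<longleftrightarrow> s = t \<or> u = 0"
  by (rule scale_cancel_right)

lemma basis_nonzero: "v i \<noteq> 0"
  using coord_basis[of i i] coord_zero[of i] by force

lemma dual_eq_of_eigen:
  assumes f: "dual f" and h: "dual h" and eq: "\<And>u. sc (f u) u = sc (h u) u"
  shows "f = h"
  by (rule dual_eqI[OF f h]) (use eq basis_nonzero sc_eq_iff in blast)

lemma basis_indices:
  obtains i j k :: 'n where "i \<noteq> j" "i \<noteq> k" "j \<noteq> k"
proof -
  obtain S :: "'n set" where "card S = 3" using card_n obtain_subset_with_card_n by blast
  then show thesis using that by (auto simp: card_3_iff)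
qed

text \<open>The case i = j is allowed, so this also supplies an index different from a single given
  one.\<close>

lemma another_index:
  obtains k :: 'n where "k \<noteq> i" "k \<noteq> j"
proof -
  have "card {i, j} < CARD('n)" using card_n card_insert_le_m1[of 2 "{j}" i] by simp
  then have "{i, j} \<noteq> UNIV" by (metis less_irrefl)
  then show thesis using that by blast
qed

section \<open>Special structure vectors and alternating products\<close>

definition opp :: "('a, 'n) svec \<Rightarrow> ('a, 'n) svec" where "opp x = sv (\<lambda>u w. br x w u)"

lemma br_opp: "br (opp x) u w = br x w u"
  unfolding opp_def by (rule br_sv) (simp add: bilin_def lin_br_left lin_br_right)

lemma opp_nth [simp]: "opp x $ (i, j, k) = x $ (j, i, k)"
  by (simp add: coord_br_basis[symmetric] br_opp)

text \<open>The polarisation of the quadratic map u -> [u,u], left without a factor 1/2 so that it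
  makes sense in characteristic 2.\<close>

definition symm :: "('a, 'n) svec \<Rightarrow> ('a, 'n) svec" where "symm x = x + opp x"

lemma br_symm: "br (symm x) u w = br x u w + br x w u"
  by (simp add: symm_def br_plus br_opp)

text \<open>The model element of \<open>Mss\<close> with [u,u] = \<theta>(u) u.\<close>

definition R :: "('v \<Rightarrow> 'a) \<Rightarrow> ('a, 'n) svec" where "R \<theta> = sv (\<lambda>u w. sc (\<theta> u) w)"
definition Y :: "('v \<Rightarrow> 'a) \<Rightarrow> ('a, 'n) svec" where "Y \<theta> = sv (\<lambda>u w. sc (\<theta> w) u + sc (\<theta> u) w)"
definition ten :: "('v \<Rightarrow> 'a) \<Rightarrow> ('v \<Rightarrow> 'a) \<Rightarrow> 'v \<Rightarrow> ('a, 'n) svec" where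
  "ten \<phi> \<psi> a = sv (\<lambda>u w. sc (\<phi> u * \<psi> w) a)"

lemma br_R: "dual \<theta> \<Longrightarrow> br (R \<theta>) u w = sc (\<theta> u) w"
  and br_Y: "dual \<theta> \<Longrightarrow> br (Y \<theta>) u w = sc (\<theta> w) u + sc (\<theta> u) w"
  and br_ten: "dual \<phi> \<Longrightarrow> dual \<psi> \<Longrightarrow> br (ten \<phi> \<psi> a) u w = sc (\<phi> u * \<psi> w) a"
  unfolding R_def Y_def ten_def
  by (rule br_sv; simp add: bilin_def linear_iff_sc dual_simps algebra_simps)+

lemma W_iff: "x \<in> W \<longleftrightarrow> (\<exists>\<theta>. dual \<theta> \<and> x = Y \<theta>)"
  unfolding mod_Ms11_def Y_def by blast

text \<open>The unit structure vectors, written as tensors so that a transvection can be applied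
  factor by factor.\<close>

abbreviation E :: "'n \<Rightarrow> 'n \<Rightarrow> 'n \<Rightarrow> ('a, 'n) svec" where
  "E i j k \<equiv> ten (\<lambda>u. c u i) (\<lambda>u. c u j) (v k)"

lemma br_E: "br (E i j k) u w = sc (c u i * c w j) (v k)"
  by (simp add: br_ten dual_coord)

lemma E_nth: "E i j k $ (p, q, r) = (if i = p then if j = q then if k = r then 1 else 0 else 0 else 0)"
  unfolding coord_br_basis[symmetric] by (auto simp: br_E coord_simps)

lemma order_index:
  obtains f :: "'n \<Rightarrow> nat" where "inj f"
  using finite_imp_inj_to_nat_seg[of "UNIV :: 'n set"] by auto

text \<open>Keeping the entries with i before j, in some order of the indices, gives y. Nothing is
  halved, so the decomposition is also available in characteristic 2.\<close>

lemma alternating_eq_diff: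
  fixes x :: "('a, 'n) svec"
  assumes "\<And>i k. x $ (i, i, k) = 0" "\<And>i j k. x $ (i, j, k) + x $ (j, i, k) = 0"
  obtains y where "x = y - opp y"
proof -
  obtain f :: "'n \<Rightarrow> nat" where f: "inj f" by (rule order_index)
  define y :: "('a, 'n) svec" where "y = (\<chi> p. if f (fst p) < f (fst (snd p)) then x $ p else 0)"
  have "x $ (i, j, k) = y $ (i, j, k) - y $ (j, i, k)" for i j k
    using assms(1)[of i k] assms(2)[of i j k] inj_eq[OF f, of i j]
    by (cases "f i" "f j" rule: linorder_cases) (auto simp: y_def eq_neg_iff_add_eq_0)
  then have "x = y - opp y" by (simp add: vec_eq_iff)
  then show thesis by (rule that)
qed

lemma K_antisym: "x \<in> K \<Longrightarrow> br x u w = - br x w u"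
proof -
  assume x: "x \<in> K"
  have "br x (u + w) (u + w) = 0" "br x u u = 0" "br x w w = 0" using x unfolding mod_K_def by blast+
  then show ?thesis by (simp add: br_bilinear eq_neg_iff_add_eq_0 add.commute)
qed

lemma K_nth:
  assumes "x \<in> K"
  shows "x $ (i, i, k) = 0" "x $ (i, j, k) + x $ (j, i, k) = 0"
proof -
  show "x $ (i, i, k) = 0"
    using assms coord_br_basis[of x i i k] by (simp add: mod_K_def coord_zero)
  show "x $ (i, j, k) + x $ (j, i, k) = 0"
    using arg_cong[OF K_antisym[OF assms, of "v i" "v j"], of "\<lambda>u. c u k"]
    by (simp add: coord_neg coord_br_basis)
qed

lemma diff_opp_in_K: "y - opp y \<in> K"
  by (simp add: mod_K_def br_svec br_opp)

lemma K_iff_nth: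
  "x \<in> K \<longleftrightarrow> (\<forall>i k. x $ (i, i, k) = 0) \<and> (\<forall>i j k. x $ (i, j, k) + x $ (j, i, k) = 0)"
  using K_nth alternating_eq_diff[of x] diff_opp_in_K by metis

lemma K_obtain:
  assumes "x \<in> K"
  obtains y where "x = y - opp y"
  using alternating_eq_diff[of x] K_nth[OF assms] by blast

section \<open>Linearity of the eigenvalue on \<open>Mss\<close>\<close>

text \<open>On \<open>Mss\<close> this is the functional \<theta> with [u,u] = \<theta>(u) u: it is
  the only linear candidate, since the value at \<open>v i\<close> must be the diagonal
  entry.\<close>

definition th :: "('a, 'n) svec \<Rightarrow> 'v \<Rightarrow> 'a" where "th x u = (\<Sum>i\<in>UNIV. c u i * x $ (i, i, i))"

lemma dual_th: "dual (th x)"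
  unfolding th_def by (rule dual_combination)

lemma th_basis: "th x (v i) = x $ (i, i, i)"
  by (simp add: th_def coord_basis if_distrib[of "\<lambda>t. t * _"] cong: if_cong)

lemma R_nth: "dual \<theta> \<Longrightarrow> R \<theta> $ (i, j, k) = (if j = k then \<theta> (v i) else 0)"
  unfolding coord_br_basis[symmetric] by (simp add: br_R coord_simps)

text \<open>Membership in \<open>Mss\<close> gives a scalar for each vector separately; the content
  is that these scalars can be chosen linearly. Testing the vectors \<open>v i\<close> + t
  \<open>v j\<close> suffices.\<close>

lemma Mss_diff_R:
  assumes x: "x \<in> Mss"
  shows "x - R (th x) \<in> K"
proof -
  have e: "\<exists>t. br x u u = sc t u" for u using x unfolding mod_Mss_def by blast
  have diag: "x $ (i, i, k) = 0" if "i \<noteq> k" for i k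
  proof -
    obtain t where "br x (v i) (v i) = sc t (v i)" using e by blast
    then have "c (br x (v i) (v i)) k = c (sc t (v i)) k" by simp
    then show ?thesis using that by (simp add: coord_br_basis coord_simps)
  qed
  have off: "x $ (i, j, k) + x $ (j, i, k) = (if j = k then x $ (i, i, i) else 0) + (if i = k then x $ (j, j, j) else 0)"
    if ij: "i \<noteq> j" for i j k
  proof -
    let ?m = "\<lambda>p. x $ (i, j, p) + x $ (j, i, p)"
    \<comment> \<open>The condition [u,u] = s u at u = \<open>v i\<close> + t \<open>v j\<close>,
      read in coordinate p.\<close>
    have s: "\<exists>s. \<forall>p. x $ (i, i, p) + t * ?m p + t * t * x $ (j, j, p) =
        s * ((if i = p then 1 else 0) + t * (if j = p then 1 else 0))" for t
    proof -
      obtain s where "br x (v i + sc t (v j)) (v i + sc t (v j)) = sc s (v i + sc t (v j))" using e by blast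
      then have "c (br x (v i + sc t (v j)) (v i + sc t (v j))) p = c (sc s (v i + sc t (v j))) p" for p
        by simp
      then have "x $ (i, i, p) + t * ?m p + t * t * x $ (j, j, p) =
          s * ((if i = p then 1 else 0) + t * (if j = p then 1 else 0))" for p
        by (simp only: br_bilinear coord_simps coord_br_basis) (simp add: algebra_simps)
      then show ?thesis by blast
    qed
    \<comment> \<open>Coordinates i and j both compute s; the latter after cancelling a factor
      t.\<close>
    have eq: "x $ (i, i, i) + t * ?m i = ?m j + t * x $ (j, j, j)" if t: "t \<noteq> 0" for t
    proof -
      obtain s where s: "\<And>p. x $ (i, i, p) + t * ?m p + t * t * x $ (j, j, p) =
        s * ((if i = p then 1 else 0) + t * (if j = p then 1 else 0))" using s by blast
      have "x $ (i, i, i) + t * ?m i = s" using s[of i] ij diag[of j i] by simp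
      moreover have "t * (?m j + t * x $ (j, j, j)) = t * s"
        using s[of j] ij diag[of i j] by (simp add: algebra_simps)
      ultimately show ?thesis using t by simp
    qed
    \<comment> \<open>The affine identity \<open>eq\<close> at the two distinct nonzero scalars t
      and 1 separates its coefficients.\<close>
    obtain t :: 'a where t: "t \<noteq> 0" "t \<noteq> 1" using field_large by blast
    have "(t - 1) * ?m i = (x $ (i, i, i) + t * ?m i) - (x $ (i, i, i) + 1 * ?m i)"
      by (simp add: algebra_simps)
    also have "\<dots> = (?m j + t * x $ (j, j, j)) - (?m j + 1 * x $ (j, j, j))"
      by (simp only: eq[OF t(1)] eq[OF one_neq_zero])
    also have "\<dots> = (t - 1) * x $ (j, j, j)" by (simp add: algebra_simps)
    finally have mi: "?m i = x $ (j, j, j)" using t(2) by simp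
    then have mj: "?m j = x $ (i, i, i)" using eq[of 1] by simp
    have "?m k = 0" if "k \<noteq> i" "k \<noteq> j"
    proof -
      obtain s where "\<And>p. x $ (i, i, p) + 1 * ?m p + 1 * 1 * x $ (j, j, p) =
        s * ((if i = p then 1 else 0) + 1 * (if j = p then 1 else 0))" using s by blast
      from this[of k] show ?thesis using that diag[of i k] diag[of j k] by simp
    qed
    then show ?thesis using mi mj ij by auto
  qed
  have d0: "(x - R (th x)) $ (i, i, k) = 0" for i k
    using diag[of i k] by (simp add: R_nth dual_th th_basis)
  moreover have "(x - R (th x)) $ (i, j, k) + (x - R (th x)) $ (j, i, k) = 0" for i j k
  proof (cases "i = j")
    case False
    then show ?thesis using off[OF False, of k] by (simp add: R_nth dual_th th_basis algebra_simps)
  qed (simp only: d0 add_0)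
  ultimately show ?thesis unfolding K_iff_nth by blast
qed

lemma Mss_square: "x \<in> Mss \<Longrightarrow> br x u u = sc (th x u) u"
  using Mss_diff_R[of x] by (simp add: mod_K_def br_svec br_R dual_th)

lemma Mss_iff: "x \<in> Mss \<longleftrightarrow> (\<forall>u. br x u u = sc (th x u) u)"
  using Mss_square unfolding mod_Mss_def by blast

lemma th_eqI:
  assumes "dual \<theta>" "\<And>u. br x u u = sc (\<theta> u) u"
  shows "th x = \<theta>"
proof (rule dual_eq_of_eigen[OF dual_th assms(1)])
  have "x \<in> Mss" using assms(2) unfolding mod_Mss_def by blast
  then show "sc (th x u) u = sc (\<theta> u) u" for u using Mss_square[of x u] assms(2)[of u] by metis
qed

lemma th_svec: "th (x + y) u = th x u + th y u" "th (t *s x) u = t * th x u" "th 0 u = 0"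
  by (simp_all add: th_def algebra_simps sum.distrib sum_distrib_left)

lemma th_act:
  assumes g: "g \<in> G" and x: "x \<in> Mss"
  shows "th (act x g) = (\<lambda>u. th x (g u))"
proof (rule th_eqI)
  show "dual (\<lambda>u. th x (g u))" using dual_th by (simp add: dual_iff GL_add[OF g] GL_scale[OF g])
  show "br (act x g) u u = sc (th x (g u)) u" for u
    by (simp add: br_act g Mss_square[OF x] GL_scale[OF inv_GL[OF g]])
qed

lemma gsubmodule_Mss: "gsubmodule G \<Lambda> Mss"
  unfolding gsubmodule_iff
proof (intro conjI ballI allI)
  show "0 \<in> Mss" unfolding mod_Mss_def by (auto simp: br_zero intro: exI[of _ 0])
  show "x + y \<in> Mss" if "x \<in> Mss" "y \<in> Mss" for x y
    unfolding Mss_iff th_svec by (simp add: br_plus Mss_square[OF that(1)] Mss_square[OF that(2)] scale_left_distrib)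
  show "t *s x \<in> Mss" if "x \<in> Mss" for t x
    unfolding Mss_iff th_svec by (simp add: br_smult Mss_square[OF that])
  show "act x g \<in> Mss" if "g \<in> G" "x \<in> Mss" for x g
    unfolding Mss_iff th_act[OF that]
    by (simp add: br_act that Mss_square[OF that(2)] GL_scale[OF inv_GL[OF that(1)]])
qed

lemma K_subset_Mss: "K \<subseteq> Mss"
proof
  fix x assume "x \<in> K"
  then have "br x u u = sc 0 u" for u by (simp add: mod_K_def)
  then show "x \<in> Mss" unfolding mod_Mss_def by blast
qed

section \<open>Copies of the dual space: \<open>Mss\<close>/\<open>K\<close> and
  \<open>W\<close>\<close>

lemma gcarrier_\<Lambda>: "gcarrier \<Lambda> = UNIV" and gzero_\<Lambda>: "gzero \<Lambda> = 0" and grestrict_UNIV: "grestrict \<Lambda> UNIV = \<Lambda>"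
  by (simp_all add: svec_module_def grestrict_def)

lemma gepi_iff:
  "gepi G (grestrict \<Lambda> B) V f L \<longleftrightarrow> f ` B = gcarrier V \<and> f 0 = gzero V \<and>
     (\<forall>x\<in>B. \<forall>y\<in>B. f (x + y) = gadd V (f x) (f y)) \<and> (\<forall>t. \<forall>x\<in>B. f (t *s x) = gsmult V t (f x)) \<and>
     (\<forall>g\<in>G. \<forall>x\<in>B. f (act x g) = gact V (f x) g) \<and> L = {x \<in> B. f x = gzero V}"
  by (simp add: gepi_def grestrict_def svec_module_def)

lemma gmodule_V_hat: "gmodule G V_hat"
proof
  fix g assume g: "g \<in> G"
  show "\<exists>h\<in>G. \<forall>x\<in>gcarrier V_hat. gact V_hat (gact V_hat x h) g = x"
    using inv_GL[OF g] g by (intro bexI[of _ "inv g"]) (simp_all add: dual_module_def)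
  show "x \<in> gcarrier V_hat \<Longrightarrow> gact V_hat x g \<in> gcarrier V_hat" for x
    by (simp add: dual_module_def dual_iff GL_add[OF g] GL_scale[OF g])
qed (auto simp: dual_module_def dual_iff algebra_simps fun_eq_iff)

sublocale V_hat: gmodule G V_hat by (rule gmodule_V_hat)

text \<open>Surjectivity comes from \<open>R\<close>, since \<open>th (R \<phi>)\<close> is
  \<phi>.\<close>

lemma gepi_th: "gepi G (grestrict \<Lambda> Mss) V_hat th K"
proof -
  have "th ` Mss = {\<phi>. dual \<phi>}"
  proof
    show "{\<phi>. dual \<phi>} \<subseteq> th ` Mss"
    proof
      fix \<phi> assume "\<phi> \<in> {\<phi>. dual \<phi>}"
      then have \<phi>: "dual \<phi>" by simp
      have "R \<phi> \<in> Mss" unfolding mod_Mss_def using br_R[OF \<phi>] by blast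
      moreover have "th (R \<phi>) = \<phi>" by (rule th_eqI[OF \<phi> br_R[OF \<phi>]])
      ultimately show "\<phi> \<in> th ` Mss" by (metis image_eqI)
    qed
  qed (use dual_th in blast)
  moreover have "K = {x \<in> Mss. th x = (\<lambda>u. 0)}"
  proof -
    have "x \<in> K \<longleftrightarrow> th x = (\<lambda>u. 0)" if "x \<in> Mss" for x
    proof
      assume "x \<in> K"
      then show "th x = (\<lambda>u. 0)" by (intro th_eqI) (simp_all add: dual_iff mod_K_def)
    next
      assume "th x = (\<lambda>u. 0)"
      then show "x \<in> K" using Mss_square[OF that] by (simp add: mod_K_def)
    qed
    then show ?thesis using K_subset_Mss by blast
  qed
  ultimately show ?thesis unfolding gepi_iff
    by (simp add: dual_module_def th_svec th_act fun_eq_iff)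
qed

lemma Y_add: "dual \<phi> \<Longrightarrow> dual \<psi> \<Longrightarrow> Y (\<lambda>u. \<phi> u + \<psi> u) = Y \<phi> + Y \<psi>"
  by (rule svec_eqI) (simp add: br_svec br_Y dual_iff algebra_simps)

lemma Y_smult: "dual \<phi> \<Longrightarrow> Y (\<lambda>u. t * \<phi> u) = t *s Y \<phi>"
  by (rule svec_eqI) (simp add: br_svec br_Y dual_iff algebra_simps)

lemma Y_act: "dual \<phi> \<Longrightarrow> g \<in> G \<Longrightarrow> Y (\<lambda>u. \<phi> (g u)) = act (Y \<phi>) g"
  by (rule svec_eqI) (simp add: br_act br_Y dual_iff GL_add GL_scale inv_GL)

lemma Y_0: "Y (\<lambda>u. 0) = 0"
  by (rule svec_eqI) (simp add: br_svec br_Y dual_iff)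

lemma Y_eq_0_iff:
  assumes \<phi>: "dual \<phi>"
  shows "Y \<phi> = 0 \<longleftrightarrow> \<phi> = (\<lambda>u. 0)"
proof
  assume y: "Y \<phi> = 0"
  show "\<phi> = (\<lambda>u. 0)"
  proof (rule dual_eqI[OF \<phi>])
    fix i :: 'n
    obtain j where "j \<noteq> i" using another_index by blast
    \<comment> \<open>For j different from i, the \<open>v j\<close>-coefficient of
      [\<open>v i\<close>, \<open>v j\<close>] is exactly \<phi>(\<open>v i\<close>).\<close>
    have "c (br (Y \<phi>) (v i) (v j)) j = 0" by (simp add: y br_zero coord_zero)
    then show "\<phi> (v i) = 0" using \<open>j \<noteq> i\<close> by (simp add: br_Y \<phi> coord_simps)
  qed (simp add: dual_iff)
qed (simp add: Y_0)

lemma gepi_Y: "gepi G V_hat (grestrict \<Lambda> W) Y {\<lambda>u. 0}"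
proof -
  have "Y ` {\<phi>. dual \<phi>} = W" unfolding set_eq_iff W_iff by blast
  moreover have "{\<lambda>u. 0} = {\<phi>. dual \<phi> \<and> Y \<phi> = 0}"
    using Y_eq_0_iff by (auto simp: dual_iff)
  ultimately show ?thesis unfolding gepi_def
    by (simp add: dual_module_def grestrict_def svec_module_def Y_0 Y_add Y_smult Y_act)
qed

lemma gsubmodule_W: "gsubmodule G \<Lambda> W"
proof -
  have W: "W = Y ` {\<phi>. dual \<phi>}" unfolding set_eq_iff W_iff by blast
  have "dual (\<lambda>u. \<phi> (g u))" if "g \<in> G" "dual \<phi>" for g \<phi>
    using that by (simp add: dual_iff GL_add GL_scale)
  then show ?thesis unfolding gsubmodule_iff W
    by (auto simp: Y_0[symmetric] Y_add[symmetric] Y_smult[symmetric] Y_act[symmetric] dual_iff algebra_simps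
        intro!: imageI)
qed

text \<open>The rank-one map w -> \<phi>(w) u contributes \<phi>(u), and the scalar map w ->
  \<phi>(u) w contributes n \<phi>(u).\<close>

lemma trL_Y: "dual \<phi> \<Longrightarrow> trL (Y \<phi>) u = (of_nat CARD('n) + 1) * \<phi> u"
  by (simp add: trL_eq br_Y coord_simps sum.distrib if_distrib[of "\<lambda>t. _ * t"] dual_expansion[of \<phi> u] mult.commute
      algebra_simps cong: if_cong)

section \<open>Transvections and extraction of the quadratic part\<close>

definition tv :: "('v \<Rightarrow> 'a) \<Rightarrow> 'v \<Rightarrow> 'v \<Rightarrow> 'v" where "tv \<phi> a u = u + sc (\<phi> u) a"

lemma tv_inverse:
  assumes "dual \<phi>" "\<phi> a = 0"
  shows "tv \<phi> a (u - sc (\<phi> u) a) = u" "tv \<phi> a u - sc (\<phi> (tv \<phi> a u)) a = u"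
  using assms by (simp_all add: tv_def dual_simps)

lemma bij_tv:
  assumes "dual \<phi>" "\<phi> a = 0"
  shows "bij (tv \<phi> a)"
  by (rule bij_betw_byWitness[where f' = "\<lambda>u. u - sc (\<phi> u) a"]) (simp_all add: tv_inverse[OF assms])

lemma tv_GL:
  assumes "dual \<phi>" "\<phi> a = 0"
  shows "tv \<phi> a \<in> G"
  using bij_tv[OF assms] assms(1)
  by (simp add: GL_def linear_iff_sc tv_def dual_simps algebra_simps)

lemma inv_tv:
  assumes "dual \<phi>" "\<phi> a = 0"
  shows "inv (tv \<phi> a) u = u - sc (\<phi> u) a"
  using inv_f_eq[OF bij_is_inj[OF bij_tv[OF assms]] tv_inverse(1)[OF assms]] .

lemma br_act_tv:
  assumes "dual \<phi>" "\<phi> a = 0"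
  shows "br (act x (tv \<phi> a)) u w =
    br x (u + sc (\<phi> u) a) (w + sc (\<phi> w) a) - sc (\<phi> (br x (u + sc (\<phi> u) a) (w + sc (\<phi> w) a))) a"
  by (simp only: br_act[OF tv_GL[OF assms]] inv_tv[OF assms]) (simp only: tv_def)

text \<open>Serves to move a configuration of independent vectors to chosen basis vectors; the
  images of the remaining basis vectors are left open.\<close>

lemma GL_extend:
  assumes "inj_on f S" "independent (f ` S)"
  obtains g where "g \<in> G" "\<And>i. i \<in> S \<Longrightarrow> g (v i) = f i"
proof -
  have fv: "f (inv v (v i)) = f i" for i by (simp add: inv_f_f[OF inj_v])
  have img: "(\<lambda>u. f (inv v u)) ` v ` S = f ` S" by (simp add: image_image fv)
  have "independent (v ` S)" by (rule independent_mono[OF independent_Basis]) blast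
  moreover have "independent ((\<lambda>u. f (inv v u)) ` v ` S)" unfolding img by (rule assms(2))
  moreover have "inj_on (\<lambda>u. f (inv v u)) (v ` S)"
    using assms(1) by (auto simp: inj_on_def fv)
  ultimately obtain g where g: "lin g" "inj g" "\<forall>x\<in>v ` S. g x = f (inv v x)"
    using linear_independent_extend_inj by blast
  have "surj g" by (rule linear_inj_imp_surj[OF g(1,2)])
  then have "g \<in> G" using g by (simp add: GL_def bij_def)
  then show thesis using that g(3) fv by simp
qed

lemma dual_span:
  assumes "dual \<phi>" "\<And>u. u \<in> S \<Longrightarrow> \<phi> u = 0" "w \<in> span S"
  shows "\<phi> w = 0"
proof -
  have "subspace {u. \<phi> u = 0}" using assms(1) by (simp add: subspace_def dual_simps)
  then have "span S \<subseteq> {u. \<phi> u = 0}" using assms(2) by (intro span_minimal) auto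
  then show ?thesis using assms(3) by blast
qed

lemma gsubmodule_smult_cancel:
  assumes "gsubmodule G \<Lambda> X" "t *s x \<in> X" "t \<noteq> 0"
  shows "x \<in> X"
proof -
  have "(1 / t) *s (t *s x) \<in> X" using assms(1,2) by (simp only: gsubmodule_iff)
  moreover have "(1 / t) *s (t *s x) = x" using assms(3) by (simp add: vec_eq_iff)
  ultimately show ?thesis by simp
qed

text \<open>The displayed vector is the coefficient of s^2 in the action of
  \<open>tv (s \<phi>) a\<close> on x. The cubic coefficient is a multiple of \<phi>([a,a]), which
  is assumed to vanish.\<close>

lemma D2_in_gsubmodule:
  assumes X: "gsubmodule G \<Lambda> X" and x: "x \<in> X" and \<phi>: "dual \<phi>" "\<phi> a = 0" "\<phi> (br x a a) = 0"
  shows "ten \<phi> \<phi> (br x a a) - ten \<phi> (\<lambda>w. \<phi> (br x a w)) a - ten (\<lambda>u. \<phi> (br x u a)) \<phi> a \<in> X"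
    (is "?D \<in> X")
proof -
  obtain t :: 'a where t: "t \<noteq> 0" "t \<noteq> 1" using field_large by blast
  define A where "A s = act x (tv (\<lambda>u. s * \<phi> u) a) - x" for s
  have d: "dual (\<lambda>u. s * \<phi> u)" "dual (\<lambda>w. \<phi> (br x a w))" "dual (\<lambda>u. \<phi> (br x u a))" for s
    using \<phi>(1) by (simp_all add: dual_iff br_bilinear algebra_simps)
  have A: "A s \<in> X" for s
    unfolding A_def using X x tv_GL[OF d(1)] \<phi>(2) by (intro gsubmodule_diff[OF X]) (simp_all add: gsubmodule_iff)
  \<comment> \<open>\<open>A s\<close> has the form s L + s^2 Q; this combination removes L.\<close>
  have "A t - t *s A 1 = (t * t - t) *s ?D"
  proof (rule svec_eqI, rule coord_eqI)
    fix u w i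
    show "c (br (A t - t *s A 1) u w) i = c (br ((t * t - t) *s ?D) u w) i"
      unfolding A_def
      by (simp add: br_svec br_act_tv d \<phi> br_ten br_bilinear dual_simps coord_simps algebra_simps)
  qed
  moreover have "A t - t *s A 1 \<in> X"
    using A X by (intro gsubmodule_diff[OF X]) (simp_all add: gsubmodule_iff)
  ultimately have "(t * t - t) *s ?D \<in> X" by (simp only:)
  then show ?thesis by (rule gsubmodule_smult_cancel[OF X]) (use t in simp)
qed

text \<open>A vector a with [a,a] not proportional to a is moved to \<open>v i\<close>, and [a,a] to
  \<open>v j\<close>. The quadratic part for the functional c_k and the vector \<open>v i\<close> is
  then \<open>E k k j\<close> plus terms with values along \<open>v i\<close>, which one further
  transvection cancels.\<close>

lemma E_diag_in_gsubmodule: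
  assumes X: "gsubmodule G \<Lambda> X" and x: "x \<in> X" "x \<notin> Mss" and ki: "k \<noteq> i"
  shows "E k k i \<in> X"
proof -
  obtain a where a: "\<And>t. br x a a \<noteq> sc t a" using x(2) unfolding mod_Mss_def by blast
  let ?b = "br x a a"
  \<comment> \<open>The third index carries [a,a], leaving k free for the functional; this is where
    n >= 3 is needed.\<close>
  obtain j where j: "j \<noteq> i" "j \<noteq> k" using another_index by blast
  have "a \<noteq> 0" using a[of 0] by (auto simp: br_bilinear)
  then have "independent {?b, a}"
    using a by (auto simp: independent_insert span_singleton)
  moreover define f where "f p = (if p = i then a else ?b)" for p
  moreover have "a \<noteq> ?b" using a[of 1] by auto
  ultimately have "inj_on f {i, j}" "independent (f ` {i, j})"
    using j by (auto simp: insert_commute)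
  then obtain g where g: "g \<in> G" "\<And>p. p \<in> {i, j} \<Longrightarrow> g (v p) = f p" using GL_extend by blast
  define y where "y = act x g"
  have y: "y \<in> X" unfolding y_def using X x(1) g(1) by (simp add: gsubmodule_iff)
  have "g (v i) = a" "g (v j) = ?b" using g(2)[of i] g(2)[of j] j by (simp_all add: f_def)
  then have yi: "br y (v i) (v i) = v j"
    unfolding y_def by (simp add: br_act[OF g(1)]) (metis GL_inv(1) g(1))
  define D where "D = E k k j - ten (\<lambda>u. c u k) (\<lambda>w. c (br y (v i) w) k) (v i)
      - ten (\<lambda>u. c (br y u (v i)) k) (\<lambda>u. c u k) (v i)"
  have D: "D \<in> X"
    unfolding D_def using D2_in_gsubmodule[OF X y dual_coord, of "v i" k] ki j by (simp add: yi coord_basis)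
  let ?g = "tv (\<lambda>u. c u j) (v i)"
  have ji: "c (v i) j = 0" using j by (simp add: coord_basis)
  have d: "dual (\<lambda>w. c (br y (v i) w) k)" "dual (\<lambda>u. c (br y u (v i)) k)"
    by (simp_all add: dual_iff br_bilinear coord_simps)
  \<comment> \<open>Acting by \<open>?g\<close> changes the value \<open>v j\<close> into
    \<open>v j - v i\<close>. The other two terms are fixed: their value \<open>v i\<close> is
    fixed, and their functionals vanish at \<open>v i\<close> because
    c_k([\<open>v i\<close>, \<open>v i\<close>]) = c_k(\<open>v j\<close>) = 0.\<close>
  have "D - act D ?g = E k k i"
  proof (rule svec_eqI, rule coord_eqI)
    fix u w p
    show "c (br (D - act D ?g) u w) p = c (br (E k k i) u w) p"
      unfolding D_def using ki j
      by (simp add: br_svec br_act_tv dual_coord ji br_ten d br_bilinear coord_simps yi algebra_simps)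
  qed
  moreover have "D - act D ?g \<in> X"
    using D X tv_GL[OF dual_coord ji] by (intro gsubmodule_diff[OF X]) (simp_all add: gsubmodule_iff)
  ultimately show ?thesis by simp
qed

section \<open>Generating \<open>N\<close> from the units \<open>E k k i\<close>\<close>

context
  fixes X
  assumes X: "gsubmodule G \<Lambda> X" and diag: "\<And>k i. k \<noteq> i \<Longrightarrow> E k k i \<in> X"
begin

lemma X_closed: "x \<in> X \<Longrightarrow> y \<in> X \<Longrightarrow> x + y \<in> X" "x \<in> X \<Longrightarrow> t *s x \<in> X" "x \<in> X \<Longrightarrow> y \<in> X \<Longrightarrow> x - y \<in> X"
  "x \<in> X \<Longrightarrow> g \<in> G \<Longrightarrow> act x g \<in> X"
  using X gsubmodule_diff[OF X] by (simp_all add: gsubmodule_iff)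

text \<open>Again a coefficient of s^2, now of (u_k + s u_i)(w_k + s w_i)(v_i - s v_k), obtained by
  letting \<open>tv (s c_i) (v k)\<close> act on \<open>E k k i\<close>.\<close>

lemma offdiag_in_gsubmodule:
  assumes "i \<noteq> k"
  shows "E i i i - E k i k - E i k k \<in> X" (is "?Q \<in> X")
proof -
  obtain t :: 'a where t: "t \<noteq> 0" "t \<noteq> 1" using field_large by blast
  \<comment> \<open>Here the cubic term does not vanish; it is -s^3 \<open>E i i k\<close>, a
    multiple of a diagonal unit already in X, and is added back.\<close>
  define A where "A s = act (E k k i) (tv (\<lambda>u. s * c u i) (v k)) - E k k i + (s * s * s) *s E i i k" for s
  have d: "dual (\<lambda>u. s * c u i)" for s by (simp add: dual_iff coord_simps algebra_simps)
  have k0: "s * c (v k) i = 0" for s using assms by (simp add: coord_basis)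
  have A: "A s \<in> X" for s
    unfolding A_def using assms diag tv_GL[OF d k0] by (intro X_closed) auto
  have "A t - t *s A 1 = (t * t - t) *s ?Q"
  proof (rule svec_eqI, rule coord_eqI)
    fix u w p
    show "c (br (A t - t *s A 1) u w) p = c (br ((t * t - t) *s ?Q) u w) p"
      unfolding A_def br_svec br_act_tv[OF d k0] br_E using assms
      by (simp add: coord_simps algebra_simps)
  qed
  moreover have "A t - t *s A 1 \<in> X" using A by (intro X_closed)
  ultimately have "(t * t - t) *s ?Q \<in> X" by (simp only:)
  then show ?thesis by (rule gsubmodule_smult_cancel[OF X]) (use t in simp)
qed

text \<open>Polarisation: replacing u_k by u_k + u_l in u_k w_k produces the two squares and the
  mixed terms.\<close>

lemma mixed_in_gsubmodule:
  assumes "k \<noteq> l" "i \<noteq> k" "i \<noteq> l"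
  shows "E k l i + E l k i \<in> X"
proof -
  have k0: "c (v k) l = 0" using assms by (simp add: coord_basis)
  have "act (E k k i) (tv (\<lambda>u. c u l) (v k)) - E k k i - E l l i = E k l i + E l k i"
  proof (rule svec_eqI, rule coord_eqI)
    fix u w p
    show "c (br (act (E k k i) (tv (\<lambda>u. c u l) (v k)) - E k k i - E l l i) u w) p = c (br (E k l i + E l k i) u w) p"
      unfolding br_svec br_act_tv[OF dual_coord k0] br_E using assms
      by (simp add: coord_simps algebra_simps)
  qed
  moreover have "act (E k k i) (tv (\<lambda>u. c u l) (v k)) - E k k i - E l l i \<in> X"
    using assms tv_GL[OF dual_coord k0] by (intro X_closed diag) auto
  ultimately show ?thesis by simp
qed

text \<open>The generators found so far span the commutative products of trace zero; the proof
  writes x explicitly as a combination of them.\<close>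

lemma N_subset_gsubmodule: "N \<subseteq> X"
proof
  fix x assume "x \<in> N"
  then have xC: "x \<in> C" and xT: "x \<in> T" unfolding mod_N_def by blast+
  have comm: "x $ (p, q, r) = x $ (q, p, r)" for p q r
    using xC coord_br_basis by (metis (mono_tags, lifting) mem_Collect_eq mod_C_def)
  have trace: "(\<Sum>l\<in>UNIV. x $ (p, l, l)) = 0" for p
    using xT trL_basis[of x p] by (simp add: T_iff)
  obtain f :: "'n \<Rightarrow> nat" where f: "inj f" by (rule order_index)
  \<comment> \<open>Each unordered pair of distinct indices is counted once, which avoids a factor
    1/2.\<close>
  define y where "y p q r = (if f p < f q then x $ (p, q, r) else 0)" for p q r
  have y: "y p q r + y q p r = (if p = q then 0 else x $ (p, q, r))" for p q r
    using comm[of p q r] inj_eq[OF f, of p q] by (cases "f p" "f q" rule: linorder_cases) (auto simp: y_def)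
  \<comment> \<open>The symmetric unit, corrected by a diagonal unit to trace zero; for l = i or k =
    i it is the negative of an element of the form \<open>offdiag_in_gsubmodule\<close>.\<close>
  define F where "F k l i = E k l i + E l k i - (if l = i then E k k k else 0) - (if k = i then E l l l else 0)" for k l i
  have F: "y k l i *s F k l i \<in> X" for k l i
  proof (cases "k = l")
    case True
    then show ?thesis using X by (simp add: y_def gsubmodule_iff vec_eq_iff)
  next
    case False
    have "F k l i \<in> X"
    proof -
      consider "i \<noteq> k" "i \<noteq> l" | "i = l" | "i = k" by blast
      then show ?thesis
      proof cases
        case 1
        then show ?thesis using mixed_in_gsubmodule[OF False] by (simp add: F_def)
      next
        case 2
        have eq: "F k l i = (-1) *s (E k k k - E l k l - E k l l)"
          using 2 False by (simp add: F_def vec_eq_iff)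
        show ?thesis unfolding eq by (rule X_closed(2)[OF offdiag_in_gsubmodule[OF False]])
      next
        case 3
        have eq: "F k l i = (-1) *s (E l l l - E k l k - E l k k)"
          using 3 False by (simp add: F_def vec_eq_iff)
        show ?thesis unfolding eq by (rule X_closed(2)[OF offdiag_in_gsubmodule]) (use False in simp)
      qed
    qed
    then show ?thesis by (rule X_closed)
  qed
  define s where "s = (\<Sum>k\<in>UNIV. \<Sum>l\<in>UNIV. \<Sum>i\<in>UNIV. y k l i *s F k l i)
      + (\<Sum>k\<in>UNIV. \<Sum>i\<in>UNIV. if k = i then 0 else x $ (k, k, i) *s E k k i)"
  have "(if k = i then 0 else x $ (k, k, i) *s E k k i) \<in> X" for k i
    using diag[of k i] X by (auto simp: gsubmodule_iff)
  then have "s \<in> X"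
    unfolding s_def by (intro X_closed(1) gsubmodule_sum[OF X] F)
  moreover have "x = s"
  proof -
    have "x $ (p, q, r) = s $ (p, q, r)" for p q r
    proof -
      have 1: "(\<Sum>k\<in>UNIV. \<Sum>l\<in>UNIV. \<Sum>i\<in>UNIV. y k l i * E k l i $ (p, q, r)) = y p q r"
        by (simp add: E_nth if_distrib[of "\<lambda>t. _ * t"] sum_if_outer cong: if_cong)
      have 2: "(\<Sum>k\<in>UNIV. \<Sum>l\<in>UNIV. \<Sum>i\<in>UNIV. y k l i * E l k i $ (p, q, r)) = y q p r"
        by (simp add: E_nth if_distrib[of "\<lambda>t. _ * t"] sum_if_outer cong: if_cong)
      have 3: "(\<Sum>k\<in>UNIV. \<Sum>l\<in>UNIV. \<Sum>i\<in>UNIV. y k l i * (if l = i then E k k k else 0) $ (p, q, r))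
          = (if p = q then if p = r then \<Sum>l\<in>UNIV. y p l l else 0 else 0)"
        by (simp add: E_nth if_distrib[of "\<lambda>t. _ * t"] if_distrib[of "\<lambda>t. t $ _"] sum_if_outer cong: if_cong)
      have 4: "(\<Sum>k\<in>UNIV. \<Sum>l\<in>UNIV. \<Sum>i\<in>UNIV. y k l i * (if k = i then E l l l else 0) $ (p, q, r))
          = (if p = q then if p = r then \<Sum>l\<in>UNIV. y l p l else 0 else 0)"
        by (simp add: E_nth if_distrib[of "\<lambda>t. _ * t"] if_distrib[of "\<lambda>t. t $ _"] sum_if_outer cong: if_cong)
      have 5: "(\<Sum>k\<in>UNIV. \<Sum>i\<in>UNIV. (if k = i then 0 else x $ (k, k, i) *s E k k i) $ (p, q, r))
          = (if p = q then if p = r then 0 else x $ (p, q, r) else 0)"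
      proof -
        have "(if k = i then 0 else x $ (k, k, i) *s E k k i) $ (p, q, r) =
            (if k = p then if k = q then if i = r then if p = r then 0 else x $ (p, q, r) else 0 else 0 else 0)" for k i
          by (auto simp: E_nth)
        then show ?thesis by (simp only: sum_if_outer) (simp add: sum_if_outer)
      qed
      have seq: "s $ (p, q, r) = y p q r + y q p r - (if p = q then if p = r then \<Sum>l\<in>UNIV. y p l l else 0 else 0)
          - (if p = q then if p = r then \<Sum>l\<in>UNIV. y l p l else 0 else 0)
          + (if p = q then if p = r then 0 else x $ (p, q, r) else 0)"
        unfolding 1[symmetric] 2[symmetric] 3[symmetric] 4[symmetric] 5[symmetric]
        unfolding s_def F_def
        by (simp add: algebra_simps sum.distrib sum_subtractf)
      \<comment> \<open>The units \<open>E p p p\<close> are not generators, so the entry x_ppp must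
        come from the corrections in \<open>F\<close>; the trace condition makes it come out
        right.\<close>
      have AB: "(\<Sum>l\<in>UNIV. y p l l) + (\<Sum>l\<in>UNIV. y l p l) = - x $ (p, p, p)"
      proof -
        have "(\<Sum>l\<in>UNIV. y p l l) + (\<Sum>l\<in>UNIV. y l p l) = (\<Sum>l\<in>UNIV. if p = l then 0 else x $ (p, l, l))"
          by (simp add: sum.distrib[symmetric] y)
        also have "\<dots> = (\<Sum>l\<in>UNIV. x $ (p, l, l) - (if p = l then x $ (p, l, l) else 0))"
          by (rule sum.cong) auto
        also have "\<dots> = - x $ (p, p, p)" by (simp add: sum_subtractf trace)
        finally show ?thesis .
      qed
      consider "p \<noteq> q" | "p = q" "p \<noteq> r" | "p = q" "p = r" by blast
      then show ?thesis
      proof cases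
        case 3
        have "s $ (p, q, r) = - ((\<Sum>l\<in>UNIV. y p l l) + (\<Sum>l\<in>UNIV. y l p l))"
          using seq y[of p q r] 3 by simp
        then show ?thesis unfolding AB using 3 by simp
      qed (use seq y[of p q r] in simp_all)
    qed
    then show ?thesis by (simp add: vec_eq_iff)
  qed
  ultimately show "x \<in> X" by simp
qed

end

theorem N_subset_of_not_subset_Mss:
  assumes "gsubmodule G \<Lambda> X" "\<not> X \<subseteq> Mss"
  shows "N \<subseteq> X"
  using N_subset_gsubmodule[OF assms(1)] E_diag_in_gsubmodule[OF assms(1)] assms(2) by blast

section \<open>Submodules of \<open>K\<close> and generation of \<open>U\<close>\<close>

text \<open>The functionals act as certificates: \<eta> separates b from a, and \<xi> separates d
  from the span of a and b.\<close>

lemma independent_triple: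
  assumes a: "a \<noteq> 0" and \<eta>: "dual \<eta>" "\<eta> a = 0" "\<eta> b \<noteq> 0"
    and \<xi>: "dual \<xi>" "\<xi> a = 0" "\<xi> b = 0" "\<xi> d \<noteq> 0"
  shows "independent {d, b, a}" "a \<noteq> b" "a \<noteq> d" "b \<noteq> d"
proof -
  have "d \<notin> span {b, a}" using dual_span[OF \<xi>(1), of "{b, a}" d] \<xi>(2-4) by blast
  moreover have "b \<notin> span {a}" using dual_span[OF \<eta>(1), of "{a}" b] \<eta>(2,3) by blast
  moreover have "independent {a}" using a by simp
  ultimately show "independent {d, b, a}" by (simp add: independent_insertI)
qed (use \<eta> \<xi> in auto)

abbreviation alt :: "'n \<Rightarrow> 'n \<Rightarrow> 'n \<Rightarrow> ('a, 'n) svec" where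
  "alt k l i \<equiv> E k l i - E l k i"

text \<open>The independent vectors a, b, [a,b] are moved to \<open>v i\<close>, \<open>v m\<close>,
  \<open>v k\<close>. As [\<open>v i\<close>, \<open>v i\<close>] = 0, the quadratic part reduces to
  an alternating tensor in c_k and \<open>L\<close> with value \<open>v i\<close>, and a
  transvection along \<open>v m\<close> replaces \<open>L\<close> by the coordinate c_m.\<close>

lemma alt_in_gsubmodule:
  assumes X: "gsubmodule G \<Lambda> X" "X \<subseteq> K" and x: "x \<in> X"
    and ab: "a \<noteq> 0" "dual \<eta>" "\<eta> a = 0" "\<eta> b \<noteq> 0"
      "dual \<xi>" "\<xi> a = 0" "\<xi> b = 0" "\<xi> (br x a b) \<noteq> 0"
    and ne: "k \<noteq> m" "k \<noteq> i" "m \<noteq> i"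
  shows "alt k m i \<in> X"
proof -
  let ?d = "br x a b"
  note ind = independent_triple[OF ab]
  define f where "f p = (if p = i then a else if p = m then b else ?d)" for p
  have "inj_on f {i, m, k}" "independent (f ` {i, m, k})"
    using ind ne by (auto simp: f_def insert_commute inj_on_def)
  then obtain g where g: "g \<in> G" "\<And>p. p \<in> {i, m, k} \<Longrightarrow> g (v p) = f p" using GL_extend by blast
  define y where "y = act x g"
  have y: "y \<in> X" unfolding y_def using X x g(1) by (simp add: gsubmodule_iff)
  have gv: "g (v i) = a" "g (v m) = b" "g (v k) = ?d"
    using g(2)[of i] g(2)[of m] g(2)[of k] ne by (simp_all add: f_def)
  have yim: "br y (v i) (v m) = v k"
    unfolding y_def by (simp add: br_act[OF g(1)] gv(1,2)) (simp add: gv(3)[symmetric] g(1))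
  have yi: "br y (v i) (v i) = 0" using y X(2) by (auto simp: mod_K_def)
  define L where "L u = c (br y (v i) u) k" for u
  have L: "dual L" by (simp add: L_def dual_iff br_bilinear coord_simps)
  have Li: "L (v i) = 0" and Lm: "L (v m) = 1" by (simp_all add: L_def yi yim coord_simps)
  have anti: "br y u (v i) = - br y (v i) u" for u
    by (rule K_antisym) (use y X(2) in blast)
  \<comment> \<open>The first tensor is the zero remnant of
    [\<open>v i\<close>, \<open>v i\<close>], kept so that \<open>D\<close> matches the general
    quadratic part.\<close>
  define D where "D = ten (\<lambda>u. c u k) (\<lambda>u. c u k) 0 - ten (\<lambda>u. c u k) L (v i)
      - ten (\<lambda>u. - L u) (\<lambda>u. c u k) (v i)"
  have L': "(\<lambda>u. c (br y (v i) u) k) = L" "(\<lambda>u. c (br y u (v i)) k) = (\<lambda>u. - L u)"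
    unfolding L_def by (rule ext, simp only: anti coord_neg)+
  have ik: "c (v i) k = 0" using ne by (simp add: coord_basis)
  have "D \<in> X"
    using D2_in_gsubmodule[OF X(1) y dual_coord[of k] ik] unfolding yi coord_zero L' D_def by simp
  note D = this
  \<comment> \<open>Chosen so that \<open>L\<close> (u + \<psi>(u) \<open>v m\<close>) = c_m(u),
    since \<open>L\<close> (\<open>v m\<close>) = 1; the same equation gives
    \<psi>(\<open>v m\<close>) = 0, as a transvection requires.\<close>
  define \<psi> where "\<psi> u = c u m - L u" for u
  have \<psi>: "dual \<psi>" "\<psi> (v m) = 0" "\<psi> (v i) = 0"
    using L Li Lm ne by (simp_all add: \<psi>_def dual_iff coord_simps algebra_simps)
  have dL: "dual (\<lambda>u. - L u)" using L by (simp add: dual_iff)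
  have "act D (tv \<psi> (v m)) = (-1) *s alt k m i"
  proof (rule svec_eqI)
    fix u w
    have Lt: "L (u + sc (\<psi> u) (v m)) = c u m" for u
      using L by (simp add: dual_simps Lm \<psi>_def)
    have c': "c (u + sc (\<psi> u) (v m)) k = c u k" for u using ne by (simp add: coord_simps)
    have br_D: "br D u w = - sc (c u k * L w) (v i) + sc (L u * c w k) (v i)" for u w
      by (simp add: D_def br_svec br_ten dual_coord L dL)
    have "br (act D (tv \<psi> (v m))) u w = - sc (c u k * c w m) (v i) + sc (c u m * c w k) (v i)"
      unfolding br_act_tv[OF \<psi>(1,2)] br_D Lt c' using \<psi>(1,3) by (simp add: dual_simps)
    then show "br (act D (tv \<psi> (v m))) u w = br ((-1) *s alt k m i) u w"
      by (simp add: br_svec br_E)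
  qed
  moreover have "act D (tv \<psi> (v m)) \<in> X" using D X(1) tv_GL[OF \<psi>(1,2)] by (simp add: gsubmodule_iff)
  ultimately have "(-1) *s alt k m i \<in> X" by (simp only:)
  then show ?thesis by (rule gsubmodule_smult_cancel[OF X(1)]) simp
qed

text \<open>Under \<open>tv c_i (v m)\<close> the form c_k wedge c_m becomes c_k wedge (c_m + c_i)
  and the value \<open>v i\<close> becomes \<open>v i - v m\<close>; the two unwanted products have
  three distinct indices.\<close>

lemma alt_diff_in_gsubmodule:
  assumes X: "gsubmodule G \<Lambda> X" and alt: "\<And>k m i. \<lbrakk>k \<noteq> m; k \<noteq> i; m \<noteq> i\<rbrakk> \<Longrightarrow> alt k m i \<in> X"
    and ne: "k \<noteq> m" "k \<noteq> i"
  shows "alt k i i - alt k m m \<in> X"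
proof (cases "m = i")
  case True
  then show ?thesis using X by (simp add: gsubmodule_iff)
next
  case False
  have m0: "c (v m) i = 0" using False by (simp add: coord_basis)
  have "act (alt k m i) (tv (\<lambda>u. c u i) (v m)) - alt k m i + alt k i m = alt k i i - alt k m m"
  proof (rule svec_eqI, rule coord_eqI)
    fix u w p
    show "c (br (act (alt k m i) (tv (\<lambda>u. c u i) (v m)) - alt k m i + alt k i m) u w) p
        = c (br (alt k i i - alt k m m) u w) p"
      unfolding br_svec br_act_tv[OF dual_coord m0] br_E using ne False
      by (simp add: coord_simps algebra_simps)
  qed
  moreover have "act (alt k m i) (tv (\<lambda>u. c u i) (v m)) - alt k m i + alt k i m \<in> X"
  proof -
    have "act (alt k m i) (tv (\<lambda>u. c u i) (v m)) \<in> X" "alt k m i \<in> X" "alt k i m \<in> X"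
      using X tv_GL[OF dual_coord m0] alt ne False by (simp_all add: gsubmodule_iff)
    then show ?thesis using gsubmodule_diff[OF X] X unfolding gsubmodule_iff by blast
  qed
  ultimately show ?thesis by (simp only:)
qed

text \<open>\<open>U\<close> is spanned by the \<open>alt k m i\<close> with distinct indices and
  the differences \<open>alt k i i - alt k m m\<close>; x is expanded in these.\<close>

lemma U_subset_gsubmodule:
  assumes X: "gsubmodule G \<Lambda> X" and alt: "\<And>k m i. \<lbrakk>k \<noteq> m; k \<noteq> i; m \<noteq> i\<rbrakk> \<Longrightarrow> alt k m i \<in> X"
  shows "U \<subseteq> X"
proof
  fix x assume "x \<in> U"
  then have xK: "x \<in> K" and xT: "x \<in> T" unfolding mod_U_def by blast+
  have trace: "(\<Sum>l\<in>UNIV. x $ (p, l, l)) = 0" for p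
    using xT trL_basis[of x p] by (simp add: T_iff)
  obtain y where y: "x = y - opp y" using K_obtain[OF xK] .
  have "\<forall>k::'n. \<exists>l. l \<noteq> k" using another_index by metis
  \<comment> \<open>\<open>l0\<close> fixes one reference element \<open>h k\<close> among the
    \<open>alt k l l\<close>; the others differ from it by members of X.\<close>
  then obtain l0 :: "'n \<Rightarrow> 'n" where l0: "\<And>k. l0 k \<noteq> k" by metis
  define h where "h k = alt k (l0 k) (l0 k)" for k
  define F where "F k l i = alt k l i - (if l = i then h k else 0) + (if k = i then h l else 0)" for k l i
  note X' = X[unfolded gsubmodule_iff]
  have h: "alt k l l - h k \<in> X" if "k \<noteq> l" for k l
    unfolding h_def using alt_diff_in_gsubmodule[OF X alt, of k "l0 k" l] l0[of k] that by metis
  have F: "F k l i \<in> X" for k l i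
  proof (cases "k = l")
    case True
    then have "F k l i = 0" by (simp add: F_def)
    then show ?thesis using X' by simp
  next
    case False
    consider "i \<noteq> k" "i \<noteq> l" | "i = l" | "i = k" by blast
    then show ?thesis
    proof cases
      case 1
      then have "F k l i = alt k l i" by (simp add: F_def)
      then show ?thesis using alt[OF False] 1 by metis
    next
      case 2
      then have "F k l i = alt k l l - h k" using False by (simp add: F_def)
      then show ?thesis using h[OF False] by (simp only:)
    next
      case 3
      then have "F k l i = (-1) *s (alt l k k - h l)" using False by (simp add: F_def vec_eq_iff)
      moreover have "alt l k k - h l \<in> X" using h False by metis
      ultimately show ?thesis using X' by (simp only:)
    qed
  qed
  define s where "s = (\<Sum>k\<in>UNIV. \<Sum>l\<in>UNIV. \<Sum>i\<in>UNIV. y $ (k, l, i) *s F k l i)"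
  have "s \<in> X"
    unfolding s_def by (intro gsubmodule_sum[OF X]) (use F X' in blast)
  moreover have "x $ (p, q, r) = s $ (p, q, r)" for p q r
  proof -
    have 1: "(\<Sum>k\<in>UNIV. \<Sum>l\<in>UNIV. \<Sum>i\<in>UNIV. y $ (k, l, i) * E k l i $ (p, q, r)) = y $ (p, q, r)"
      by (simp add: E_nth if_distrib[of "\<lambda>t. _ * t"] sum_if_outer cong: if_cong)
    have 2: "(\<Sum>k\<in>UNIV. \<Sum>l\<in>UNIV. \<Sum>i\<in>UNIV. y $ (k, l, i) * E l k i $ (p, q, r)) = y $ (q, p, r)"
      by (simp add: E_nth if_distrib[of "\<lambda>t. _ * t"] sum_if_outer cong: if_cong)
    have 3: "(\<Sum>k\<in>UNIV. \<Sum>l\<in>UNIV. \<Sum>i\<in>UNIV. y $ (k, l, i) * (if l = i then h k else 0) $ (p, q, r))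
        = (\<Sum>k\<in>UNIV. \<Sum>l\<in>UNIV. y $ (k, l, l) * h k $ (p, q, r))"
      by (simp add: if_distrib[of "\<lambda>t. _ * t"] if_distrib[of "\<lambda>t. t $ _"] cong: if_cong)
    have 4: "(\<Sum>k\<in>UNIV. \<Sum>l\<in>UNIV. \<Sum>i\<in>UNIV. y $ (k, l, i) * (if k = i then h l else 0) $ (p, q, r))
        = (\<Sum>k\<in>UNIV. \<Sum>l\<in>UNIV. y $ (l, k, l) * h k $ (p, q, r))"
      by (subst (2) sum.swap) (simp add: if_distrib[of "\<lambda>t. _ * t"] if_distrib[of "\<lambda>t. t $ _"] cong: if_cong)
    \<comment> \<open>The reference elements enter with coefficient equal to the trace of
      [\<open>v k\<close>, .], which vanishes.\<close>
    have "(\<Sum>k\<in>UNIV. \<Sum>l\<in>UNIV. y $ (k, l, l) * h k $ (p, q, r))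
        - (\<Sum>k\<in>UNIV. \<Sum>l\<in>UNIV. y $ (l, k, l) * h k $ (p, q, r))
        = (\<Sum>k\<in>UNIV. \<Sum>l\<in>UNIV. (y $ (k, l, l) - y $ (l, k, l)) * h k $ (p, q, r))"
      by (simp only: sum_subtractf left_diff_distrib)
    also have "\<dots> = (\<Sum>k\<in>UNIV. (\<Sum>l\<in>UNIV. x $ (k, l, l)) * h k $ (p, q, r))"
      by (simp add: y sum_distrib_right)
    also have "\<dots> = 0" by (simp only: trace) simp
    finally have 5: "(\<Sum>k\<in>UNIV. \<Sum>l\<in>UNIV. y $ (k, l, l) * h k $ (p, q, r))
        = (\<Sum>k\<in>UNIV. \<Sum>l\<in>UNIV. y $ (l, k, l) * h k $ (p, q, r))" by simp
    have "s $ (p, q, r) = y $ (p, q, r) - y $ (q, p, r)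
        - (\<Sum>k\<in>UNIV. \<Sum>l\<in>UNIV. y $ (k, l, l) * h k $ (p, q, r))
        + (\<Sum>k\<in>UNIV. \<Sum>l\<in>UNIV. y $ (l, k, l) * h k $ (p, q, r))"
      unfolding 1[symmetric] 2[symmetric] 3[symmetric] 4[symmetric]
      unfolding s_def F_def
      by (simp add: algebra_simps sum.distrib sum_subtractf)
    then show ?thesis by (simp add: 5 y)
  qed
  then have "x = s" by (simp add: vec_eq_iff)
  ultimately show "x \<in> X" by simp
qed

text \<open>If [a,b] always lay in the span of a and b, an alternating product would have the form
  [a,b] = \<phi>(a) b - \<phi>(b) a, which in characteristic 2 is \<open>Y \<phi>\<close>. So an
  element outside \<open>W\<close> yields a, b, [a,b] independent.\<close>

theorem U_subset_of_not_subset_W: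
  assumes two: "(1::'a) + 1 = 0" and X: "gsubmodule G \<Lambda> X" "X \<subseteq> K" and XW: "\<not> X \<subseteq> W"
  shows "U \<subseteq> X"
proof -
  obtain x where x: "x \<in> X" "x \<notin> W" using XW by blast
  have xK: "x \<in> K" using x(1) X(2) by blast
  have "\<exists>a b \<eta> \<xi>. a \<noteq> 0 \<and> dual \<eta> \<and> \<eta> a = 0 \<and> \<eta> b \<noteq> 0 \<and> dual \<xi> \<and> \<xi> a = 0 \<and> \<xi> b = 0 \<and> \<xi> (br x a b) \<noteq> 0"
  proof (rule ccontr)
    assume no: "\<not> ?thesis"
    have off: "x $ (i, j, k) = 0" if "i \<noteq> j" "k \<noteq> i" "k \<noteq> j" for i j k
    proof (rule ccontr)
      assume "x $ (i, j, k) \<noteq> 0"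
      then have "v i \<noteq> 0 \<and> dual (\<lambda>u. c u j) \<and> c (v i) j = 0 \<and> c (v j) j \<noteq> 0 \<and>
          dual (\<lambda>u. c u k) \<and> c (v i) k = 0 \<and> c (v j) k = 0 \<and> c (br x (v i) (v j)) k \<noteq> 0"
        using that by (simp add: basis_nonzero dual_coord coord_basis coord_br_basis)
      then show False using no by blast
    qed
    have eq: "x $ (i, j, j) = x $ (i, k, k)" if "i \<noteq> j" "k \<noteq> i" for i j k
    proof (cases "k = j")
      case False
      show ?thesis
      proof (rule ccontr)
        \<comment> \<open>The forbidden pair is \<open>v i\<close> and \<open>v j + v k\<close>,
          with \<xi> = c_j - c_k: it kills both vectors and takes the value x_ijj - x_ikk on their
          product.\<close>
        assume "x $ (i, j, j) \<noteq> x $ (i, k, k)"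
        moreover have "x $ (i, k, j) = 0" "x $ (i, j, k) = 0" using off that False by auto
        moreover have "dual (\<lambda>u. c u j - c u k)" by (simp add: dual_iff coord_simps algebra_simps)
        ultimately have "v i \<noteq> 0 \<and> dual (\<lambda>u. c u j) \<and> c (v i) j = 0 \<and> c (v j + v k) j \<noteq> 0 \<and>
            dual (\<lambda>u. c u j - c u k) \<and> c (v i) j - c (v i) k = 0 \<and> c (v j + v k) j - c (v j + v k) k = 0 \<and>
            c (br x (v i) (v j + v k)) j - c (br x (v i) (v j + v k)) k \<noteq> 0"
          using that False
          by (simp add: basis_nonzero dual_coord coord_basis coord_br_basis br_bilinear coord_add)
        then show False using no by blast
      qed
    qed simp
    have "\<forall>k::'n. \<exists>l. l \<noteq> k" using another_index by metis
    then obtain l0 :: "'n \<Rightarrow> 'n" where l0: "\<And>k. l0 k \<noteq> k" by metis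
    \<comment> \<open>By \<open>eq\<close> the entry x_ijj does not depend on j other than i, so any
      choice \<open>l0 i\<close> defines the same functional.\<close>
    define \<phi> where "\<phi> u = (\<Sum>i\<in>UNIV. c u i * x $ (i, l0 i, l0 i))" for u
    have d: "dual \<phi>" unfolding \<phi>_def by (rule dual_combination)
    have \<phi>: "\<phi> (v i) = x $ (i, j, j)" if "i \<noteq> j" for i j
    proof -
      have "\<phi> (v i) = x $ (i, l0 i, l0 i)"
        by (simp add: \<phi>_def coord_basis if_distrib[of "\<lambda>t. t * _"] cong: if_cong)
      then show ?thesis using eq[OF that l0] by simp
    qed
    have twice: "t + t = 0" for t :: 'a using two by (metis distrib_left mult.right_neutral mult_zero_right)
    have "x $ (i, j, k) = Y \<phi> $ (i, j, k)" for i j k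
    proof -
      have Yn: "Y \<phi> $ (i, j, k) = (if i = k then \<phi> (v j) else 0) + (if j = k then \<phi> (v i) else 0)"
        unfolding coord_br_basis[symmetric] by (simp add: br_Y d coord_simps)
      have anti: "x $ (i, j, k) = x $ (j, i, k)"
        using K_nth(2)[OF xK, of i j k] twice[of "x $ (j, i, k)"] by (metis add_right_cancel)
      show ?thesis
      proof (cases "i = j")
        case True
        have "Y \<phi> $ (i, j, k) = (if j = k then \<phi> (v j) else 0) + (if j = k then \<phi> (v j) else 0)"
          using Yn unfolding True .
        also have "\<dots> = 0" by (rule twice)
        finally have "Y \<phi> $ (i, j, k) = 0" .
        then show ?thesis using K_nth(1)[OF xK, of i k] True by simp
      next
        case False
        then show ?thesis
          using off[OF False, of k] \<phi>[of i j] \<phi>[of j i] anti by (auto simp: Yn)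
      qed
    qed
    then have "x = Y \<phi>" by (simp add: vec_eq_iff)
    then show False using x(2) d W_iff by blast
  qed
  then obtain a b \<eta> \<xi> where ab: "a \<noteq> 0" "dual \<eta>" "\<eta> a = 0" "\<eta> b \<noteq> 0"
      "dual \<xi>" "\<xi> a = 0" "\<xi> b = 0" "\<xi> (br x a b) \<noteq> 0" by blast
  show ?thesis
    by (rule U_subset_gsubmodule[OF X(1)]) (rule alt_in_gsubmodule[OF X x(1) ab])
qed

section \<open>Irreducibility of the dual space and trace maps onto it\<close>

lemma V_hat_simps: "gcarrier V_hat = {\<phi>. dual \<phi>}" "gzero V_hat = (\<lambda>u. 0)"
  "gadd V_hat = (\<lambda>\<phi> \<psi> u. \<phi> u + \<psi> u)" "gsmult V_hat = (\<lambda>t \<phi> u. t * \<phi> u)"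
  "gact V_hat = (\<lambda>\<phi> g u. \<phi> (g u))"
  by (simp_all add: dual_module_def)

lemma gsubmodule_V_hat_eq_carrier:
  assumes S: "gsubmodule G V_hat S" and \<phi>: "\<phi> \<in> S" "\<phi> \<noteq> (\<lambda>u. 0)"
  shows "S = {\<phi>. dual \<phi>}"
proof -
  have sub: "S \<subseteq> {\<phi>. dual \<phi>}" and zero: "(\<lambda>u. 0) \<in> S"
    and add: "\<And>f h. f \<in> S \<Longrightarrow> h \<in> S \<Longrightarrow> (\<lambda>u. f u + h u) \<in> S"
    and smult: "\<And>t f. f \<in> S \<Longrightarrow> (\<lambda>u. t * f u) \<in> S"
    and actS: "\<And>g f. g \<in> G \<Longrightarrow> f \<in> S \<Longrightarrow> (\<lambda>u. f (g u)) \<in> S"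
    using S unfolding gsubmodule_def V_hat_simps by auto
  have d: "dual \<phi>" using sub \<phi>(1) by blast
  have "\<exists>i. \<phi> (v i) \<noteq> 0"
  proof (rule ccontr)
    assume "\<not> ?thesis"
    then have "\<phi> = (\<lambda>u. 0)" by (intro dual_eqI[OF d]) (simp_all add: dual_iff)
    then show False using \<phi>(2) by blast
  qed
  then obtain i where i: "\<phi> (v i) \<noteq> 0" by blast
  have coord_S: "(\<lambda>u. c u j) \<in> S" for j
  proof (cases "\<exists>p. p \<noteq> j \<and> \<phi> (v p) \<noteq> 0")
    case True
    then obtain p where p: "p \<noteq> j" "\<phi> (v p) \<noteq> 0" by blast
    have p0: "c (v p) j = 0" using p(1) by (simp add: coord_basis)
    \<comment> \<open>This difference is \<phi>(\<open>v p\<close>) times the j-th coordinate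
      functional.\<close>
    have "(\<lambda>u. \<phi> (tv (\<lambda>u. c u j) (v p) u) + (-1) * \<phi> u) \<in> S"
      using add[OF actS[OF tv_GL[OF dual_coord p0] \<phi>(1)] smult[OF \<phi>(1), of "-1"]] .
    from smult[OF this, of "1 / \<phi> (v p)"] p(2) d
    show ?thesis by (simp add: tv_def dual_simps)
  next
    case False
    then have "\<phi> = (\<lambda>u. \<phi> (v j) * c u j)"
      using d by (intro dual_eqI) (auto simp: dual_iff coord_simps algebra_simps)
    then have e: "\<phi> u = \<phi> (v j) * c u j" for u by (rule fun_cong)
    have nz: "\<phi> (v j) \<noteq> 0" using False i by metis
    have "(1 / \<phi> (v j)) * \<phi> u = c u j" for u by (subst e) (use nz in simp)
    then show ?thesis using smult[OF \<phi>(1), of "1 / \<phi> (v j)"] by simp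
  qed
  have "(\<lambda>u. \<Sum>j\<in>A. c u j * b j) \<in> S" for A and b :: "'n \<Rightarrow> 'a"
  proof (induction A rule: infinite_finite_induct)
    case (insert j A)
    have "(\<lambda>u. b j * c u j + (\<Sum>j\<in>A. c u j * b j)) \<in> S"
      using add[OF smult[OF coord_S] insert.IH] .
    then show ?case using insert.hyps by (simp add: mult.commute)
  qed (simp_all add: zero)
  moreover have "\<psi> = (\<lambda>u. \<Sum>j\<in>UNIV. c u j * \<psi> (v j))" if "dual \<psi>" for \<psi>
    using dual_expansion[OF that] by blast
  ultimately have "\<psi> \<in> S" if "dual \<psi>" for \<psi> using that by metis
  then show ?thesis using sub by blast
qed

lemma V_hat_nonzero: "(\<lambda>u. c u i) \<noteq> (\<lambda>u. 0)"
  using coord_basis[of i i] by (metis zero_neq_one)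

lemma girreducible_V_hat: "girreducible G V_hat"
  unfolding girreducible_def
proof (intro conjI allI impI)
  show "gcarrier V_hat \<noteq> {gzero V_hat}"
    using V_hat_nonzero dual_coord unfolding V_hat_simps by blast
  fix S assume S: "gsubmodule G V_hat S"
  then have "gzero V_hat \<in> S" unfolding gsubmodule_def by blast
  then show "S = {gzero V_hat} \<or> S = gcarrier V_hat"
    using gsubmodule_V_hat_eq_carrier[OF S] unfolding V_hat_simps by blast
qed

text \<open>A nonzero homomorphism into an irreducible module is onto, so a single pair (x, u) with
  nonzero value suffices.\<close>

lemma gepi_V_hat:
  assumes B: "gsubmodule G \<Lambda> B" and dual: "\<And>x. x \<in> B \<Longrightarrow> dual (f x)"
    and hom: "\<And>x y u. f (x + y) u = f x u + f y u" "\<And>t x u. f (t *s x) u = t * f x u"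
      "\<And>x g u. g \<in> G \<Longrightarrow> f (act x g) u = f x (g u)"
    and x: "x \<in> B" "f x u \<noteq> 0"
  shows "gepi G (grestrict \<Lambda> B) V_hat f {x \<in> B. \<forall>u. f x u = 0}"
proof -
  note B' = B[unfolded gsubmodule_iff]
  have f: "f (x + y) = (\<lambda>u. f x u + f y u)" "f (t *s x) = (\<lambda>u. t * f x u)"
    "g \<in> G \<Longrightarrow> f (act x g) = (\<lambda>u. f x (g u))" for x y t g
    using hom by blast+
  have f0: "f 0 = (\<lambda>u. 0)" using f(2)[of 0 0] by simp
  have "gsubmodule G V_hat (f ` B)"
    unfolding gsubmodule_def V_hat_simps
    using B' dual by (auto simp: f[symmetric] f0[symmetric])
  moreover have "f x \<noteq> (\<lambda>u. 0)" using x(2) by auto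
  ultimately have "f ` B = {\<phi>. dual \<phi>}" using gsubmodule_V_hat_eq_carrier x(1) by blast
  then show ?thesis unfolding gepi_iff V_hat_simps by (simp add: f f0) (simp add: fun_eq_iff)
qed

lemma E_trace:
  assumes "i \<noteq> j"
  shows "trL (E i j j) (v i) = 1" "trR (E i j j) (v i) = 0" "trL (E j i j) (v i) = 0"
  using assms by (simp_all add: trL_basis trR_basis E_nth)

lemma alt_in_K: "alt k l i \<in> K"
  by (simp add: mod_K_def br_svec br_E mult.commute)

lemma alt_in_U: "k \<noteq> l \<Longrightarrow> k \<noteq> i \<Longrightarrow> l \<noteq> i \<Longrightarrow> alt k l i \<in> U"
proof -
  assume ne: "k \<noteq> l" "k \<noteq> i" "l \<noteq> i"
  have "trL (alt k l i) u = 0" for u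
    using ne by (simp add: trL_eq br_svec br_E coord_simps if_distrib[of "\<lambda>t. _ * t"] sum_subtractf sum_if_outer cong: if_cong)
  then show ?thesis using alt_in_K by (simp add: mod_U_def T_iff)
qed

lemma U_eq: "U = {x \<in> K. \<forall>u. trL x u = 0}"
  by (auto simp: mod_U_def T_iff)

lemma gepi_trL: "gepi G (grestrict \<Lambda> K) V_hat trL U"
proof -
  obtain i j k :: 'n where ij: "i \<noteq> j" and "i \<noteq> k" "j \<noteq> k" by (rule basis_indices)
  then show ?thesis
    unfolding U_eq
    by (intro gepi_V_hat[where f = trL and x = "alt i j j" and u = "v i"])
      (simp_all add: gsubmodule_K dual_trL trL_svec trL_act alt_in_K E_trace)
qed

lemma gsubmodule_UNIV: "gsubmodule G \<Lambda> UNIV"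
  using \<Lambda>.gsubmodule_carrier by (simp add: gcarrier_\<Lambda>)

text \<open>The map is x -> \<open>trL (symm x)\<close>. Its kernel turns out to be
  \<open>N + Mss\<close> when the characteristic is not 2 and n + 1 = 0 in the field.\<close>

lemma gepi_trLR: "gepi G \<Lambda> V_hat (\<lambda>x u. trL x u + trR x u) {x. \<forall>u. trL x u + trR x u = 0}"
proof -
  obtain i j k :: 'n where ij: "i \<noteq> j" and "i \<noteq> k" "j \<noteq> k" by (rule basis_indices)
  have "dual (\<lambda>u. trL x u + trR x u)" for x
    using dual_trL[of x] dual_trR[of x] by (simp add: dual_iff algebra_simps)
  then have "gepi G (grestrict \<Lambda> UNIV) V_hat (\<lambda>x u. trL x u + trR x u)
      {x \<in> UNIV. \<forall>u. trL x u + trR x u = 0}"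
    by (intro gepi_V_hat[where f = "\<lambda>x u. trL x u + trR x u" and x = "E i j j" and u = "v i"])
      (simp_all add: gsubmodule_UNIV trL_svec trR_svec trL_act trR_act E_trace[OF ij] algebra_simps)
  then show ?thesis by (simp add: grestrict_UNIV)
qed

lemma gsubmodule_0: "gsubmodule G \<Lambda> {0}"
  using \<Lambda>.gsubmodule_zero by (simp add: gzero_\<Lambda>)

lemma gepi_id: "gsubmodule G \<Lambda> B \<Longrightarrow> gepi G (grestrict \<Lambda> B) (grestrict \<Lambda> B) id {0}"
  using gmodule.gepi_id[OF \<Lambda>.gmodule_grestrict[of B]] by (simp add: grestrict_def svec_module_def)

section \<open>Covers in the submodule lattice\<close>

lemma gcover_K_Mss: "gcover G \<Lambda> K Mss"
  using \<Lambda>.girreducible_grestrict_gepi_iff[OF gsubmodule_Mss gepi_th] girreducible_V_hat by blast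

lemma gcover_U_K: "gcover G \<Lambda> U K"
  using \<Lambda>.girreducible_grestrict_gepi_iff[OF gsubmodule_K gepi_trL] girreducible_V_hat by blast

lemma girreducible_W: "girreducible G (grestrict \<Lambda> W)"
proof -
  have "gcover G V_hat {\<lambda>u. 0} (gcarrier V_hat)"
    using V_hat.girreducible_gepi_iff[OF V_hat.gepi_id] girreducible_V_hat by (simp add: V_hat_simps)
  then show ?thesis using V_hat.girreducible_gepi_iff[OF gepi_Y] by blast
qed

lemma gcover_0_W: "gcover G \<Lambda> {0} W"
  using \<Lambda>.girreducible_grestrict_gepi_iff[OF gsubmodule_W gepi_id[OF gsubmodule_W]] girreducible_W by blast

lemma giso_W_V_hat: "giso G (gsection \<Lambda> {0} W) V_hat"
proof -
  have "giso G (grestrict \<Lambda> W) V_hat"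
    using V_hat.giso_of_gepi[OF gepi_Y] V_hat.gepi_id by (simp add: V_hat_simps)
  then show ?thesis using \<Lambda>.giso_gsection[OF gsubmodule_W gepi_id[OF gsubmodule_W]] giso_trans by blast
qed

lemma giso_K_V_hat: "giso G (gsection \<Lambda> U K) V_hat"
  by (rule \<Lambda>.giso_gsection[OF gsubmodule_K gepi_trL])

lemma giso_Mss_V_hat: "giso G (gsection \<Lambda> K Mss) V_hat"
  by (rule \<Lambda>.giso_gsection[OF gsubmodule_Mss gepi_th])

text \<open>Packages the dichotomy that a submodule lies in \<open>Mss\<close> or contains
  \<open>N\<close>: the first alternative must force S below A, the second must force S up to
  B.\<close>

lemma gcover_of_not_subset_Mss:
  assumes A: "gsubmodule G \<Lambda> A" and B: "gsubmodule G \<Lambda> B" and "A \<subset> B"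
    and sub: "\<And>S. S \<subseteq> Mss \<Longrightarrow> S \<subseteq> B \<Longrightarrow> S \<subseteq> A" and sup: "\<And>S. A \<subseteq> S \<Longrightarrow> N \<subseteq> S \<Longrightarrow> gsubmodule G \<Lambda> S \<Longrightarrow> B \<subseteq> S"
  shows "gcover G \<Lambda> A B"
  unfolding gcover_def
proof (intro conjI allI impI assms)
  fix S assume S: "gsubmodule G \<Lambda> S \<and> A \<subseteq> S \<and> S \<subseteq> B"
  show "S = A \<or> S = B"
  proof (cases "S \<subseteq> Mss")
    case True
    then show ?thesis using sub[OF True] S by blast
  next
    case False
    then have "B \<subseteq> S" using sup N_subset_of_not_subset_Mss[of S] S by blast
    then show ?thesis using S by blast
  qed
qed

lemma E_diag_in_N: "k \<noteq> i \<Longrightarrow> E k k i \<in> N"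
proof -
  assume ki: "k \<noteq> i"
  have "E k k i \<in> C" by (simp add: mod_C_def br_E mult.commute)
  moreover have "trL (E k k i) u = 0" for u
    using ki by (simp add: trL_eq br_E coord_simps if_distrib[of "\<lambda>t. _ * t"] cong: if_cong)
  ultimately show ?thesis by (simp add: mod_N_def T_iff)
qed

lemma E_diag_notin_Mss: "k \<noteq> i \<Longrightarrow> E k k i \<notin> Mss"
proof
  assume ki: "k \<noteq> i" and "E k k i \<in> Mss"
  then obtain t where "br (E k k i) (v k) (v k) = sc t (v k)" unfolding mod_Mss_def by blast
  then have "c (br (E k k i) (v k) (v k)) i = c (sc t (v k)) i" by simp
  then show False using ki by (simp add: br_E coord_simps)
qed

lemma N_not_subset_Mss: "\<not> N \<subseteq> Mss"
proof -
  obtain k i j :: 'n where ki: "k \<noteq> i" and "k \<noteq> j" "i \<noteq> j" by (rule basis_indices)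
  show ?thesis using E_diag_in_N[OF ki] E_diag_notin_Mss[OF ki] by blast
qed

lemma gcover_N: "gcover G \<Lambda> (N \<inter> Mss) N"
  by (rule gcover_of_not_subset_Mss)
    (use N_not_subset_Mss gsubmodule_Int gsubmodule_N gsubmodule_Mss in auto)

lemma subset_plus: "gsubmodule G \<Lambda> A \<Longrightarrow> gsubmodule G \<Lambda> B \<Longrightarrow> A \<subseteq> A + B"
  "gsubmodule G \<Lambda> A \<Longrightarrow> gsubmodule G \<Lambda> B \<Longrightarrow> B \<subseteq> A + B"
  unfolding gsubmodule_iff by (metis add.right_neutral set_plus_intro subsetI)
    (metis add.left_neutral set_plus_intro subsetI)

lemma plus_subset: "gsubmodule G \<Lambda> S \<Longrightarrow> A \<subseteq> S \<Longrightarrow> B \<subseteq> S \<Longrightarrow> A + B \<subseteq> S"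
  unfolding gsubmodule_iff by (auto elim!: set_plus_elim)

lemmas N_Mss = gsubmodule_plus[OF gsubmodule_N gsubmodule_Mss] subset_plus[OF gsubmodule_N gsubmodule_Mss]

lemma gcover_N_plus_Mss: "gcover G \<Lambda> Mss (N + Mss)"
proof (rule gcover_of_not_subset_Mss)
  show "Mss \<subset> N + Mss" using N_Mss N_not_subset_Mss by blast
  show "N + Mss \<subseteq> S" if "Mss \<subseteq> S" "N \<subseteq> S" "gsubmodule G \<Lambda> S" for S
    using plus_subset that by blast
qed (use gsubmodule_Mss N_Mss in auto)

lemma giso_second:
  assumes A: "gsubmodule G \<Lambda> A" and B: "gsubmodule G \<Lambda> B"
  shows "giso G (gsection \<Lambda> B (A + B)) (gsection \<Lambda> (A \<inter> B) A)"
proof -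
  interpret A: gmodule G "grestrict \<Lambda> A" by (rule \<Lambda>.gmodule_grestrict[OF A])
  have "gepi G (grestrict \<Lambda> A) (gsection \<Lambda> B (A + B)) (gcoset (grestrict \<Lambda> (A + B)) B) (A \<inter> B)"
    by (rule \<Lambda>.gepi_gsection_sum[OF A B gsubmodule_plus[OF A B] subset_plus[OF A B]])
      (auto simp: svec_module_def elim!: set_plus_elim)
  from A.giso_of_gepi[OF this \<Lambda>.gepi_gsection[OF gsubmodule_Int[OF A B] A]] show ?thesis by blast
qed

section \<open>\<open>N\<close> against \<open>Mss\<close> in characteristic other than 2\<close>

text \<open>Polarisation of [u,u] = \<theta>(u) u, valid in every characteristic.\<close>

lemma Mss_symm: "x \<in> Mss \<Longrightarrow> symm x = Y (th x)"
proof (rule svec_eqI)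
  fix u w assume x: "x \<in> Mss"
  have "br x (u + w) (u + w) - br x u u - br x w w = sc (th x (u + w)) (u + w) - sc (th x u) u - sc (th x w) w"
    by (simp only: Mss_square[OF x])
  then show "br (symm x) u w = br (Y (th x)) u w"
    by (simp add: br_symm br_Y[OF dual_th] dual_add[OF dual_th] br_bilinear algebra_simps)
qed

lemma trL_symm: "trL (symm x) u = trL x u + trR x u"
  by (simp add: trL_eq trR_eq br_symm coord_add sum.distrib)

lemma C_symm: "x \<in> C \<Longrightarrow> symm x = 2 *s x"
  by (rule svec_eqI) (simp add: br_symm br_smult mod_C_def scale_left_distrib[of 1 1, simplified])

lemma symm_in_C: "symm x \<in> C"
  by (simp add: mod_C_def br_symm add.commute)

lemma Y_in_C: "dual \<theta> \<Longrightarrow> Y \<theta> \<in> C"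
  by (simp add: mod_C_def br_Y add.commute)

lemma Y_in_Mss: "dual \<theta> \<Longrightarrow> Y \<theta> \<in> Mss"
proof -
  assume "dual \<theta>"
  then have "br (Y \<theta>) u u = sc (\<theta> u + \<theta> u) u" for u by (simp only: br_Y scale_left_distrib)
  then show ?thesis unfolding mod_Mss_def by blast
qed

text \<open>On commutative x the symmetrisation is 2x, on \<open>Mss\<close> it is
  \<open>Y (th x)\<close>; comparing left traces, zero on \<open>N\<close>, gives the second
  equation.\<close>

lemma N_Int_Mss_trace:
  assumes "x \<in> N" "x \<in> Mss"
  shows "2 *s x = Y (th x)" "(of_nat CARD('n) + 1) * th x u = 0"
proof -
  have "x \<in> C" "\<forall>u. trL x u = 0" using assms(1) by (simp_all add: mod_N_def T_iff)
  then show e: "2 *s x = Y (th x)" using C_symm Mss_symm[OF assms(2)] by simp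
  have "trL (2 *s x) u = 0" using \<open>\<forall>u. trL x u = 0\<close> by (simp add: trL_svec)
  then show "(of_nat CARD('n) + 1) * th x u = 0" unfolding e by (simp add: trL_Y dual_th)
qed

lemma diff_half_symm_in_K:
  assumes "(2::'a) \<noteq> 0"
  shows "x - (1 / 2) *s symm x \<in> K"
proof -
  have "sc (1 / 2) (u + u) = u" for u
  proof -
    have "sc (1 / 2) (u + u) = sc (1 / 2 + 1 / 2) u" by (simp only: scale_right_distrib scale_left_distrib)
    also have "(1 / 2 + 1 / 2 :: 'a) = 1" using assms by (simp add: field_simps)
    finally show ?thesis by simp
  qed
  then show ?thesis by (simp add: mod_K_def br_svec br_symm)
qed

lemma half_symm_in_C: "(1 / 2) *s symm x \<in> C"
  using gsubmodule_C symm_in_C unfolding gsubmodule_iff by blast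

lemma N_Int_Mss_of_unit:
  assumes two: "(2::'a) \<noteq> 0" and n1: "of_nat CARD('n) + (1::'a) \<noteq> 0"
  shows "N \<inter> Mss = {0}"
proof -
  have "x = 0" if "x \<in> N" "x \<in> Mss" for x
  proof -
    have "th x = (\<lambda>u. 0)" using N_Int_Mss_trace(2)[OF that] n1 by auto
    then have "2 *s x = 0" using N_Int_Mss_trace(1)[OF that] Y_0 by simp
    then show ?thesis using two by (simp add: vec_eq_iff)
  qed
  then show ?thesis using gsubmodule_N gsubmodule_Mss unfolding gsubmodule_iff by blast
qed

text \<open>Half the symmetrisation of x differs from x by an alternating product, which is in
  \<open>Mss\<close>; it remains to move its trace into \<open>Mss\<close> as well.\<close>

lemma N_plus_Mss_of_unit:
  assumes two: "(2::'a) \<noteq> 0" and n1: "of_nat CARD('n) + (1::'a) \<noteq> 0"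
  shows "N + Mss = UNIV"
proof -
  have "x \<in> N + Mss" for x
  proof -
    let ?s = "(1 / 2) *s symm x"
    \<comment> \<open>Solves \<open>trL (Y \<psi>) = trL ?s\<close>; dividing by n + 1 is the point
      where its invertibility is used.\<close>
    define \<psi> where "\<psi> u = 1 / (of_nat CARD('n) + 1) * trL ?s u" for u
    have \<psi>: "dual \<psi>" using dual_trL[of ?s] unfolding dual_iff \<psi>_def by (simp add: algebra_simps)
    have "trL (?s - Y \<psi>) u = 0" for u
      unfolding trL_svec(4) trL_Y[OF \<psi>] using n1 by (simp add: \<psi>_def)
    then have "?s - Y \<psi> \<in> N"
      unfolding mod_N_def T_iff using gsubmodule_diff[OF gsubmodule_C half_symm_in_C Y_in_C[OF \<psi>]] T_iff by blast
    moreover have "(x - ?s) + Y \<psi> \<in> Mss"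
      using diff_half_symm_in_K[OF two, of x] K_subset_Mss Y_in_Mss[OF \<psi>] gsubmodule_Mss
      unfolding gsubmodule_iff by blast
    ultimately have "(?s - Y \<psi>) + ((x - ?s) + Y \<psi>) \<in> N + Mss" by (rule set_plus_intro)
    then show ?thesis by simp
  qed
  then show ?thesis by blast
qed

lemma N_Int_Mss_of_not_unit:
  assumes two: "(2::'a) \<noteq> 0" and n1: "of_nat CARD('n) + (1::'a) = 0"
  shows "N \<inter> Mss = W"
proof
  show "N \<inter> Mss \<subseteq> W"
  proof
    fix x assume "x \<in> N \<inter> Mss"
    then have e: "2 *s x = Y (th x)" using N_Int_Mss_trace(1) by blast
    have "x = (1 / 2) *s (2 *s x)" using two by (simp add: vec_eq_iff)
    also have "\<dots> = Y (\<lambda>u. 1 / 2 * th x u)" unfolding e by (rule Y_smult[OF dual_th, symmetric])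
    finally have "x = Y (\<lambda>u. 1 / 2 * th x u)" .
    moreover have "dual (\<lambda>u. 1 / 2 * th x u)" using dual_th[of x] unfolding dual_iff by (simp add: algebra_simps)
    ultimately show "x \<in> W" unfolding W_iff by blast
  qed
  show "W \<subseteq> N \<inter> Mss"
  proof
    fix x assume "x \<in> W"
    then obtain \<theta> where \<theta>: "dual \<theta>" "x = Y \<theta>" unfolding W_iff by blast
    have "Y \<theta> \<in> T" unfolding T_iff trL_Y[OF \<theta>(1)] n1 by simp
    then show "x \<in> N \<inter> Mss" using \<theta> Y_in_C Y_in_Mss by (simp add: mod_N_def)
  qed
qed

text \<open>With n + 1 = 0 the elements of \<open>W\<close> have no trace, so
  \<open>trL + trR\<close> vanishes on \<open>Mss\<close> too. Conversely its vanishing says that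
  half the symmetrisation already lies in \<open>N\<close>.\<close>

lemma N_plus_Mss_of_not_unit:
  assumes two: "(2::'a) \<noteq> 0" and n1: "of_nat CARD('n) + (1::'a) = 0"
  shows "N + Mss = {x. \<forall>u. trL x u + trR x u = 0}"
proof
  have N: "trL a u + trR a u = 0" if "a \<in> N" for a u
    using that C_symm[of a] trL_symm[of a u] by (simp add: mod_N_def T_iff trL_svec)
  have M: "trL b u + trR b u = 0" if "b \<in> Mss" for b u
    unfolding trL_symm[symmetric] Mss_symm[OF that] trL_Y[OF dual_th] n1 by simp
  have "trL (a + b) u + trR (a + b) u = 0" if "a \<in> N" "b \<in> Mss" for a b u
  proof -
    have "trL (a + b) u + trR (a + b) u = (trL a u + trR a u) + (trL b u + trR b u)"
      by (simp add: trL_svec trR_svec)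
    then show ?thesis by (simp only: N[OF that(1)] M[OF that(2)] add_0)
  qed
  then show "N + Mss \<subseteq> {x. \<forall>u. trL x u + trR x u = 0}" by (auto elim!: set_plus_elim)
  show "{x. \<forall>u. trL x u + trR x u = 0} \<subseteq> N + Mss"
  proof
    fix x assume x: "x \<in> {x. \<forall>u. trL x u + trR x u = 0}"
    let ?s = "(1 / 2) *s symm x"
    have "trL ?s u = 0" for u using x by (simp add: trL_svec trL_symm)
    then have "?s \<in> N" using half_symm_in_C by (simp add: mod_N_def T_iff)
    moreover have "x - ?s \<in> Mss" using diff_half_symm_in_K[OF two] K_subset_Mss by blast
    ultimately have "?s + (x - ?s) \<in> N + Mss" by (rule set_plus_intro)
    then show "x \<in> N + Mss" by simp
  qed
qed

text \<open>A transvection acts on functionals by \<theta> -> \<theta> +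
  \<theta>(\<open>v k\<close>) c_l, and c_l is itself fixed; \<open>Y\<close> carries this to
  \<open>W\<close>.\<close>

lemma Y_second_difference:
  assumes \<theta>: "dual \<theta>" and kl: "k \<noteq> l"
  shows "act (act (Y \<theta>) (tv (\<lambda>u. c u l) (v k))) (tv (\<lambda>u. c u l) (v k))
    + (- 2) *s act (Y \<theta>) (tv (\<lambda>u. c u l) (v k)) + Y \<theta> = 0"
proof -
  let ?g = "tv (\<lambda>u. c u l) (v k)"
  have l0: "c (v k) l = 0" using kl by (simp add: coord_basis)
  have g: "?g \<in> G" by (rule tv_GL[OF dual_coord l0])
  have d: "dual (\<lambda>u. \<theta> (?g u))" "dual (\<lambda>u. \<theta> (?g (?g u)))"
    using \<theta> by (simp_all add: dual_iff GL_add[OF g] GL_scale[OF g])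
  have a: "act (act (Y \<theta>) ?g) ?g = Y (\<lambda>u. \<theta> (?g (?g u)))" "act (Y \<theta>) ?g = Y (\<lambda>u. \<theta> (?g u))"
    using Y_act[OF \<theta> g] Y_act[OF d(1) g] by simp_all
  have t1: "\<theta> (?g u) = \<theta> u + c u l * \<theta> (v k)" for u
    using \<theta> by (simp add: tv_def dual_simps)
  have t2: "\<theta> (?g (?g u)) = \<theta> u + 2 * c u l * \<theta> (v k)" for u
    using \<theta> kl by (simp add: tv_def dual_simps coord_simps algebra_simps)
  show ?thesis
  proof (rule svec_eqI, rule coord_eqI)
    fix u w i
    show "c (br (act (act (Y \<theta>) ?g) ?g + (- 2) *s act (Y \<theta>) ?g + Y \<theta>) u w) i = c (br 0 u w) i"
      unfolding a(1) unfolding a(2) br_svec br_Y[OF d(1)] br_Y[OF d(2)] br_Y[OF \<theta>] unfolding t2 unfolding t1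
      by (simp add: coord_simps algebra_simps)
  qed
qed

text \<open>The second difference of the square c_k^2 along c_k -> c_k + c_l is 2 c_l^2, and the
  value \<open>v i\<close> is fixed.\<close>

lemma E_second_difference:
  assumes "k \<noteq> l" "k \<noteq> i" "l \<noteq> i"
  shows "act (act (E k k i) (tv (\<lambda>u. c u l) (v k))) (tv (\<lambda>u. c u l) (v k))
    + (- 2) *s act (E k k i) (tv (\<lambda>u. c u l) (v k)) + E k k i = 2 *s E l l i"
proof -
  have l0: "c (v k) l = 0" using assms by (simp add: coord_basis)
  show ?thesis
    by (rule svec_eqI, rule coord_eqI)
      (use assms in \<open>simp add: br_svec br_act_tv[OF dual_coord l0] br_E coord_simps algebra_simps\<close>)
qed

text \<open>A transvection \<open>g\<close> satisfies \<open>(g - 1)\<^sup>2 = 0\<close> on \<open>W\<close>. An isomorphism from \<open>\<Lambda>/Mss\<close> to \<open>N\<close>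
  would carry a submodule containing \<open>(N + Mss)/Mss\<close> onto \<open>W\<close>, but \<open>(g - 1)\<^sup>2\<close> does not vanish there.\<close>

lemma not_giso_of_not_unit:
  assumes two: "(2::'a) \<noteq> 0" and n1: "of_nat CARD('n) + (1::'a) = 0"
  shows "\<not> giso G (gquot \<Lambda> Mss) (grestrict \<Lambda> N)"
proof
  assume "giso G (gquot \<Lambda> Mss) (grestrict \<Lambda> N)"
  then obtain f where f: "gepi G \<Lambda> (grestrict \<Lambda> N) f Mss"
    using \<Lambda>.gepi_giso[OF \<Lambda>.gepi_gcoset[OF gsubmodule_Mss] _ \<Lambda>.gmodule_grestrict[OF gsubmodule_N]] by blast
  have WN: "W \<subseteq> N" using N_Int_Mss_of_not_unit[OF two n1] by blast
  have fD: "f (x + y) = f x + f y" "f (t *s x) = t *s f x" "g \<in> G \<Longrightarrow> f (act x g) = act (f x) g"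
    "f ` UNIV = N" "x \<in> Mss \<longleftrightarrow> f x = 0" for x y t g
    using gepiD[OF f] by (simp_all add: grestrict_def svec_module_def)
  define X where "X = {x. f x \<in> W}"
  have "gsubmodule G (grestrict \<Lambda> N) W"
    using \<Lambda>.gsubmodule_grestrict_iff[OF gsubmodule_N] gsubmodule_W WN by blast
  from \<Lambda>.gsubmodule_preimage[OF f this] have X: "gsubmodule G \<Lambda> X" by (simp add: X_def gcarrier_\<Lambda>)
  have "\<not> X \<subseteq> Mss"
  proof -
    obtain w where w: "w \<in> W" "w \<noteq> 0" using gcover_0_W unfolding gcover_def by blast
    then obtain x where "f x = w" using WN fD(4) by (metis imageE subsetD)
    then show ?thesis using w fD(5) by (auto simp: X_def)
  qed
  \<comment> \<open>X is the preimage of \<open>W\<close>, which is nonzero, so the dichotomy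
    applies and f sends \<open>N\<close> into \<open>W\<close>.\<close>
  then have "N \<subseteq> X" using N_subset_of_not_subset_Mss[OF X] by blast
  obtain k l i :: 'n where ne: "k \<noteq> l" "k \<noteq> i" "l \<noteq> i" by (rule basis_indices)
  have "f (E k k i) \<in> W" using \<open>N \<subseteq> X\<close> E_diag_in_N[OF ne(2)] X_def by blast
  then obtain \<theta> where \<theta>: "dual \<theta>" "f (E k k i) = Y \<theta>" unfolding W_iff by blast
  have g: "tv (\<lambda>u. c u l) (v k) \<in> G" by (rule tv_GL[OF dual_coord]) (use ne in \<open>simp add: coord_basis\<close>)
  have "f (2 *s E l l i) = 0"
    unfolding E_second_difference[OF ne, symmetric] fD(1,2) fD(3)[OF g] \<theta>(2)
    by (rule Y_second_difference[OF \<theta>(1) ne(1)])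
  then have "2 *s E l l i \<in> Mss" using fD(5) by blast
  then show False using gsubmodule_smult_cancel[OF gsubmodule_Mss _ two] E_diag_notin_Mss[OF ne(3)] by blast
qed

section \<open>Assembling the two cases with 2 invertible\<close>

lemma giso_N_quotient: "giso G (gsection \<Lambda> Mss (N + Mss)) (gsection \<Lambda> (N \<inter> Mss) N)"
  by (rule giso_second[OF gsubmodule_N gsubmodule_Mss])

lemma gmodule_gsection:
  assumes "gsubmodule G \<Lambda> A" "gsubmodule G \<Lambda> B" "A \<subseteq> B"
  shows "gmodule G (gsection \<Lambda> A B)"
  using gmodule.gmodule_gepi[OF \<Lambda>.gmodule_grestrict[OF assms(2)] \<Lambda>.gepi_gsection[OF assms]] .

lemma gepi_gquot: "gsubmodule G \<Lambda> A \<Longrightarrow> gepi G (grestrict \<Lambda> UNIV) (gquot \<Lambda> A) (gcoset \<Lambda> A) A"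
  unfolding grestrict_UNIV by (rule \<Lambda>.gepi_gcoset)

lemma giso_gsection_0: "gsubmodule G \<Lambda> B \<Longrightarrow> giso G (gsection \<Lambda> {0} B) (grestrict \<Lambda> B)"
  by (rule \<Lambda>.giso_gsection[OF _ gepi_id])

lemma giso_V_hat_sym: "giso G M V_hat \<Longrightarrow> gmodule G M \<Longrightarrow> giso G V_hat M"
  by (rule gmodule.giso_sym)

theorem case_unit:
  assumes two: "(2::'a) \<noteq> 0" and n1: "of_nat CARD('n) + (1::'a) \<noteq> 0"
  shows "N + Mss = gcarrier \<Lambda> \<and> N \<inter> Mss = {0} \<and>
    giso G (gquot \<Lambda> Mss) (grestrict \<Lambda> N) \<and> girreducible G (grestrict \<Lambda> N)"
    and "same_comp_factors G (gquot \<Lambda> Mss) (grestrict \<Lambda> N)"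
proof -
  note I = N_Int_Mss_of_unit[OF two n1] and S = N_plus_Mss_of_unit[OF two n1]
  have iso: "giso G (gsection \<Lambda> Mss UNIV) (gsection \<Lambda> {0} N)" using giso_N_quotient by (simp add: I S)
  have cov: "gcover G \<Lambda> {0} N" "gcover G \<Lambda> Mss UNIV"
    using gcover_N gcover_N_plus_Mss by (simp_all add: I S)
  show "N + Mss = gcarrier \<Lambda> \<and> N \<inter> Mss = {0} \<and>
    giso G (gquot \<Lambda> Mss) (grestrict \<Lambda> N) \<and> girreducible G (grestrict \<Lambda> N)"
    using I S giso_trans[OF iso giso_gsection_0[OF gsubmodule_N]] cov(1)
      \<Lambda>.girreducible_grestrict_gepi_iff[OF gsubmodule_N gepi_id[OF gsubmodule_N]]
    by (simp add: gcarrier_\<Lambda> grestrict_UNIV)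
  show "same_comp_factors G (gquot \<Lambda> Mss) (grestrict \<Lambda> N)"
    by (rule \<Lambda>.same_comp_factors_gepi[where B = "\<lambda>i. [Mss, UNIV] ! i" and B' = "\<lambda>i. [{0}, N] ! i"
          and k = 1 and f = "gcoset \<Lambda> Mss" and f' = id])
      (simp_all add: gepi_gquot gepi_id gsubmodule_Mss gsubmodule_N gsubmodule_0 cov iso)
qed

text \<open>The series are \<open>Mss\<close> < \<open>N + Mss\<close> < \<Lambda> and 0 <
  \<open>W\<close> < \<open>N\<close>: the copy of the dual is on top in the first and at the bottom
  in the second.\<close>

theorem case_not_unit:
  assumes two: "(2::'a) \<noteq> 0" and n1: "of_nat CARD('n) + (1::'a) = 0"
  shows "N \<inter> Mss = W \<and>
      girreducible G (gquot (grestrict \<Lambda> (N + Mss)) Mss) \<and>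
      giso G (gquot (grestrict \<Lambda> (N + Mss)) Mss) (gquot (grestrict \<Lambda> N) W) \<and>
      giso G (gquot \<Lambda> (N + Mss)) V_hat \<and>
      \<not> giso G (gquot \<Lambda> Mss) (grestrict \<Lambda> N)"
    and "same_comp_factors G (gquot \<Lambda> Mss) (grestrict \<Lambda> N)"
proof -
  note I = N_Int_Mss_of_not_unit[OF two n1] and S = N_plus_Mss_of_not_unit[OF two n1]
  have iso: "giso G (gsection \<Lambda> Mss (N + Mss)) (gsection \<Lambda> W N)" using giso_N_quotient by (simp add: I)
  have e: "gepi G (grestrict \<Lambda> UNIV) V_hat (\<lambda>x u. trL x u + trR x u) (N + Mss)"
    using gepi_trLR by (simp add: S grestrict_UNIV)
  have iso': "giso G (gsection \<Lambda> (N + Mss) UNIV) V_hat" by (rule \<Lambda>.giso_gsection[OF gsubmodule_UNIV e])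
  have cov: "gcover G \<Lambda> W N" using gcover_N by (simp add: I)
  have cov': "gcover G \<Lambda> (N + Mss) UNIV"
    using \<Lambda>.girreducible_grestrict_gepi_iff[OF gsubmodule_UNIV e] girreducible_V_hat by blast
  show "N \<inter> Mss = W \<and>
      girreducible G (gquot (grestrict \<Lambda> (N + Mss)) Mss) \<and>
      giso G (gquot (grestrict \<Lambda> (N + Mss)) Mss) (gquot (grestrict \<Lambda> N) W) \<and>
      giso G (gquot \<Lambda> (N + Mss)) V_hat \<and>
      \<not> giso G (gquot \<Lambda> Mss) (grestrict \<Lambda> N)"
    using I iso iso' not_giso_of_not_unit[OF two n1] gcover_N_plus_Mss
      \<Lambda>.girreducible_gsection_iff[OF gsubmodule_Mss N_Mss(1) N_Mss(3)]
    by (simp add: grestrict_UNIV)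
  have iso'': "giso G (gsection \<Lambda> (N + Mss) UNIV) (gsection \<Lambda> {0} W)"
    by (rule giso_trans[OF iso' giso_V_hat_sym[OF giso_W_V_hat gmodule_gsection]])
      (use gsubmodule_W gsubmodule_0 in \<open>auto simp: gsubmodule_iff\<close>)
  show "same_comp_factors G (gquot \<Lambda> Mss) (grestrict \<Lambda> N)"
    by (rule \<Lambda>.same_comp_factors_gepi[where B = "\<lambda>i. [Mss, N + Mss, UNIV] ! i" and B' = "\<lambda>i. [{0}, W, N] ! i"
          and k = 2 and f = "gcoset \<Lambda> Mss" and f' = id])
      (auto simp: gepi_gquot gepi_id gsubmodule_Mss gsubmodule_N gsubmodule_0 cov cov' iso iso''
        gcover_N_plus_Mss gcover_0_W less_Suc_eq numeral_2_eq_2)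
qed

end

section \<open>Characteristic 2: symmetrisation as a map onto \<open>K\<close>\<close>

locale algebra_space_char2 = algebra_space sc v
  for sc :: "'a::field \<Rightarrow> 'v::ab_group_add \<Rightarrow> 'v" and v :: "'n::finite \<Rightarrow> 'v" +
  assumes char2: "(1::'a) + 1 = 0"
begin

lemma add_self_vector: "(u::'v) + u = 0"
  using scale_left_distrib[of 1 1 u] by (simp only: char2 scale_zero_left scale_one)

lemma neg_vector: "- (u::'v) = u"
  using add_self_vector by (simp add: neg_eq_iff_add_eq_0)

lemma K_subset_C: "K \<subseteq> C"
  using K_antisym neg_vector by (auto simp: mod_C_def)

lemma symm_eq_0_iff: "symm x = 0 \<longleftrightarrow> x \<in> C"
proof
  assume s: "symm x = 0"
  have "br x u w + br x w u = 0" for u w using br_symm[of x u w] by (simp add: s br_zero)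
  then have "br x u w = br x w u" for u w
    using neg_vector by (metis eq_neg_iff_add_eq_0)
  then show "x \<in> C" by (simp add: mod_C_def)
next
  assume "x \<in> C"
  then show "symm x = 0"
    by (intro svec_eqI) (auto simp: br_symm br_zero mod_C_def add_self_vector)
qed

text \<open>Symmetrisation kills commutative products, while on \<open>Mss\<close> it is
  \<open>Y (th x)\<close> and \<open>Y\<close> is injective; hence \<open>th x\<close> = 0 and x is
  alternating.\<close>

lemma N_Int_Mss_eq_U: "N \<inter> Mss = U"
proof
  show "N \<inter> Mss \<subseteq> U"
  proof
    fix x assume x: "x \<in> N \<inter> Mss"
    then have "symm x = 0" using symm_eq_0_iff by (simp add: mod_N_def)
    then have "Y (th x) = 0" using Mss_symm x by auto
    then have "th x = (\<lambda>u. 0)" using Y_eq_0_iff dual_th by blast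
    then have "x \<in> K" using Mss_square[of x] x by (simp add: mod_K_def)
    then show "x \<in> U" using x by (simp add: mod_U_def mod_N_def)
  qed
  show "U \<subseteq> N \<inter> Mss" using K_subset_C K_subset_Mss by (auto simp: mod_U_def mod_N_def)
qed

lemma symm_in_K: "symm x \<in> K"
  by (simp add: mod_K_def br_symm add_self_vector)

lemma Y_in_K: "dual \<theta> \<Longrightarrow> Y \<theta> \<in> K"
  by (simp add: mod_K_def br_Y add_self_vector)

lemma W_subset_K: "W \<subseteq> K"
  by (auto simp: W_iff Y_in_K)

lemma Y_in_W: "dual \<theta> \<Longrightarrow> Y \<theta> \<in> W"
  by (auto simp: W_iff)

text \<open>Onto because an alternating product is some y - \<open>opp y\<close>, which equals y +
  \<open>opp y\<close> here.\<close>

lemma gepi_symm: "gepi G (grestrict \<Lambda> UNIV) (grestrict \<Lambda> K) symm C"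
proof -
  have "x \<in> range symm" if "x \<in> K" for x
  proof -
    obtain y where y: "x = y - opp y" using K_obtain[OF \<open>x \<in> K\<close>] .
    have "x = symm y"
      by (rule svec_eqI) (simp add: y br_svec br_symm br_opp diff_conv_add_uminus neg_vector del: add_uminus_conv_diff)
    then show ?thesis by blast
  qed
  then have "range symm = K" using symm_in_K by blast
  moreover have "symm (x + y) = symm x + symm y" "symm (t *s x) = t *s symm x" for x y t
    by (rule svec_eqI, simp add: br_symm br_svec scale_right_distrib algebra_simps)+
  moreover have "symm (act x g) = act (symm x) g" if "g \<in> G" for x g
    by (rule svec_eqI) (simp add: that br_symm br_act GL_add inv_GL)
  moreover have "symm 0 = 0" by (simp add: symm_eq_0_iff mod_C_def br_zero)
  ultimately show ?thesis unfolding gepi_iff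
    by (simp add: symm_eq_0_iff grestrict_def svec_module_def)
qed

lemma symm_add: "symm (x + y) = symm x + symm y"
  by (rule svec_eqI) (simp add: br_symm br_svec algebra_simps)

definition pre :: "('a, 'n) svec set \<Rightarrow> ('a, 'n) svec set" where "pre A = {x. symm x \<in> A}"

lemma gsubmodule_pre:
  assumes "gsubmodule G \<Lambda> A" "A \<subseteq> K"
  shows "gsubmodule G \<Lambda> (pre A)"
proof -
  have "gsubmodule G (grestrict \<Lambda> K) A" using assms \<Lambda>.gsubmodule_grestrict_iff[OF gsubmodule_K] by blast
  from \<Lambda>.gsubmodule_preimage[OF gepi_symm[unfolded grestrict_UNIV] this]
  show ?thesis by (simp add: pre_def gcarrier_\<Lambda>)
qed

text \<open>Sections between preimages are the sections of \<open>K\<close> below them, so covers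
  and isomorphism types in \<open>K\<close> lift to \<Lambda>.\<close>

lemma gepi_pre:
  assumes A: "gsubmodule G \<Lambda> A" and B: "gsubmodule G \<Lambda> B" and "A \<subseteq> B" "B \<subseteq> K"
  shows "gepi G (grestrict \<Lambda> (pre B)) (gsection \<Lambda> A B) (gcoset (grestrict \<Lambda> B) A \<circ> symm) (pre A)"
proof -
  have P: "gsubmodule G \<Lambda> (pre B)" by (rule gsubmodule_pre[OF B \<open>B \<subseteq> K\<close>])
  interpret P: gmodule G "grestrict \<Lambda> (pre B)" by (rule \<Lambda>.gmodule_grestrict[OF P])
  have "range symm = K" using gepi_symm unfolding gepi_iff by (simp add: grestrict_def)
  moreover have "symm ` pre B = range symm \<inter> B" unfolding pre_def by auto
  ultimately have "symm ` pre B = B" using \<open>B \<subseteq> K\<close> by auto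
  then have "gepi G (grestrict \<Lambda> (pre B)) (grestrict \<Lambda> B) symm (pre B \<inter> C)"
    using \<Lambda>.gepi_grestrict[OF gepi_symm[unfolded grestrict_UNIV] P] by (simp add: grestrict_def)
  from P.gepi_compose[OF this \<Lambda>.gepi_gsection[OF A B \<open>A \<subseteq> B\<close>]]
  have "gepi G (grestrict \<Lambda> (pre B)) (gsection \<Lambda> A B) (gcoset (grestrict \<Lambda> B) A \<circ> symm)
      {x \<in> pre B. symm x \<in> A}" by (simp add: grestrict_def)
  moreover have "{x \<in> pre B. symm x \<in> A} = pre A" using \<open>A \<subseteq> B\<close> unfolding pre_def by blast
  ultimately show ?thesis by simp
qed

lemma giso_pre:
  assumes "gsubmodule G \<Lambda> A" "gsubmodule G \<Lambda> B" "A \<subseteq> B" "B \<subseteq> K"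
  shows "giso G (gsection \<Lambda> (pre A) (pre B)) (gsection \<Lambda> A B)"
  by (rule \<Lambda>.giso_gsection[OF gsubmodule_pre[OF assms(2,4)] gepi_pre[OF assms]])

lemma gcover_pre:
  assumes "gcover G \<Lambda> A B" "B \<subseteq> K"
  shows "gcover G \<Lambda> (pre A) (pre B)"
proof -
  have s: "gsubmodule G \<Lambda> A" "gsubmodule G \<Lambda> B" "A \<subseteq> B" using assms(1) unfolding gcover_def by (simp_all add: psubset_imp_subset)
  show ?thesis
    using \<Lambda>.girreducible_grestrict_gepi_iff[OF gsubmodule_pre[OF s(2) assms(2)] gepi_pre[OF s assms(2)]]
      \<Lambda>.girreducible_gsection_iff[OF s] assms(1) by blast
qed

lemma pre_K: "pre K = UNIV"
  using symm_in_K by (simp add: pre_def)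

text \<open>Allows a trace to be corrected by an element of \<open>K\<close>, which lies in both
  \<open>C\<close> and \<open>Mss\<close>.\<close>

lemma obtain_trace:
  assumes "dual \<phi>"
  obtains k where "k \<in> K" "trL k = \<phi>"
proof -
  have "trL ` K = {\<phi>. dual \<phi>}" using gepi_trL unfolding gepi_iff V_hat_simps by (elim conjE)
  then show thesis using assms that by (metis (mono_tags) imageE mem_Collect_eq)
qed

lemma symm_N: "x \<in> N \<Longrightarrow> symm x = 0"
  by (simp add: symm_eq_0_iff mod_N_def)

lemma pre_W: "pre W = N + Mss"
proof
  show "N + Mss \<subseteq> pre W"
  proof
    fix x assume "x \<in> N + Mss"
    then obtain a b where ab: "a \<in> N" "b \<in> Mss" "x = a + b" by (elim set_plus_elim) blast
    have "symm x = Y (th b)" using ab by (simp add: symm_add symm_N Mss_symm)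
    then show "x \<in> pre W" by (simp add: pre_def Y_in_W dual_th)
  qed
  show "pre W \<subseteq> N + Mss"
  proof
    fix x assume "x \<in> pre W"
    then obtain \<theta> where \<theta>: "dual \<theta>" "symm x = Y \<theta>" unfolding pre_def W_iff by blast
    \<comment> \<open>\<open>R \<theta>\<close> is an element of \<open>Mss\<close> with
      symmetrisation \<open>Y \<theta>\<close>, so subtracting it leaves a commutative
      product.\<close>
    have "symm (x - R \<theta>) = 0"
    proof (rule svec_eqI)
      fix u w
      have "br x u w + br x w u = sc (\<theta> w) u + sc (\<theta> u) w"
        using br_symm[of x u w] br_Y[OF \<theta>(1), of u w] \<theta>(2) by simp
      then show "br (symm (x - R \<theta>)) u w = br 0 u w"
        by (simp add: br_symm br_svec br_R[OF \<theta>(1)] algebra_simps)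
    qed
    then have C: "x - R \<theta> \<in> C" using symm_eq_0_iff by blast
    \<comment> \<open>The remaining trace is moved from the commutative summand to the
      \<open>Mss\<close> summand.\<close>
    obtain k where k: "k \<in> K" "trL k = trL (x - R \<theta>)" using obtain_trace[OF dual_trL] .
    have "x - R \<theta> - k \<in> C" using C k(1) K_subset_C gsubmodule_diff[OF gsubmodule_C] by blast
    moreover have "trL (x - R \<theta> - k) u = 0" for u using trL_svec(4)[of "x - R \<theta>" k u] k(2) by simp
    ultimately have "x - R \<theta> - k \<in> N" by (simp add: mod_N_def T_iff)
    moreover have "k + R \<theta> \<in> Mss"
    proof -
      have "R \<theta> \<in> Mss" unfolding mod_Mss_def using br_R[OF \<theta>(1)] by blast
      then show ?thesis using k(1) K_subset_Mss gsubmodule_Mss unfolding gsubmodule_iff by blast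
    qed
    ultimately have "(x - R \<theta> - k) + (k + R \<theta>) \<in> N + Mss" by (rule set_plus_intro)
    then show "x \<in> N + Mss" by simp
  qed
qed

lemma trR_K: "k \<in> K \<Longrightarrow> trR k u = - trL k u"
proof -
  assume "k \<in> K"
  then have "symm k = 0" using K_subset_C symm_eq_0_iff by blast
  then have "trL k u + trR k u = 0" using trL_symm[of k u] by (simp add: trL_svec)
  then show ?thesis by (simp add: eq_neg_iff_add_eq_0 add.commute)
qed

lemma W_subset_U:
  assumes "of_nat CARD('n) + (1::'a) = 0"
  shows "W \<subseteq> U"
  by (auto simp: W_iff U_eq Y_in_K trL_Y assms)

lemma pre_U:
  assumes n1: "of_nat CARD('n) + (1::'a) = 0"
  shows "pre U = T \<inter> T' + Mss"
proof
  show "T \<inter> T' + Mss \<subseteq> pre U"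
  proof
    fix x assume "x \<in> T \<inter> T' + Mss"
    then obtain a b where ab: "a \<in> T" "a \<in> T'" "b \<in> Mss" "x = a + b" by (elim set_plus_elim) blast
    have "symm a \<in> U" using ab symm_in_K by (simp add: U_eq trL_symm T_iff T'_iff)
    moreover have "symm b \<in> U"
      unfolding Mss_symm[OF ab(3)] using W_subset_U[OF n1] Y_in_W[OF dual_th] by (rule subsetD)
    ultimately have "symm a + symm b \<in> U" using gsubmodule_U unfolding gsubmodule_iff by blast
    then show "x \<in> pre U" using ab(4) symm_add by (simp add: pre_def)
  qed
  show "pre U \<subseteq> T \<inter> T' + Mss"
  proof
    fix x assume "x \<in> pre U"
    then have x: "trR x u = - trL x u" for u
      using trL_symm[of x u] by (simp add: pre_def U_eq eq_neg_iff_add_eq_0 add.commute)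
    \<comment> \<open>The right trace is minus the left one both for x and for k, so one correction
      makes both traces of x - k vanish.\<close>
    obtain k where k: "k \<in> K" "trL k = trL x" using obtain_trace[OF dual_trL] .
    have "x - k \<in> T \<inter> T'" by (simp add: T_iff T'_iff trL_svec trR_svec x trR_K[OF k(1)] k(2))
    moreover have "k \<in> Mss" using k(1) K_subset_Mss by blast
    ultimately have "(x - k) + k \<in> T \<inter> T' + Mss" by (rule set_plus_intro)
    then show "x \<in> T \<inter> T' + Mss" by simp
  qed
qed

text \<open>When n is even, \<open>trL (Y \<theta>)\<close> = \<theta>, so \<open>Y\<close> splits
  the trace on \<open>K\<close> and the map is the projection of \<open>K\<close> = \<open>U\<close>
  + \<open>W\<close> onto \<open>U\<close>.\<close>

lemma gepi_proj:
  assumes n1: "of_nat CARD('n) + (1::'a) = 1"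
  shows "gepi G (grestrict \<Lambda> K) (grestrict \<Lambda> U) (\<lambda>k. k - Y (trL k)) W"
proof -
  define p where "p k = k - Y (trL k)" for k
  have trY: "trL (Y \<theta>) = \<theta>" if "dual \<theta>" for \<theta> using trL_Y[OF that] n1 by auto
  have pU: "p k \<in> U" if "k \<in> K" for k
    using that Y_in_K[OF dual_trL] gsubmodule_diff[OF gsubmodule_K]
    by (simp add: p_def U_eq trL_svec trY dual_trL)
  have "p u = u" if "u \<in> U" for u
  proof -
    have "trL u = (\<lambda>u. 0)" using that by (auto simp: U_eq)
    then show ?thesis by (simp add: p_def Y_0)
  qed
  then have "p ` K = U" using pU by (force simp: U_eq)
  moreover have "p (x + y) = p x + p y" for x y
  proof -
    have "trL (x + y) = (\<lambda>u. trL x u + trL y u)" by (rule ext) (rule trL_svec)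
    then show ?thesis by (simp add: p_def Y_add dual_trL)
  qed
  moreover have "p (t *s x) = t *s p x" for x t
  proof -
    have "trL (t *s x) = (\<lambda>u. t * trL x u)" by (rule ext) (rule trL_svec)
    then show ?thesis by (simp add: p_def Y_smult dual_trL vec_eq_iff algebra_simps)
  qed
  moreover have "p (act x g) = act (p x) g" if g: "g \<in> G" for x g
  proof -
    have "trL (act x g) = (\<lambda>u. trL x (g u))" using trL_act[OF g] by blast
    then have "p (act x g) = act x g - act (Y (trL x)) g" by (simp add: p_def Y_act dual_trL g)
    also have "\<dots> = act (x - Y (trL x)) g"
      by (rule svec_eqI) (simp add: br_svec br_act g lin_diff[OF GL_D(1)[OF inv_GL[OF g]]])
    finally show ?thesis by (simp add: p_def)
  qed
  moreover have "p 0 = 0"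
  proof -
    have "trL 0 = (\<lambda>u. 0)" by (rule ext) (rule trL_svec)
    then show ?thesis by (simp add: p_def Y_0)
  qed
  moreover have "W = {x \<in> K. p x = 0}"
  proof -
    have "p x = 0" if x: "x \<in> W" for x
    proof -
      obtain \<theta> where "dual \<theta>" "x = Y \<theta>" using x unfolding W_iff by blast
      then show ?thesis by (simp add: p_def trY)
    qed
    moreover have "x \<in> W" if "p x = 0" for x
    proof -
      have "x = Y (trL x)" using that by (simp add: p_def)
      then show ?thesis using Y_in_W[OF dual_trL] by metis
    qed
    ultimately show ?thesis using W_subset_K by blast
  qed
  ultimately have "gepi G (grestrict \<Lambda> K) (grestrict \<Lambda> U) p W"
    unfolding gepi_iff by (simp add: grestrict_def svec_module_def)
  then show ?thesis by (simp add: p_def[abs_def])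
qed

lemma U_not_subset_W: "\<not> U \<subseteq> W"
proof
  assume "U \<subseteq> W"
  obtain k l i :: 'n where ne: "k \<noteq> l" "k \<noteq> i" "l \<noteq> i" by (rule basis_indices)
  have "alt k l i \<in> W" using alt_in_U[OF ne] \<open>U \<subseteq> W\<close> by blast
  then obtain \<theta> where \<theta>: "dual \<theta>" "alt k l i = Y \<theta>" unfolding W_iff by blast
  have "c (br (alt k l i) (v k) (v l)) i = c (br (Y \<theta>) (v k) (v l)) i" by (simp only: \<theta>(2))
  then show False using ne by (simp add: br_svec br_E br_Y[OF \<theta>(1)] coord_simps)
qed

lemma U_subset_K: "U \<subseteq> K"
  by (simp add: mod_U_def)

text \<open>For n odd \<open>W\<close> lies inside \<open>U\<close>; a submodule of \<open>U\<close>
  is either inside \<open>W\<close> or all of \<open>U\<close>.\<close>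

lemma gcover_W_U:
  assumes n1: "of_nat CARD('n) + (1::'a) = 0"
  shows "gcover G \<Lambda> W U"
  unfolding gcover_def
proof (intro conjI allI impI gsubmodule_W gsubmodule_U)
  show "W \<subset> U" using W_subset_U[OF n1] U_not_subset_W by blast
  fix S assume S: "gsubmodule G \<Lambda> S \<and> W \<subseteq> S \<and> S \<subseteq> U"
  then have "S \<subseteq> K" using U_subset_K by blast
  show "S = W \<or> S = U"
  proof (cases "S \<subseteq> W")
    case False
    then have "U \<subseteq> S" using U_subset_of_not_subset_W[OF char2 _ \<open>S \<subseteq> K\<close>] S by blast
    then show ?thesis using S by blast
  qed (use S in blast)
qed

lemma W_Int_U:
  assumes n1: "of_nat CARD('n) + (1::'a) = 1" and "x \<in> W" "x \<in> U"
  shows "x = 0"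
proof -
  obtain \<theta> where \<theta>: "dual \<theta>" "x = Y \<theta>" using assms(2) unfolding W_iff by blast
  have "\<theta> u = 0" for u using trL_Y[OF \<theta>(1), of u] assms(3) n1 by (simp add: U_eq \<theta>(2))
  then have "\<theta> = (\<lambda>u. 0)" by blast
  then show ?thesis using \<theta>(2) Y_0 by simp
qed

text \<open>For n even \<open>W\<close> meets \<open>U\<close> in 0, so the same alternative makes
  \<open>U\<close> irreducible.\<close>

lemma gcover_0_U:
  assumes n1: "of_nat CARD('n) + (1::'a) = 1"
  shows "gcover G \<Lambda> {0} U"
  unfolding gcover_def
proof (intro conjI allI impI gsubmodule_0 gsubmodule_U)
  have zero: "0 \<in> S" if "gsubmodule G \<Lambda> S" for S using that unfolding gsubmodule_iff by (rule conjunct1)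
  note 0 = zero[OF gsubmodule_U] zero[OF gsubmodule_W]
  have "{0} \<subseteq> W" "{0} \<subseteq> U" using 0 by (simp_all only: insert_subset empty_subsetI simp_thms)
  moreover have "U \<noteq> {0}" using U_not_subset_W \<open>{0} \<subseteq> W\<close> by metis
  ultimately show "{0} \<subset> U" by (simp only: psubset_eq) metis
  fix S assume S: "gsubmodule G \<Lambda> S \<and> {0} \<subseteq> S \<and> S \<subseteq> U"
  then have "S \<subseteq> K" using U_subset_K by blast
  show "S = {0} \<or> S = U"
  proof (cases "S \<subseteq> W")
    case True
    then have "S \<subseteq> {0}" using W_Int_U[OF n1] S by blast
    then show ?thesis using S by blast
  next
    case False
    then have "U \<subseteq> S" using U_subset_of_not_subset_W[OF char2 _ \<open>S \<subseteq> K\<close>] S by blast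
    then show ?thesis using S by blast
  qed
qed

section \<open>Assembling characteristic 2\<close>

lemma giso_sections:
  "giso G (gsection \<Lambda> Mss (N + Mss)) (gsection \<Lambda> U N)"
  "gcover G \<Lambda> U N"
  using giso_N_quotient gcover_N by (simp_all add: N_Int_Mss_eq_U)

theorem case_char2:
  "N \<inter> Mss = U \<and>
     giso G (gquot (grestrict \<Lambda> (N + Mss)) Mss) (gquot (grestrict \<Lambda> N) U) \<and>
     girreducible G (gquot (grestrict \<Lambda> N) U) \<and>
     giso G (gquot (grestrict \<Lambda> (N + Mss)) N) (gquot (grestrict \<Lambda> Mss) U) \<and>
     (\<exists>S. comp_series G (gquot (grestrict \<Lambda> Mss) U) 2 S \<and>
          (\<forall>i<2. giso G (comp_factor (gquot (grestrict \<Lambda> Mss) U) S i) V_hat))"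
proof (intro conjI)
  have UN: "U \<subseteq> N" and UM: "U \<subseteq> Mss" using N_Int_Mss_eq_U by blast+
  show "N \<inter> Mss = U" by (rule N_Int_Mss_eq_U)
  show "giso G (gquot (grestrict \<Lambda> (N + Mss)) Mss) (gquot (grestrict \<Lambda> N) U)" by (rule giso_sections)
  show "girreducible G (gquot (grestrict \<Lambda> N) U)"
    using \<Lambda>.girreducible_gsection_iff[OF gsubmodule_U gsubmodule_N UN] giso_sections(2) by blast
  show "giso G (gquot (grestrict \<Lambda> (N + Mss)) N) (gquot (grestrict \<Lambda> Mss) U)"
    using giso_second[OF gsubmodule_Mss gsubmodule_N]
    by (simp only: N_Int_Mss_eq_U add.commute[of Mss N] Int_commute[of Mss N])
  \<comment> \<open>Both steps are copies of the dual: \<open>K\<close>/\<open>U\<close> through the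
    trace, \<open>Mss\<close>/\<open>K\<close> through the eigenvalue functional.\<close>
  define B where "B i = [U, K, Mss] ! i" for i
  have B: "B 0 = U" "B 1 = K" "B 2 = Mss" by (simp_all add: B_def)
  have e: "gepi G (grestrict \<Lambda> (B 2)) (gsection \<Lambda> U Mss) (gcoset (grestrict \<Lambda> Mss) U) (B 0)"
    unfolding B by (rule \<Lambda>.gepi_gsection[OF gsubmodule_U gsubmodule_Mss UM])
  have s: "gsubmodule G \<Lambda> (B 0)" unfolding B by (rule gsubmodule_U)
  have cov: "gcover G \<Lambda> (B i) (B (Suc i))" if "i < 2" for i
    using that gcover_U_K gcover_K_Mss by (auto simp: less_Suc_eq numeral_2_eq_2 B_def)
  have V: "giso G (gsection \<Lambda> (B i) (B (Suc i))) V_hat" if "i < 2" for i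
    using that giso_K_V_hat giso_Mss_V_hat by (auto simp: less_Suc_eq numeral_2_eq_2 B_def)
  show "\<exists>S. comp_series G (gquot (grestrict \<Lambda> Mss) U) 2 S \<and>
          (\<forall>i<2. giso G (comp_factor (gquot (grestrict \<Lambda> Mss) U) S i) V_hat)"
    using \<Lambda>.comp_series_gepi(1)[OF e s cov] giso_trans[OF \<Lambda>.comp_series_gepi(2)[OF e s cov] V] by blast
qed

theorem case_char2_even:
  assumes n1: "of_nat CARD('n) + (1::'a) = 1"
  shows "girreducible G (gquot \<Lambda> (N + Mss)) \<and> giso G (gquot \<Lambda> (N + Mss)) (grestrict \<Lambda> U)"
    and "same_comp_factors G (gquot \<Lambda> Mss) (grestrict \<Lambda> N)"
proof -
  have cov: "gcover G \<Lambda> (N + Mss) UNIV" and iso: "giso G (gsection \<Lambda> (N + Mss) UNIV) (grestrict \<Lambda> U)"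
  proof -
    obtain f where e: "gepi G (grestrict \<Lambda> UNIV) (grestrict \<Lambda> U) f (N + Mss)"
    proof
      \<comment> \<open>Symmetrise onto \<open>K\<close>, then project along \<open>W\<close>; the
        kernel is the preimage of \<open>W\<close>, that is \<open>N + Mss\<close>.\<close>
      have "gepi G \<Lambda> (grestrict \<Lambda> U) ((\<lambda>k. k - Y (trL k)) \<circ> symm) {x \<in> gcarrier \<Lambda>. symm x \<in> W}"
        by (rule \<Lambda>.gepi_compose[OF gepi_symm[unfolded grestrict_UNIV] gepi_proj[OF n1]])
      then show "gepi G (grestrict \<Lambda> UNIV) (grestrict \<Lambda> U) ((\<lambda>k. k - Y (trL k)) \<circ> symm) (N + Mss)"
        by (simp add: grestrict_UNIV gcarrier_\<Lambda> pre_W[symmetric] pre_def)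
    qed
    have "girreducible G (grestrict \<Lambda> U)"
      using \<Lambda>.girreducible_grestrict_gepi_iff[OF gsubmodule_U gepi_id[OF gsubmodule_U]] gcover_0_U[OF n1] by blast
    then show "gcover G \<Lambda> (N + Mss) UNIV"
      using \<Lambda>.girreducible_grestrict_gepi_iff[OF gsubmodule_UNIV e] by blast
    show "giso G (gsection \<Lambda> (N + Mss) UNIV) (grestrict \<Lambda> U)"
      by (rule \<Lambda>.giso_gsection[OF gsubmodule_UNIV e])
  qed
  show "girreducible G (gquot \<Lambda> (N + Mss)) \<and> giso G (gquot \<Lambda> (N + Mss)) (grestrict \<Lambda> U)"
    using iso cov \<Lambda>.girreducible_gsection_iff[OF N_Mss(1) gsubmodule_UNIV] by (simp add: grestrict_UNIV)
  interpret U0: gmodule G "gsection \<Lambda> {0} U"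
    by (rule gmodule_gsection[OF gsubmodule_0 gsubmodule_U]) (use gcover_0_U[OF n1] in \<open>auto simp: gcover_def\<close>)
  have iso0: "giso G (gsection \<Lambda> (N + Mss) UNIV) (gsection \<Lambda> {0} U)"
    by (rule giso_trans[OF iso U0.giso_sym[OF giso_gsection_0[OF gsubmodule_U]]])
  show "same_comp_factors G (gquot \<Lambda> Mss) (grestrict \<Lambda> N)"
    by (rule \<Lambda>.same_comp_factors_gepi[where B = "\<lambda>i. [Mss, N + Mss, UNIV] ! i" and B' = "\<lambda>i. [{0}, U, N] ! i"
          and k = 2 and f = "gcoset \<Lambda> Mss" and f' = id])
      (auto simp: gepi_gquot gepi_id gsubmodule_Mss gsubmodule_N gsubmodule_0 cov giso_sections iso0
        gcover_N_plus_Mss gcover_0_U[OF n1] less_Suc_eq numeral_2_eq_2)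
qed

theorem case_char2_odd:
  assumes n1: "of_nat CARD('n) + (1::'a) = 0"
  shows "has_comp_length G (gquot \<Lambda> (N + Mss)) 2 \<and>
      has_comp_length G (grestrict \<Lambda> U) 2 \<and>
      same_comp_factors G (gquot \<Lambda> (N + Mss)) (grestrict \<Lambda> U) \<and>
      N + Mss \<subset> T \<inter> T' + Mss \<and> T \<inter> T' + Mss \<subset> gcarrier \<Lambda> \<and>
      girreducible G (gquot (grestrict \<Lambda> (T \<inter> T' + Mss)) (N + Mss)) \<and>
      girreducible G (gquot \<Lambda> (T \<inter> T' + Mss))"
    and "same_comp_factors G (gquot \<Lambda> Mss) (grestrict \<Lambda> N)"
proof -
  let ?P = "T \<inter> T' + Mss"
  have WU: "W \<subseteq> U" by (rule W_subset_U[OF n1])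
  have P: "gsubmodule G \<Lambda> ?P" using gsubmodule_pre[OF gsubmodule_U U_subset_K] by (simp add: pre_U[OF n1])
  have cov1: "gcover G \<Lambda> (N + Mss) ?P"
    using gcover_pre[OF gcover_W_U[OF n1] U_subset_K] by (simp add: pre_W pre_U[OF n1])
  have cov2: "gcover G \<Lambda> ?P UNIV"
    using gcover_pre[OF gcover_U_K] by (simp add: pre_K pre_U[OF n1])
  have iso1: "giso G (gsection \<Lambda> (N + Mss) ?P) (gsection \<Lambda> W U)"
    using giso_pre[OF gsubmodule_W gsubmodule_U WU U_subset_K] by (simp add: pre_W pre_U[OF n1])
  \<comment> \<open>The top section is carried to \<open>K\<close>/\<open>U\<close>, and both this
    and \<open>W\<close> are copies of the dual; this matches the top of \<Lambda> with the bottom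
    of \<open>U\<close>.\<close>
  have iso2: "giso G (gsection \<Lambda> ?P UNIV) (gsection \<Lambda> {0} W)"
  proof -
    have 1: "giso G (gsection \<Lambda> ?P UNIV) (gsection \<Lambda> U K)"
      using giso_pre[OF gsubmodule_U gsubmodule_K U_subset_K] by (simp add: pre_K pre_U[OF n1])
    have 2: "giso G V_hat (gsection \<Lambda> {0} W)"
      by (rule giso_V_hat_sym[OF giso_W_V_hat gmodule_gsection[OF gsubmodule_0 gsubmodule_W]])
        (use gsubmodule_W in \<open>simp add: gsubmodule_iff\<close>)
    show ?thesis by (rule giso_trans[OF giso_trans[OF 1 giso_K_V_hat] 2])
  qed
  define A where "A i = [N + Mss, ?P, UNIV] ! i" for i
  define B where "B i = [{0}, W, U] ! i" for i
  have A: "A 0 = N + Mss" "A 2 = UNIV" and B: "B 0 = {0}" "B 2 = U" by (simp_all add: A_def B_def)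
  have eA: "gepi G (grestrict \<Lambda> (A 2)) (gquot \<Lambda> (N + Mss)) (gcoset \<Lambda> (N + Mss)) (A 0)"
    unfolding A by (rule gepi_gquot[OF N_Mss(1)])
  have eB: "gepi G (grestrict \<Lambda> (B 2)) (grestrict \<Lambda> U) id (B 0)"
    unfolding B by (rule gepi_id[OF gsubmodule_U])
  have A0: "gsubmodule G \<Lambda> (A 0)" and B0: "gsubmodule G \<Lambda> (B 0)"
    unfolding A B by (rule N_Mss(1), rule gsubmodule_0)
  have covA: "gcover G \<Lambda> (A i) (A (Suc i))" if "i < 2" for i
    using that cov1 cov2 by (auto simp: less_Suc_eq numeral_2_eq_2 A_def)
  have covB: "gcover G \<Lambda> (B i) (B (Suc i))" if "i < 2" for i
    using that gcover_0_W gcover_W_U[OF n1] by (auto simp: less_Suc_eq numeral_2_eq_2 B_def)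
  have isoAB: "giso G (gsection \<Lambda> (A i) (A (Suc i))) (gsection \<Lambda> (B (2 - Suc i)) (B (Suc (2 - Suc i))))"
    if "i < 2" for i
    using that iso1 iso2 by (auto simp: less_Suc_eq numeral_2_eq_2 A_def B_def)
  show "has_comp_length G (gquot \<Lambda> (N + Mss)) 2 \<and>
      has_comp_length G (grestrict \<Lambda> U) 2 \<and>
      same_comp_factors G (gquot \<Lambda> (N + Mss)) (grestrict \<Lambda> U) \<and>
      N + Mss \<subset> ?P \<and> ?P \<subset> gcarrier \<Lambda> \<and>
      girreducible G (gquot (grestrict \<Lambda> ?P) (N + Mss)) \<and>
      girreducible G (gquot \<Lambda> ?P)"
  proof (intro conjI)
    show "has_comp_length G (gquot \<Lambda> (N + Mss)) 2"
      unfolding has_comp_length_def using \<Lambda>.comp_series_gepi(1)[OF eA A0 covA] by blast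
    show "has_comp_length G (grestrict \<Lambda> U) 2"
      unfolding has_comp_length_def using \<Lambda>.comp_series_gepi(1)[OF eB B0 covB] by blast
    show "same_comp_factors G (gquot \<Lambda> (N + Mss)) (grestrict \<Lambda> U)"
      by (rule \<Lambda>.same_comp_factors_gepi[OF eA A0 covA eB B0 covB isoAB])
    show NP: "N + Mss \<subset> ?P" using cov1 unfolding gcover_def by (elim conjE)
    show PU: "?P \<subset> gcarrier \<Lambda>" using cov2 unfolding gcover_def gcarrier_\<Lambda> by (elim conjE)
    show "girreducible G (gquot (grestrict \<Lambda> ?P) (N + Mss))"
      using \<Lambda>.girreducible_gsection_iff[OF N_Mss(1) P psubset_imp_subset[OF NP]] cov1 by blast
    show "girreducible G (gquot \<Lambda> ?P)"
      using \<Lambda>.girreducible_gsection_iff[OF P gsubmodule_UNIV subset_UNIV] cov2 by (simp add: grestrict_UNIV)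
  qed
  show "same_comp_factors G (gquot \<Lambda> Mss) (grestrict \<Lambda> N)"
    by (rule \<Lambda>.same_comp_factors_gepi[where B = "\<lambda>i. [Mss, N + Mss, ?P, UNIV] ! i"
          and B' = "\<lambda>i. [{0}, W, U, N] ! i" and k = 3 and f = "gcoset \<Lambda> Mss" and f' = id])
      (auto simp: gepi_gquot gepi_id gsubmodule_Mss gsubmodule_N gsubmodule_0 cov1 cov2 giso_sections iso1 iso2
        gcover_N_plus_Mss gcover_0_W gcover_W_U[OF n1] less_Suc_eq numeral_3_eq_3)
qed

end

section \<open>Translation from the characteristic to identities in the field\<close>

theorem mainTheorem5:
  fixes sc :: "'a::field \<Rightarrow> 'v::ab_group_add \<Rightarrow> 'v"
    and v :: "'n::finite \<Rightarrow> 'v"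
    and G :: "('v \<Rightarrow> 'v) set"
    and \<Lambda> :: "('a, 'v \<Rightarrow> 'v, ('a, 'n) svec) gmod"
    and V_hat :: "('a, 'v \<Rightarrow> 'v, 'v \<Rightarrow> 'a) gmod"
    and N Mss Ms11 U T T_tilde :: "('a, 'n) svec set"
  assumes "finite_dimensional_vector_space sc (range v)" and "inj v"
    and "finite (UNIV :: 'a set) \<longrightarrow> card (UNIV :: 'a set) > 2"
    and "CARD('n) \<ge> 3"
    and "G = GL sc"
    and "\<Lambda> = svec_module sc v"
    and "V_hat = dual_module sc"
    and "N = mod_N sc v"
    and "Mss = mod_Mss sc v"
    and "Ms11 = mod_Ms11 sc v"
    and "U = mod_U sc v"
    and "T = mod_T sc v"
    and "T_tilde = mod_T_tilde sc v"
  shows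
    "(CHAR('a) \<noteq> 2 \<and> \<not> CHAR('a) dvd CARD('n) + 1 \<longrightarrow>
       N + Mss = gcarrier \<Lambda> \<and> N \<inter> Mss = {0} \<and>
       giso G (gquot \<Lambda> Mss) (grestrict \<Lambda> N) \<and>
       girreducible G (grestrict \<Lambda> N)) \<and>
     (CHAR('a) \<noteq> 2 \<and> CHAR('a) dvd CARD('n) + 1 \<longrightarrow>
       N \<inter> Mss = Ms11 \<and>
       girreducible G (gquot (grestrict \<Lambda> (N + Mss)) Mss) \<and>
       giso G (gquot (grestrict \<Lambda> (N + Mss)) Mss) (gquot (grestrict \<Lambda> N) Ms11) \<and>
       giso G (gquot \<Lambda> (N + Mss)) V_hat \<and>
       \<not> giso G (gquot \<Lambda> Mss) (grestrict \<Lambda> N)) \<and>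
     (CHAR('a) = 2 \<longrightarrow>
       N \<inter> Mss = U \<and>
       giso G (gquot (grestrict \<Lambda> (N + Mss)) Mss) (gquot (grestrict \<Lambda> N) U) \<and>
       girreducible G (gquot (grestrict \<Lambda> N) U) \<and>
       giso G (gquot (grestrict \<Lambda> (N + Mss)) N) (gquot (grestrict \<Lambda> Mss) U) \<and>
       (\<exists>S. comp_series G (gquot (grestrict \<Lambda> Mss) U) 2 S \<and>
            (\<forall>i<2. giso G (comp_factor (gquot (grestrict \<Lambda> Mss) U) S i) V_hat)) \<and>
       (even CARD('n) \<longrightarrow>
          girreducible G (gquot \<Lambda> (N + Mss)) \<and>
          giso G (gquot \<Lambda> (N + Mss)) (grestrict \<Lambda> U)) \<and>
       (odd CARD('n) \<longrightarrow>
          has_comp_length G (gquot \<Lambda> (N + Mss)) 2 \<and>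
          has_comp_length G (grestrict \<Lambda> U) 2 \<and>
          same_comp_factors G (gquot \<Lambda> (N + Mss)) (grestrict \<Lambda> U) \<and>
          N + Mss \<subset> T \<inter> T_tilde + Mss \<and>
          T \<inter> T_tilde + Mss \<subset> gcarrier \<Lambda> \<and>
          girreducible G (gquot (grestrict \<Lambda> (T \<inter> T_tilde + Mss)) (N + Mss)) \<and>
          girreducible G (gquot \<Lambda> (T \<inter> T_tilde + Mss)))) \<and>
     (same_comp_factors G (gquot \<Lambda> Mss) (grestrict \<Lambda> N))"
proof -
  interpret finite_dimensional_vector_space sc "range v" by (rule assms(1))
  have "\<exists>t::'a. t \<noteq> 0 \<and> t \<noteq> 1"
  proof (rule ccontr)
    assume "\<not> ?thesis"
    then have *: "(UNIV :: 'a set) = {0, 1}" by auto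
    then have "finite (UNIV :: 'a set)" by (metis finite.emptyI finite_insert)
    moreover have "card (UNIV :: 'a set) \<le> 2" unfolding * by (simp add: card_insert_if)
    ultimately show False using assms(3) by simp
  qed
  then interpret algebra_space sc v by unfold_locales (use assms(2,4) in auto)
  \<comment> \<open>As 0 divides only 0, characteristic 0 falls on the non-dividing side, in line
    with the convention.\<close>
  have n1: "of_nat CARD('n) + (1::'a) = 0 \<longleftrightarrow> CHAR('a) dvd CARD('n) + 1"
    using of_nat_eq_0_iff_char_dvd[of "CARD('n) + 1", where 'a = 'a] by (simp add: add.commute)
  have n0: "of_nat CARD('n) = (0::'a) \<longleftrightarrow> CHAR('a) dvd CARD('n)"
    by (rule of_nat_eq_0_iff_char_dvd)
  show ?thesis
  proof (cases "CHAR('a) = 2")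
    case False
    have "CHAR('a) \<noteq> 1" using of_nat_CHAR[where 'a = 'a] by fastforce
    then have "\<not> CHAR('a) dvd 2" using False two_is_prime_nat prime_nat_iff by blast
    then have two: "(2::'a) \<noteq> 0" using of_nat_eq_0_iff_char_dvd[of 2, where 'a = 'a] by simp
    show ?thesis
    proof (cases "CHAR('a) dvd CARD('n) + 1")
      case dvd: True
      show ?thesis unfolding assms(5-13)
        using False dvd case_not_unit[OF two n1[THEN iffD2, OF dvd]] by blast
    next
      case dvd: False
      then have "of_nat CARD('n) + (1::'a) \<noteq> 0" using n1 by blast
      from case_unit[OF two this] show ?thesis unfolding assms(5-13) using False dvd by blast
    qed
  next
    case True
    then have "(1::'a) + 1 = 0" using of_nat_CHAR[where 'a = 'a] by simp
    then interpret algebra_space_char2 sc v by unfold_locales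
    show ?thesis
    \<comment> \<open>In characteristic 2 the parity of n decides whether n + 1 is 1 or 0 in the
      field, the form in which the two subcases were proved.\<close>
    proof (cases "even CARD('n)")
      case even: True
      have "of_nat CARD('n) + (1::'a) = 1" using n0 True even by simp
      from case_char2 case_char2_even[OF this] show ?thesis unfolding assms(5-13) using True even by blast
    next
      case odd: False
      have "of_nat CARD('n) + (1::'a) = 0" using n1 True odd by simp
      from case_char2 case_char2_odd[OF this] show ?thesis unfolding assms(5-13) using True odd by blast
    qed
  qed
qed

end
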